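(* Let $\overline{M} = I\,{}_{h}\!\times_{\rho}\mathbb{P}$ be a doubly warped product spacetime with $\rho'\geq 0$ on $I$, and let $\psi:M\to\overline{M}$ be a complete, noncompact, connected spacelike hypersurface. Let $t_0\in I$ and suppose that $\psi(M)$ is above the slice $\Sigma_{t_0}=\{t_0\}\times\mathbb{P}$ and asymptotic to it at infinity. If the mean curvature function $H$ of $\psi$ in the direction of the future-pointing unit normal satisfies $H\geq\mathcal{H}\circ\psi$ on $M$, where $\mathcal{H}(t,x)=\frac{\rho'(t)}{h(x)\rho(t)}$, then $\psi(M)=\Sigma_{t_0}$.
   Context: Manifolds are smooth and without boundary. Let $(\mathbb{P},\sigma)$ be a connected Riemannian manifold of dimension $m$, $I\subseteq\mathbb{R}$ an open interval, and $h\in C^\infty(\mathbb{P})$, $\rho\in C^\infty(I)$ positive functions. The doubly warped product spacetime $\overline{M}=I\,{}_{h}\!\times_{\rho}\mathbb{P}$ is the product $I\times\mathbb{P}$ endowed with the Lorentzian metric $\overline{g}_{(t,x)}=-h(x)^2\,\pi_I^*(\mathrm{d}t^2)+\rho(t)^2\,\pi_{\mathbb{P}}^*(\sigma)$, where $\pi_I,\pi_{\mathbb{P}}$ are the projections onto the factors; it is time-oriented by the timelike vector field $\partial_t=\partial/\partial t$. A spacelike hypersurface $\psi:M\to\overline{M}$ is a smooth immersion of an $m$-dimensional manifold $M$ such that $g=\psi^*\overline{g}$ is a Riemannian metric; completeness refers to $(M,g)$. There is a unique global unit timelike normal vector field $N$ along $\psi$ with $\overline{g}(N,N)=-1$ and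 $\overline{g}(N,\partial_t)<0$; it is called the future-pointing unit normal. With $\nabla,\overline{\nabla}$ the Levi-Civita connections of $g,\overline{g}$, the second fundamental form is $\mathrm{II}(V,W)=\overline{\nabla}_V W-\nabla_V W$, the mean curvature vector is $\mathbf{H}=\frac{1}{m}\mathrm{trace}_g(\mathrm{II})$, and the mean curvature function in the direction of $N$ is $H=-\overline{g}(\mathbf{H},N)$, so that $\mathbf{H}=HN$. The height function of $\psi$ is $\tau=\pi_I\circ\psi:M\to I$. "$\psi(M)$ is above $\Sigma_{t_0}$" means $\tau\geq t_0$ on $M$; "$\psi(M)$ is asymptotic to $\Sigma_{t_0}$ at infinity" means $\tau(x)\to t_0$ as $x\to\infty$ in $M$, i.e. for every $\varepsilon>0$ there is a compact $K\subseteq M$ with $|\tau-t_0|<\varepsilon$ on $M\setminus K$. *)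

theory Defs
  imports "HOL-Analysis.Analysis"
begin

section \<open>Smooth maps between Euclidean spaces\<close>

text \<open>For open \<^term>\<open>S\<close> and a finite-dimensional domain this is the usual class $C^k$: continuity of
  all iterated directional derivatives up to order \<^term>\<open>k\<close>.\<close>

primrec Ck_on :: "nat \<Rightarrow> 'a::real_normed_vector set \<Rightarrow> ('a \<Rightarrow> 'b::real_normed_vector) \<Rightarrow> bool" where
  "Ck_on 0 S f \<longleftrightarrow> continuous_on S f"
| "Ck_on (Suc k) S f \<longleftrightarrow>
     (\<exists>f'. (\<forall>x\<in>S. (f has_derivative f' x) (at x)) \<and> (\<forall>v. Ck_on k S (\<lambda>x. f' x v)))"

definition smooth_on :: "'a::real_normed_vector set \<Rightarrow> ('a \<Rightarrow> 'b::real_normed_vector) \<Rightarrow> bool" where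
  "smooth_on S f \<longleftrightarrow> (\<forall>k. Ck_on k S f)"


section \<open>Smooth manifolds\<close>

text \<open>A chart is an open set together with a coordinate map; only the values of the map on that set
  matter. A manifold is given by an atlas, which need not be maximal. Its underlying space is the
  union of the chart domains, an open subset of the ambient type.\<close>

type_synonym ('a, 'e) chart = "'a set \<times> ('a \<Rightarrow> 'e)"
type_synonym ('a, 'e) atlas = "('a, 'e) chart set"

abbreviation cdom :: "('a, 'e) chart \<Rightarrow> 'a set" where "cdom \<equiv> fst"
abbreviation cmap :: "('a, 'e) chart \<Rightarrow> 'a \<Rightarrow> 'e" where "cmap \<equiv> snd"
abbreviation cinv :: "('a, 'e) chart \<Rightarrow> 'e \<Rightarrow> 'a" where "cinv c \<equiv> inv_into (cdom c) (cmap c)"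

definition carrier :: "('a, 'e) atlas \<Rightarrow> 'a set" where
  "carrier A = (\<Union>c\<in>A. cdom c)"

text \<open>The dimension of the manifold is that of the model space \<^typ>\<open>'e\<close>. Hausdorffness and second countability are
  inherited from the ambient type.\<close>

definition smooth_manifold ::
  "('a::{t2_space, second_countable_topology}, 'e::euclidean_space) atlas \<Rightarrow> bool" where
  "smooth_manifold A \<longleftrightarrow>
     (\<forall>c\<in>A. open (cdom c) \<and> open (cmap c ` cdom c) \<and>
            homeomorphism (cdom c) (cmap c ` cdom c) (cmap c) (cinv c)) \<and>
     (\<forall>c\<in>A. \<forall>d\<in>A. smooth_on (cmap c ` (cdom c \<inter> cdom d)) (cmap d \<circ> cinv c))"

definition smooth_fun_on ::
  "('a, 'e::euclidean_space) atlas \<Rightarrow> 'a set \<Rightarrow> ('a \<Rightarrow> real) \<Rightarrow> bool" where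
  "smooth_fun_on A W f \<longleftrightarrow> (\<forall>c\<in>A. smooth_on (cmap c ` (cdom c \<inter> W)) (f \<circ> cinv c))"

definition smooth_near ::
  "('a::topological_space, 'e::euclidean_space) atlas \<Rightarrow> 'a \<Rightarrow> ('a \<Rightarrow> real) \<Rightarrow> bool" where
  "smooth_near A p f \<longleftrightarrow> (\<exists>W. open W \<and> p \<in> W \<and> W \<subseteq> carrier A \<and> smooth_fun_on A W f)"

definition smooth_map ::
  "('a::topological_space, 'e::euclidean_space) atlas \<Rightarrow>
   ('b::topological_space, 'f::euclidean_space) atlas \<Rightarrow> ('a \<Rightarrow> 'b) \<Rightarrow> bool" where
  "smooth_map A B \<psi> \<longleftrightarrow>
     \<psi> ` carrier A \<subseteq> carrier B \<and> continuous_on (carrier A) \<psi> \<and>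
     (\<forall>c\<in>A. \<forall>d\<in>B. smooth_on (cmap c ` (cdom c \<inter> \<psi> -` cdom d)) (cmap d \<circ> \<psi> \<circ> cinv c))"


section \<open>Tangent vectors\<close>

text \<open>A tangent vector at \<^term>\<open>p\<close> is a derivation on the functions that are smooth near \<^term>\<open>p\<close>;
  by convention it sends every other function to \<open>0\<close>, so that tangent vectors are equal iff they are
  equal as derivations. The vector \<open>coord_vec A c p u\<close> is $\sum_i u^i\,\partial/\partial x^i|_p$ in the
  chart \<^term>\<open>c\<close>; these vectors make up the tangent space.\<close>

type_synonym 'a tvec = "('a \<Rightarrow> real) \<Rightarrow> real"

definition coord_vec ::
  "('a::topological_space, 'e::euclidean_space) atlas \<Rightarrow> ('a, 'e) chart \<Rightarrow> 'a \<Rightarrow> 'e \<Rightarrow> 'a tvec" where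
  "coord_vec A c p u =
     (\<lambda>f. if smooth_near A p f then frechet_derivative (f \<circ> cinv c) (at (cmap c p)) u else 0)"

definition tangent_space ::
  "('a::topological_space, 'e::euclidean_space) atlas \<Rightarrow> 'a \<Rightarrow> 'a tvec set" where
  "tangent_space A p = {coord_vec A c p u | c u. c \<in> A \<and> p \<in> cdom c}"

text \<open>The components $v(x^i)$ of a tangent vector in a chart.\<close>

definition components :: "('a, 'e::euclidean_space) chart \<Rightarrow> 'a tvec \<Rightarrow> 'e" where
  "components c v = (\<Sum>b\<in>Basis. v (\<lambda>q. cmap c q \<bullet> b) *\<^sub>R b)"

text \<open>The differential of \<^term>\<open>\<psi>\<close> at \<^term>\<open>p\<close>, where \<^term>\<open>B\<close> is the atlas of the target.\<close>

definition differential ::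
  "('b::topological_space, 'f::euclidean_space) atlas \<Rightarrow> ('a \<Rightarrow> 'b) \<Rightarrow> 'a \<Rightarrow> 'a tvec \<Rightarrow> 'b tvec" where
  "differential B \<psi> p v = (\<lambda>f. if smooth_near B (\<psi> p) f then v (f \<circ> \<psi>) else 0)"

definition velocity ::
  "('a::topological_space, 'e::euclidean_space) atlas \<Rightarrow> (real \<Rightarrow> 'a) \<Rightarrow> real \<Rightarrow> 'a tvec" where
  "velocity A \<gamma> s = (\<lambda>f. if smooth_near A (\<gamma> s) f then deriv (f \<circ> \<gamma>) s else 0)"


section \<open>Metric tensors\<close>

type_synonym 'a metric_field = "'a \<Rightarrow> 'a tvec \<Rightarrow> 'a tvec \<Rightarrow> real"

definition metric_coord ::
  "('a::topological_space, 'e::euclidean_space) atlas \<Rightarrow> 'a metric_field \<Rightarrow> ('a, 'e) chart \<Rightarrow>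
   'e \<Rightarrow> 'e \<Rightarrow> 'e \<Rightarrow> real" where
  "metric_coord A g c x u v =
     g (cinv c x) (coord_vec A c (cinv c x) u) (coord_vec A c (cinv c x) v)"

definition riemannian_metric ::
  "('a::topological_space, 'e::euclidean_space) atlas \<Rightarrow> 'a metric_field \<Rightarrow> bool" where
  "riemannian_metric A g \<longleftrightarrow>
     (\<forall>p\<in>carrier A. \<forall>v\<in>tangent_space A p. \<forall>w\<in>tangent_space A p.
        g p v w = g p w v \<and>
        (\<forall>z\<in>tangent_space A p. \<forall>a b. g p (\<lambda>f. a * v f + b * w f) z = a * g p v z + b * g p w z)) \<and>
     (\<forall>p\<in>carrier A. \<forall>v\<in>tangent_space A p. v \<noteq> (\<lambda>f. 0) \<longrightarrow> g p v v > 0) \<and>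
     (\<forall>c\<in>A. \<forall>u v. smooth_on (cmap c ` cdom c) (\<lambda>x. metric_coord A g c x u v))"

definition pullback_metric ::
  "('b::topological_space, 'f::euclidean_space) atlas \<Rightarrow> ('a \<Rightarrow> 'b) \<Rightarrow> 'b metric_field \<Rightarrow>
   'a metric_field" where
  "pullback_metric B \<psi> g p v w = g (\<psi> p) (differential B \<psi> p v) (differential B \<psi> p w)"


subsection \<open>Riemannian distance and completeness\<close>

definition piecewise_C1_curve ::
  "('a::topological_space, 'e::euclidean_space) atlas \<Rightarrow> (real \<Rightarrow> 'a) \<Rightarrow> bool" where
  "piecewise_C1_curve A \<gamma> \<longleftrightarrow>
     path \<gamma> \<and> path_image \<gamma> \<subseteq> carrier A \<and>
     (\<forall>c\<in>A. \<forall>a b. {a..b} \<subseteq> {0..1} \<and> \<gamma> ` {a..b} \<subseteq> cdom c \<longrightarrow>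
        (cmap c \<circ> \<gamma>) piecewise_C1_differentiable_on {a..b})"

definition curve_length ::
  "('a::topological_space, 'e::euclidean_space) atlas \<Rightarrow> 'a metric_field \<Rightarrow> (real \<Rightarrow> 'a) \<Rightarrow> ennreal" where
  "curve_length A g \<gamma> =
     (\<integral>\<^sup>+s\<in>{0..1}. ennreal (sqrt (g (\<gamma> s) (velocity A \<gamma> s) (velocity A \<gamma> s))) \<partial>lborel)"

definition riemannian_dist ::
  "('a::topological_space, 'e::euclidean_space) atlas \<Rightarrow> 'a metric_field \<Rightarrow> 'a \<Rightarrow> 'a \<Rightarrow> ennreal" where
  "riemannian_dist A g p q =
     (INF \<gamma>\<in>{\<gamma>. piecewise_C1_curve A \<gamma> \<and> pathstart \<gamma> = p \<and> pathfinish \<gamma> = q}. curve_length A g \<gamma>)"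

text \<open>Completeness as a metric space, for the Riemannian distance.\<close>

definition complete_metric ::
  "('a::topological_space, 'e::euclidean_space) atlas \<Rightarrow> 'a metric_field \<Rightarrow> bool" where
  "complete_metric A g \<longleftrightarrow>
     (\<forall>s::nat \<Rightarrow> 'a. range s \<subseteq> carrier A \<and>
        (\<forall>\<epsilon>>0. \<exists>n0. \<forall>i\<ge>n0. \<forall>j\<ge>n0. riemannian_dist A g (s i) (s j) < \<epsilon>) \<longrightarrow>
        (\<exists>p\<in>carrier A. (\<lambda>i. riemannian_dist A g (s i) p) \<longlonglongrightarrow> 0))"


section \<open>Levi-Civita connection and second fundamental form\<close>

text \<open>In a chart, a connection is $\nabla_u Y = dY(u) + \Gamma(u, Y)$ with a field $\Gamma$ of
  bilinear maps. It is torsion-free iff $\Gamma$ is symmetric, and compatible with the metric $G$ iff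
  $\partial_u G(v,w) = G(\Gamma(u,v),w) + G(v,\Gamma(u,w))$. The lemma is the pointwise fundamental
  theorem: these two conditions determine $\Gamma$.\<close>

definition levi_civita_form ::
  "('e::euclidean_space \<Rightarrow> 'e \<Rightarrow> real) \<Rightarrow> ('e \<Rightarrow> 'e \<Rightarrow> 'e \<Rightarrow> real) \<Rightarrow> ('e \<Rightarrow> 'e \<Rightarrow> 'e) \<Rightarrow> bool" where
  "levi_civita_form G dG \<Gamma> \<longleftrightarrow>
     bilinear \<Gamma> \<and> (\<forall>u v. \<Gamma> u v = \<Gamma> v u) \<and>
     (\<forall>u v w. dG u v w = G (\<Gamma> u v) w + G v (\<Gamma> u w))"

lemma levi_civita_form_ex1:
  fixes G :: "'e::euclidean_space \<Rightarrow> 'e \<Rightarrow> real" and dG :: "'e \<Rightarrow> 'e \<Rightarrow> 'e \<Rightarrow> real"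
  assumes bil: "bilinear G" and sym: "\<And>v w. G v w = G w v"
    and nondeg: "\<And>v. (\<And>w. G v w = 0) \<Longrightarrow> v = 0"
    and lin1: "\<And>v w. linear (\<lambda>u. dG u v w)" and lin2: "\<And>u w. linear (\<lambda>v. dG u v w)"
    and dsym: "\<And>u v w. dG u v w = dG u w v"
  shows "\<exists>!\<Gamma>. levi_civita_form G dG \<Gamma>"
proof -
  have lin3: "linear (\<lambda>w. dG u v w)" for u v
    using lin2[of u v] dsym by simp
  have linG: "linear (\<lambda>v. G v w)" "linear (G v)" for v w
    using bil by (auto simp: bilinear_def)
  define K where "K u v w = (dG u v w + dG v u w - dG w u v) / 2" for u v w
  have Klin: "linear (\<lambda>w. K u v w)" "linear (\<lambda>v. K u v w)" "linear (\<lambda>u. K u v w)" for u v w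
    unfolding K_def
    by (auto intro!: linearI simp: linear_add[OF lin1] linear_add[OF lin2] linear_add[OF lin3]
        linear_scale[OF lin1] linear_scale[OF lin2] linear_scale[OF lin3] field_simps)
  define T where "T v = (\<Sum>b\<in>Basis. G v b *\<^sub>R b)" for v
  have T_inner: "T v \<bullet> w = G v w" for v w
  proof -
    have "G v w = G v (\<Sum>b\<in>Basis. (w \<bullet> b) *\<^sub>R b)" by (simp add: euclidean_representation)
    also have "\<dots> = (\<Sum>b\<in>Basis. (w \<bullet> b) * G v b)"
      by (simp add: linear_sum[OF linG(2)] linear_scale[OF linG(2)])
    finally show ?thesis
      by (simp add: T_def inner_sum_left inner_commute[of w] mult.commute)
  qed
  have linT: "linear T"
    unfolding T_def
    by (rule linearI) (simp_all add: linear_add[OF linG(1)] linear_scale[OF linG(1)] scaleR_left_distrib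
        sum.distrib scaleR_sum_right)
  have "inj T"
    unfolding linear_injective_0[OF linT]
  proof (intro allI impI)
    fix v assume "T v = 0"
    then have "G v w = 0" for w using T_inner[of v w] by simp
    then show "v = 0" by (rule nondeg)
  qed
  then have "surj T" using linT linear_inj_imp_surj by blast
  have solve: "\<exists>z. \<forall>w. G z w = K u v w" for u v
  proof -
    obtain z where z: "T z = (\<Sum>b\<in>Basis. K u v b *\<^sub>R b)" using \<open>surj T\<close> by (metis surjD)
    have "G z w = K u v w" for w
    proof -
      have "K u v w = K u v (\<Sum>b\<in>Basis. (w \<bullet> b) *\<^sub>R b)" by (simp add: euclidean_representation)
      also have "\<dots> = (\<Sum>b\<in>Basis. (w \<bullet> b) * K u v b)"
        by (simp add: linear_sum[OF Klin(1)] linear_scale[OF Klin(1)])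
      also have "\<dots> = T z \<bullet> w"
        by (simp add: z inner_sum_left inner_commute[of w] mult.commute)
      finally show ?thesis by (simp add: T_inner)
    qed
    then show ?thesis by blast
  qed
  then obtain \<Gamma> where \<Gamma>: "G (\<Gamma> u v) w = K u v w" for u v w by metis
  have eqI: "x = y" if "\<And>w. G x w = G y w" for x y
  proof -
    have "G (x - y) w = 0" for w using that by (simp add: linear_diff[OF linG(1)])
    then show ?thesis using nondeg by fastforce
  qed
  have "levi_civita_form G dG \<Gamma>"
    unfolding levi_civita_form_def bilinear_def
  proof (intro conjI allI)
    show "linear (\<Gamma> u)" for u
      by (rule linearI; rule eqI) (simp_all add: \<Gamma> linear_add[OF linG(1)] linear_scale[OF linG(1)]
          linear_add[OF Klin(2)] linear_scale[OF Klin(2)])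
    show "linear (\<lambda>u. \<Gamma> u v)" for v
      by (rule linearI; rule eqI) (simp_all add: \<Gamma> linear_add[OF linG(1)] linear_scale[OF linG(1)]
          linear_add[OF Klin(3)] linear_scale[OF Klin(3)])
    show "\<Gamma> u v = \<Gamma> v u" for u v
      by (rule eqI) (simp add: \<Gamma> K_def dsym[of _ u v])
    show "dG u v w = G (\<Gamma> u v) w + G v (\<Gamma> u w)" for u v w
      by (simp add: \<Gamma> sym[of v] K_def dsym[of v u w] dsym[of w u v] dsym[of u w v] field_simps)
  qed
  moreover have "\<Gamma>' = \<Gamma>" if "levi_civita_form G dG \<Gamma>'" for \<Gamma>'
  proof (intro ext eqI)
    fix u v w
    have s: "\<Gamma>' x y = \<Gamma>' y x" and c: "dG x y z = G (\<Gamma>' x y) z + G y (\<Gamma>' x z)" for x y z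
      using that by (auto simp: levi_civita_form_def)
    have "K u v w = G (\<Gamma>' u v) w"
      unfolding K_def c s[of v u] s[of w u] s[of w v] sym[of u] sym[of v] by (simp add: field_simps)
    then show "G (\<Gamma>' u v) w = G (\<Gamma> u v) w" by (simp add: \<Gamma>)
  qed
  ultimately show ?thesis by blast
qed

definition christoffel ::
  "('a::topological_space, 'e::euclidean_space) atlas \<Rightarrow> 'a metric_field \<Rightarrow> ('a, 'e) chart \<Rightarrow>
   'e \<Rightarrow> 'e \<Rightarrow> 'e \<Rightarrow> 'e" where
  "christoffel A g c x =
     (THE \<Gamma>. levi_civita_form (metric_coord A g c x)
        (\<lambda>u v w. frechet_derivative (\<lambda>y. metric_coord A g c y v w) (at x) u) \<Gamma>)"

definition chart_at :: "('a, 'e) atlas \<Rightarrow> 'a \<Rightarrow> ('a, 'e) chart" where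
  "chart_at A p = (SOME c. c \<in> A \<and> p \<in> cdom c)"

text \<open>Covariant derivative at \<^term>\<open>p\<close>, in the direction \<^term>\<open>v\<close>, of a vector field \<^term>\<open>Y\<close> along
  \<open>\<psi> : A \<rightarrow> B\<close>, for the Levi-Civita connection of \<^term>\<open>g\<close> on the target. For \<open>\<psi> = id\<close> this is the
  covariant derivative of a vector field on \<^term>\<open>A\<close>. The value does not depend on the charts.\<close>

definition cov_deriv ::
  "('a::topological_space, 'e::euclidean_space) atlas \<Rightarrow>
   ('b::topological_space, 'f::euclidean_space) atlas \<Rightarrow> 'b metric_field \<Rightarrow> ('a \<Rightarrow> 'b) \<Rightarrow>
   ('a \<Rightarrow> 'b tvec) \<Rightarrow> 'a \<Rightarrow> 'a tvec \<Rightarrow> 'b tvec" where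
  "cov_deriv A B g \<psi> Y p v =
     (let c = chart_at A p; d = chart_at B (\<psi> p);
          x = cmap c p; u = components c v;
          F = cmap d \<circ> \<psi> \<circ> cinv c;
          y = (\<lambda>x. components d (Y (cinv c x)))
      in coord_vec B d (\<psi> p)
           (frechet_derivative y (at x) u +
            christoffel B g d (F x) (frechet_derivative F (at x) u) (y x)))"

text \<open>$\mathrm{II}(V,W) = \overline\nabla_V W - \nabla_V W$ for vector fields $V, W$ on the
  hypersurface, which are identified with fields along \<^term>\<open>\<psi>\<close> by the differential. Here
  \<^term>\<open>g\<close> is the ambient metric.\<close>

definition second_ff ::
  "('a::topological_space, 'e::euclidean_space) atlas \<Rightarrow>
   ('b::topological_space, 'f::euclidean_space) atlas \<Rightarrow> 'b metric_field \<Rightarrow> ('a \<Rightarrow> 'b) \<Rightarrow>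
   ('a \<Rightarrow> 'a tvec) \<Rightarrow> ('a \<Rightarrow> 'a tvec) \<Rightarrow> 'a \<Rightarrow> 'b tvec" where
  "second_ff A B g \<psi> V W p =
     (\<lambda>f. cov_deriv A B g \<psi> (\<lambda>q. differential B \<psi> q (W q)) p (V p) f -
          differential B \<psi> p (cov_deriv A A (pullback_metric B \<psi> g) id W p (V p)) f)"

text \<open>Extension of a tangent vector at \<^term>\<open>p\<close> to a local vector field with constant components. As
  $\mathrm{II}$ is tensorial, evaluating it on such extensions gives its value on tangent vectors.\<close>

definition const_extension ::
  "('a::topological_space, 'e::euclidean_space) atlas \<Rightarrow> 'a \<Rightarrow> 'a tvec \<Rightarrow> 'a \<Rightarrow> 'a tvec" where
  "const_extension A p v = (\<lambda>q. coord_vec A (chart_at A p) q (components (chart_at A p) v))"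

definition orthonormal_basis ::
  "('a::topological_space, 'e::euclidean_space) atlas \<Rightarrow> 'a metric_field \<Rightarrow> 'a \<Rightarrow> 'a tvec set \<Rightarrow> bool" where
  "orthonormal_basis A g p E \<longleftrightarrow>
     E \<subseteq> tangent_space A p \<and> finite E \<and> card E = DIM('e) \<and>
     (\<forall>v\<in>E. \<forall>w\<in>E. g p v w = (if v = w then 1 else 0))"

definition mean_curvature_vector ::
  "('a::topological_space, 'e::euclidean_space) atlas \<Rightarrow>
   ('b::topological_space, 'f::euclidean_space) atlas \<Rightarrow> 'b metric_field \<Rightarrow> ('a \<Rightarrow> 'b) \<Rightarrow>
   'a \<Rightarrow> 'b tvec" where
  "mean_curvature_vector A B g \<psi> p =
     (let E = (SOME E. orthonormal_basis A (pullback_metric B \<psi> g) p E)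
      in (\<lambda>f. (1 / real DIM('e)) *
           (\<Sum>e\<in>E. second_ff A B g \<psi> (const_extension A p e) (const_extension A p e) p f)))"

definition mean_curvature ::
  "('a::topological_space, 'e::euclidean_space) atlas \<Rightarrow>
   ('b::topological_space, 'f::euclidean_space) atlas \<Rightarrow> 'b metric_field \<Rightarrow> ('a \<Rightarrow> 'b) \<Rightarrow>
   ('a \<Rightarrow> 'b tvec) \<Rightarrow> 'a \<Rightarrow> real" where
  "mean_curvature A B g \<psi> N p = - g (\<psi> p) (mean_curvature_vector A B g \<psi> p) (N p)"


section \<open>Doubly warped product spacetimes\<close>

definition product_atlas ::
  "real set \<Rightarrow> ('p, 'e) atlas \<Rightarrow> (real \<times> 'p, real \<times> 'e) atlas" where
  "product_atlas I P = (\<lambda>c. (I \<times> cdom c, \<lambda>(t, x). (t, cmap c x))) ` P"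

text \<open>Since \<^term>\<open>fst\<close> is the coordinate function $t$, the number \<^term>\<open>v fst\<close> is $\mathrm{d}t(v)$.\<close>

definition doubly_warped_metric ::
  "('p::topological_space, 'e::euclidean_space) atlas \<Rightarrow> ('p \<Rightarrow> real) \<Rightarrow> (real \<Rightarrow> real) \<Rightarrow>
   'p metric_field \<Rightarrow> (real \<times> 'p) metric_field" where
  "doubly_warped_metric P h \<rho> \<sigma> q v w =
     - (h (snd q))\<^sup>2 * (v fst * w fst) +
     (\<rho> (fst q))\<^sup>2 * pullback_metric P snd \<sigma> q v w"

definition time_field ::
  "real set \<Rightarrow> ('p::topological_space, 'e::euclidean_space) atlas \<Rightarrow> real \<times> 'p \<Rightarrow> (real \<times> 'p) tvec" where
  "time_field I P q =
     (\<lambda>f. if smooth_near (product_atlas I P) q f then deriv (\<lambda>s. f (s, snd q)) (fst q) else 0)"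

definition doubly_warped_data ::
  "real set \<Rightarrow> ('p \<Rightarrow> real) \<Rightarrow> (real \<Rightarrow> real) \<Rightarrow>
   ('p::{t2_space, second_countable_topology}, 'e::euclidean_space) atlas \<Rightarrow> 'p metric_field \<Rightarrow> bool" where
  "doubly_warped_data I h \<rho> P \<sigma> \<longleftrightarrow>
     smooth_manifold P \<and> connected (carrier P) \<and> riemannian_metric P \<sigma> \<and>
     open I \<and> is_interval I \<and>
     smooth_fun_on P (carrier P) h \<and> (\<forall>x\<in>carrier P. h x > 0) \<and>
     smooth_on I \<rho> \<and> (\<forall>t\<in>I. \<rho> t > 0)"

text \<open>The hypersurface has the same dimension as the Riemannian factor because both are modelled
  on \<^typ>\<open>'e\<close>.\<close>

definition spacelike_hypersurface ::
  "('a::{t2_space, second_countable_topology}, 'e::euclidean_space) atlas \<Rightarrow>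
   (real \<times> 'p::topological_space, real \<times> 'e) atlas \<Rightarrow> (real \<times> 'p) metric_field \<Rightarrow>
   ('a \<Rightarrow> real \<times> 'p) \<Rightarrow> bool" where
  "spacelike_hypersurface A B g \<psi> \<longleftrightarrow>
     smooth_manifold A \<and> smooth_map A B \<psi> \<and>
     (\<forall>p\<in>carrier A. inj_on (differential B \<psi> p) (tangent_space A p)) \<and>
     riemannian_metric A (pullback_metric B \<psi> g)"

definition future_unit_normal ::
  "('a::topological_space, 'e::euclidean_space) atlas \<Rightarrow> real set \<Rightarrow>
   ('p::topological_space, 'e) atlas \<Rightarrow> (real \<times> 'p) metric_field \<Rightarrow> ('a \<Rightarrow> real \<times> 'p) \<Rightarrow>
   ('a \<Rightarrow> (real \<times> 'p) tvec) \<Rightarrow> bool" where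
  "future_unit_normal A I P g \<psi> N \<longleftrightarrow>
     (\<forall>p\<in>carrier A.
        N p \<in> tangent_space (product_atlas I P) (\<psi> p) \<and>
        (\<forall>v\<in>tangent_space A p. g (\<psi> p) (N p) (differential (product_atlas I P) \<psi> p v) = 0) \<and>
        g (\<psi> p) (N p) (N p) = - 1 \<and>
        g (\<psi> p) (N p) (time_field I P (\<psi> p)) < 0)"

end

theory Submission
  imports Defs
begin

text \<open>Let \<open>\<tau>\<close> be the height function and \<open>n\<close> the future unit normal, and let the \<open>e\<^sub>i\<close> be an orthonormal
  frame of the hypersurface. Pairing the accelerations of coordinate lines with \<open>n\<close> gives, in every
  chart, a second-order expression \<open>\<Sum>\<^sub>i D\<^sup>2\<tau>(e\<^sub>i, e\<^sub>i)\<close> that equals \<open>m (H dt(n) - \<rho>'/(\<rho> h\<^sup>2))\<close> up to terms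
  bounded by \<open>C |d\<tau>|\<close>. Since \<open>h dt(n) \<ge> 1\<close> and \<open>\<rho>' \<ge> 0\<close>, the curvature assumption makes it at least
  \<open>- C |d\<tau>|\<close>, so \<open>\<tau>\<close> satisfies the strong maximum principle. If \<open>\<tau>\<close> were somewhere above \<open>t0\<close>, it would
  attain its maximum because of the behaviour at infinity, hence be constant, and then \<open>M\<close> would be
  compact. So \<open>\<tau> = t0\<close>, and the projection to the Riemannian factor is a homothetic local
  diffeomorphism. As \<open>M\<close> is complete, coordinate segments of the factor lift to \<open>M\<close>; therefore the image of
  the projection is open and closed, and the projection is onto.\<close>

section \<open>Calculus of smooth maps\<close>

text \<open>The mean curvature is defined through a chosen chart and a chosen frame, whereas the
  maximum principle is applied in every chart. Both a change of chart and the intrinsic covariant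
  derivative alter an acceleration only by a tangent vector, which the pairing with \<open>n\<close>
  annihilates. The error terms are controlled by splitting \<open>n\<close> into a tangent vector
  and \<kappa> times the time field: after division by \<open>\<kappa> h\<^sup>2\<close> the tangent
  vector is the gradient of the height, so no bound on \<open>n\<close> enters. The condition on
  \<rho>' makes the bound for \<open>H\<close> nonnegative, which allows it to be multiplied by
  \<open>h dt(n) \<ge> 1\<close>. For the surjectivity, coordinate segments take the place of
  geodesics: the homothety bounds the speed of a lift, so the end points of growing lifts form a
  Cauchy sequence. Convergence in the Riemannian distance must then be converted into convergence in
  the manifold topology. Noncompactness acts twice: it excludes a constant height above
  \<open>t0\<close>, and it makes \<open>M\<close> nonempty.\<close>

abbreviation fder :: "('a::real_normed_vector \<Rightarrow> 'b::real_normed_vector) \<Rightarrow> 'a \<Rightarrow> 'a \<Rightarrow> 'b" where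
  "fder f x \<equiv> frechet_derivative f (at x)"

lemma fder_eqI: "(f has_derivative f') (at x) \<Longrightarrow> fder f x = f'"
  using frechet_derivative_at by metis

section \<open>Stability of the classes \<open>Ck_on\<close> under restriction, sums, products and
  composition\<close>

lemma Ck_on_subset: "Ck_on k S f \<Longrightarrow> T \<subseteq> S \<Longrightarrow> Ck_on k T f"
proof (induction k arbitrary: f)
  case 0
  then show ?case by (auto intro: continuous_on_subset)
next
  case (Suc k)
  then show ?case by (auto intro!: Suc.IH) blast
qed

lemma Ck_on_cong:
  assumes "open S" "\<And>x. x \<in> S \<Longrightarrow> f x = g x"
  shows "Ck_on k S f \<Longrightarrow> Ck_on k S g"
proof (cases k)
  case 0
  then show "Ck_on k S f \<Longrightarrow> Ck_on k S g"
    using assms by (auto cong: continuous_on_cong)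
next
  case (Suc j)
  assume "Ck_on k S f"
  then obtain f' where f': "\<And>x. x \<in> S \<Longrightarrow> (f has_derivative f' x) (at x)" "\<And>v. Ck_on j S (\<lambda>x. f' x v)"
    using Suc by auto
  have "(g has_derivative f' x) (at x)" if "x \<in> S" for x
    using has_derivative_transform_within_open[OF f'(1)[OF that] assms(1) that] assms(2) by auto
  then show ?thesis using Suc f'(2) by auto
qed

lemma Ck_on_SucD: "Ck_on (Suc k) S f \<Longrightarrow> Ck_on k S f"
proof (induction k arbitrary: f)
  case 0
  then show ?case
    by (auto simp: continuous_on_eq_continuous_within
        intro: has_derivative_continuous has_derivative_at_withinI)
next
  case (Suc k)
  then show ?case by (metis Ck_on.simps(2))
qed

lemma Ck_on_const: "Ck_on k S (\<lambda>x. c)"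
proof (induction k arbitrary: c)
  case (Suc k)
  then show ?case by (auto intro!: exI[of _ "\<lambda>x v. 0"])
qed simp

lemma Ck_on_bounded_linear: "bounded_linear f \<Longrightarrow> Ck_on k S f"
  by (cases k) (auto simp: linear_continuous_on Ck_on_const bounded_linear_imp_has_derivative
      intro!: exI[of _ "\<lambda>x. f"])

lemma Ck_on_bounded_linear_compose:
  assumes "bounded_linear L"
  shows "Ck_on k S f \<Longrightarrow> Ck_on k S (\<lambda>x. L (f x))"
proof (induction k arbitrary: f)
  case 0
  then show ?case
    using assms by (auto intro: bounded_linear.continuous_on)
next
  case (Suc k)
  then obtain f' where f': "\<And>x. x \<in> S \<Longrightarrow> (f has_derivative f' x) (at x)" "\<And>v. Ck_on k S (\<lambda>x. f' x v)"
    by auto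
  have "((\<lambda>x. L (f x)) has_derivative (\<lambda>v. L (f' x v))) (at x)" if "x \<in> S" for x
    using bounded_linear.has_derivative[OF assms f'(1)[OF that]] .
  then show ?case using Suc.IH[OF f'(2)] by (auto intro!: exI[of _ "\<lambda>x v. L (f' x v)"])
qed

lemma Ck_on_add: "Ck_on k S f \<Longrightarrow> Ck_on k S g \<Longrightarrow> Ck_on k S (\<lambda>x. f x + g x)"
proof (induction k arbitrary: f g)
  case 0
  then show ?case by (auto intro: continuous_on_add)
next
  case (Suc k)
  obtain f' where f': "\<And>x. x \<in> S \<Longrightarrow> (f has_derivative f' x) (at x)" "\<And>v. Ck_on k S (\<lambda>x. f' x v)"
    using Suc.prems by auto
  obtain g' where g': "\<And>x. x \<in> S \<Longrightarrow> (g has_derivative g' x) (at x)" "\<And>v. Ck_on k S (\<lambda>x. g' x v)"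
    using Suc.prems by auto
  show ?case
    using has_derivative_add[OF f'(1) g'(1)] Suc.IH[OF f'(2) g'(2)]
    by (auto intro!: exI[of _ "\<lambda>x v. f' x v + g' x v"])
qed

lemma Ck_on_sum: "(\<And>i. i \<in> A \<Longrightarrow> Ck_on k S (f i)) \<Longrightarrow> Ck_on k S (\<lambda>x. \<Sum>i\<in>A. f i x)"
  by (induction A rule: infinite_finite_induct) (auto intro: Ck_on_const Ck_on_add)

lemma Ck_on_scaleR:
  "Ck_on k S f \<Longrightarrow> Ck_on k S g \<Longrightarrow> Ck_on k S (\<lambda>x. f x *\<^sub>R g x)"
proof (induction k arbitrary: f g)
  case 0
  then show ?case by (auto intro: continuous_on_scaleR)
next
  case (Suc k)
  obtain f' where f': "\<And>x. x \<in> S \<Longrightarrow> (f has_derivative f' x) (at x)" "\<And>v. Ck_on k S (\<lambda>x. f' x v)"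
    using Suc.prems by auto
  obtain g' where g': "\<And>x. x \<in> S \<Longrightarrow> (g has_derivative g' x) (at x)" "\<And>v. Ck_on k S (\<lambda>x. g' x v)"
    using Suc.prems by auto
  have "Ck_on k S f" "Ck_on k S g" using Suc.prems Ck_on_SucD by auto
  then show ?case
    using has_derivative_scaleR[OF f'(1) g'(1)] Suc.IH f'(2) g'(2)
    by (auto intro!: exI[of _ "\<lambda>x v. f x *\<^sub>R g' x v + f' x v *\<^sub>R g x"] Ck_on_add)
qed

text \<open>\<open>Ck_on\<close> controls \<open>f'\<close> only in fixed directions, while the
  chain rule evaluates it in the moving direction \<open>g' x v\<close>. Expanding that direction in
  the basis gives a finite sum of products, to which the induction hypothesis applies; hence the
  Euclidean domain of \<open>f\<close>.\<close>

lemma Ck_on_compose: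
  fixes f :: "'b::euclidean_space \<Rightarrow> 'c::real_normed_vector"
  assumes "g ` S \<subseteq> T"
  shows "Ck_on k T f \<Longrightarrow> Ck_on k S g \<Longrightarrow> Ck_on k S (\<lambda>x. f (g x))"
proof (induction k arbitrary: f)
  case 0
  then show ?case using assms by (auto intro: continuous_on_compose2)
next
  case (Suc k)
  obtain f' where f': "\<And>x. x \<in> T \<Longrightarrow> (f has_derivative f' x) (at x)" "\<And>v. Ck_on k T (\<lambda>x. f' x v)"
    using Suc.prems by auto
  obtain g' where g': "\<And>x. x \<in> S \<Longrightarrow> (g has_derivative g' x) (at x)" "\<And>v. Ck_on k S (\<lambda>x. g' x v)"
    using Suc.prems by auto
  have g: "Ck_on k S g" using Suc.prems Ck_on_SucD by auto
  define F where "F x v = (\<Sum>b\<in>Basis. (g' x v \<bullet> b) *\<^sub>R f' (g x) b)" for x v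
  have F: "f' (g x) (g' x v) = F x v" if "x \<in> S" for x v
  proof -
    have "linear (f' (g x))" using f'(1)[of "g x"] assms that has_derivative_linear by blast
    then have "f' (g x) (\<Sum>b\<in>Basis. (g' x v \<bullet> b) *\<^sub>R b) = F x v"
      by (simp add: F_def linear_sum linear_cmul)
    then show ?thesis by (simp add: euclidean_representation)
  qed
  have "((\<lambda>x. f (g x)) has_derivative F x) (at x)" if "x \<in> S" for x
    using has_derivative_compose[OF g'(1)[OF that] f'(1)] assms that F by (auto simp: image_subset_iff)
  moreover have "Ck_on k S (\<lambda>x. F x v)" for v
    unfolding F_def
    by (intro Ck_on_sum Ck_on_scaleR Suc.IH[OF f'(2)] g
        Ck_on_bounded_linear_compose[OF bounded_linear_inner_left g'(2)])
  ultimately show ?case by auto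
qed

lemma smooth_on_subset: "smooth_on S f \<Longrightarrow> T \<subseteq> S \<Longrightarrow> smooth_on T f"
  by (auto simp: smooth_on_def intro: Ck_on_subset)

lemma smooth_on_cong:
  "open S \<Longrightarrow> (\<And>x. x \<in> S \<Longrightarrow> f x = g x) \<Longrightarrow> smooth_on S f \<Longrightarrow> smooth_on S g"
  unfolding smooth_on_def using Ck_on_cong by blast

lemma smooth_on_const: "smooth_on S (\<lambda>x. c)"
  by (simp add: smooth_on_def Ck_on_const)

lemma smooth_on_bounded_linear: "bounded_linear f \<Longrightarrow> smooth_on S f"
  by (simp add: smooth_on_def Ck_on_bounded_linear)

lemma smooth_on_bounded_linear_compose:
  "bounded_linear L \<Longrightarrow> smooth_on S f \<Longrightarrow> smooth_on S (\<lambda>x. L (f x))"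
  by (simp add: smooth_on_def Ck_on_bounded_linear_compose)

lemma smooth_on_add: "smooth_on S f \<Longrightarrow> smooth_on S g \<Longrightarrow> smooth_on S (\<lambda>x. f x + g x)"
  by (simp add: smooth_on_def Ck_on_add)

lemma smooth_on_scaleR: "smooth_on S f \<Longrightarrow> smooth_on S g \<Longrightarrow> smooth_on S (\<lambda>x. f x *\<^sub>R g x)"
  by (simp add: smooth_on_def Ck_on_scaleR)

lemma smooth_on_mult:
  fixes f g :: "'a::real_normed_vector \<Rightarrow> real"
  shows "smooth_on S f \<Longrightarrow> smooth_on S g \<Longrightarrow> smooth_on S (\<lambda>x. f x * g x)"
  using smooth_on_scaleR[of S f g] by simp

lemma smooth_on_compose:
  fixes f :: "'b::euclidean_space \<Rightarrow> 'c::real_normed_vector"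
  shows "smooth_on T f \<Longrightarrow> smooth_on S g \<Longrightarrow> g ` S \<subseteq> T \<Longrightarrow> smooth_on S (\<lambda>x. f (g x))"
  by (simp add: smooth_on_def Ck_on_compose)

lemma smooth_on_Pair:
  assumes "smooth_on S f" "smooth_on S g"
  shows "smooth_on S (\<lambda>x. (f x, g x))"
proof -
  have "bounded_linear (\<lambda>a. (a, 0))" "bounded_linear (\<lambda>b. (0, b))"
    by (auto intro!: bounded_linear_Pair)
  from smooth_on_add[OF smooth_on_bounded_linear_compose[OF this(1) assms(1)]
      smooth_on_bounded_linear_compose[OF this(2) assms(2)]]
  show ?thesis by simp
qed

lemma smooth_on_imp_continuous_on: "smooth_on S f \<Longrightarrow> continuous_on S f"
  unfolding smooth_on_def by (metis Ck_on.simps(1))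

lemma smooth_on_has_derivative:
  assumes "smooth_on S f" "x \<in> S"
  shows "(f has_derivative fder f x) (at x)"
proof -
  have "Ck_on (Suc 0) S f" using assms by (auto simp only: smooth_on_def)
  then show ?thesis using assms(2) fder_eqI by fastforce
qed

lemma smooth_on_fder_linear: "smooth_on S f \<Longrightarrow> x \<in> S \<Longrightarrow> linear (fder f x)"
  using smooth_on_has_derivative has_derivative_linear by blast

lemma smooth_on_fder:
  assumes "smooth_on S f" "open S"
  shows "smooth_on S (\<lambda>x. fder f x v)"
  unfolding smooth_on_def
proof
  fix k
  have "Ck_on (Suc k) S f" using assms by (auto simp only: smooth_on_def)
  then obtain f' where f': "\<And>x. x \<in> S \<Longrightarrow> (f has_derivative f' x) (at x)" "\<And>v. Ck_on k S (\<lambda>x. f' x v)"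
    by auto
  show "Ck_on k S (\<lambda>x. fder f x v)"
    by (rule Ck_on_cong[OF assms(2) _ f'(2)[of v]]) (simp add: fder_eqI[OF f'(1)])
qed

lemma fder_cong:
  assumes "open S" "x \<in> S" "\<And>y. y \<in> S \<Longrightarrow> f y = g y"
  shows "fder f x = fder g x"
proof -
  have "(f has_derivative f') (at x) \<longleftrightarrow> (g has_derivative f') (at x)" for f'
    using has_derivative_transform_within_open[OF _ assms(1,2)] assms(3) by metis
  then show ?thesis by (simp add: frechet_derivative_def)
qed

lemma fder_bounded_linear: "bounded_linear f \<Longrightarrow> fder f x = f"
  by (simp add: bounded_linear_imp_has_derivative fder_eqI)

section \<open>Product rules for linear families and symmetry of second derivatives\<close>

lemma linear_basis_expansion:
  fixes f :: "'a::euclidean_space \<Rightarrow> 'b::real_vector"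
  assumes "linear f"
  shows "f v = (\<Sum>b\<in>Basis. (v \<bullet> b) *\<^sub>R f b)"
proof -
  have "f (\<Sum>b\<in>Basis. (v \<bullet> b) *\<^sub>R b) = (\<Sum>b\<in>Basis. (v \<bullet> b) *\<^sub>R f b)"
    by (simp add: assms linear_sum linear_cmul)
  then show ?thesis by (simp add: euclidean_representation)
qed

text \<open>A product rule for an operator field that is differentiable on each fixed vector, which
  is the form in which \<open>smooth_on\<close> gives the differentiability of
  \<open>fder f\<close>. In basis coordinates of \<open>W y\<close> it reduces to products with
  scalars.\<close>

lemma has_derivative_linear_family:
  fixes A :: "'a::real_normed_vector \<Rightarrow> 'b::euclidean_space \<Rightarrow> 'c::real_normed_vector"
  assumes lin: "\<And>y. y \<in> S \<Longrightarrow> linear (A y)" and S: "open S" "x \<in> S"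
    and A: "\<And>w. ((\<lambda>y. A y w) has_derivative A' w) (at x)"
    and W: "(W has_derivative W') (at x)"
  shows "((\<lambda>y. A y (W y)) has_derivative (\<lambda>v. A' (W x) v + A x (W' v))) (at x)"
proof -
  have *: "((\<lambda>y. A y (V y)) has_derivative
      (\<lambda>v. (\<Sum>b\<in>Basis. (V x \<bullet> b) *\<^sub>R A' b v) + A x (V' v))) (at x)"
    if V: "(V has_derivative V') (at x)" for V V'
  proof -
    have "((\<lambda>y. \<Sum>b\<in>Basis. (V y \<bullet> b) *\<^sub>R A y b) has_derivative
        (\<lambda>v. \<Sum>b\<in>Basis. (V x \<bullet> b) *\<^sub>R A' b v + (V' v \<bullet> b) *\<^sub>R A x b)) (at x)"
      by (intro has_derivative_sum has_derivative_scaleR has_derivative_inner_left V A)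
    then have "((\<lambda>y. A y (V y)) has_derivative
        (\<lambda>v. \<Sum>b\<in>Basis. (V x \<bullet> b) *\<^sub>R A' b v + (V' v \<bullet> b) *\<^sub>R A x b)) (at x)"
      by (rule has_derivative_transform_within_open[OF _ S])
        (rule linear_basis_expansion[OF lin, symmetric])
    then show ?thesis
      by (simp add: sum.distrib linear_basis_expansion[OF lin[OF S(2)], symmetric])
  qed
  \<comment> \<open>Linearity of \<open>A'\<close> in its vector is derived: for a constant field
    the formula just proved and the assumption on \<open>A\<close> give two derivatives of one map,
    and derivatives are unique.\<close>
  have "(\<lambda>v. \<Sum>b\<in>Basis. (w \<bullet> b) *\<^sub>R A' b v) = A' w" for w
    using has_derivative_unique[OF *[OF has_derivative_const[of w]] A[of w]]
    by (simp add: linear_0[OF lin[OF S(2)]])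
  then have "(\<Sum>b\<in>Basis. (w \<bullet> b) *\<^sub>R A' b v) = A' w v" for w v
    by (rule fun_cong)
  then show ?thesis using *[OF W] by simp
qed

text \<open>The chain rule for second derivatives, with the derivative of \<open>f\<close> taken at
  a moving point on a moving vector. In \<open>accel_change\<close>, \<open>W\<close> is a
  derivative of a transition map and the last summand becomes the tangential defect.\<close>

lemma has_derivative_fder_along:
  fixes f :: "'b::euclidean_space \<Rightarrow> 'c::real_normed_vector"
  assumes f: "smooth_on T f" "open T" and S: "open S" "x \<in> S" "g ` S \<subseteq> T"
    and g: "(g has_derivative g') (at x)" and W: "(W has_derivative W') (at x)"
  shows "((\<lambda>y. fder f (g y) (W y)) has_derivative
     (\<lambda>v. fder (\<lambda>z. fder f z (W x)) (g x) (g' v) + fder f (g x) (W' v))) (at x)"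
proof -
  have "((\<lambda>z. fder f z w) has_derivative fder (\<lambda>z. fder f z w) (g x)) (at (g x))" for w
    by (rule smooth_on_has_derivative[OF smooth_on_fder[OF f]]) (use S in auto)
  note d = has_derivative_compose[OF g this]
  show ?thesis
    by (rule has_derivative_linear_family[OF _ S(1,2) d W])
      (use S in \<open>auto intro: smooth_on_fder_linear[OF f(1)]\<close>)
qed

text \<open>The second difference of \<^term>\<open>f\<close> over a small parallelogram is,
  by two applications of the mean value theorem, a value of either mixed derivative nearby.\<close>

lemma fder_fder_commute_real:
  fixes f :: "'b::euclidean_space \<Rightarrow> real"
  assumes f: "smooth_on T f" "open T" and x: "x \<in> T"
  shows "fder (\<lambda>z. fder f z u) x v = fder (\<lambda>z. fder f z v) x u"
proof -
  obtain r where r: "r > 0" "cball x r \<subseteq> T" using f(2) x open_contains_cball by blast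
  have one: "\<exists>z. dist x z \<le> h * (norm p + norm q) \<and>
      f (x + h *\<^sub>R p + h *\<^sub>R q) - f (x + h *\<^sub>R p) - f (x + h *\<^sub>R q) + f x
       = h * h * fder (\<lambda>z. fder f z p) z q"
    if h: "h > 0" "h * (norm p + norm q) \<le> r" for p q h
  proof -
    have inT: "x + s *\<^sub>R p + t *\<^sub>R q \<in> T \<and> dist x (x + s *\<^sub>R p + t *\<^sub>R q) \<le> h * (norm p + norm q)"
      if "0 \<le> s" "s \<le> h" "0 \<le> t" "t \<le> h" for s t
    proof -
      have "norm (s *\<^sub>R p + t *\<^sub>R q) \<le> s * norm p + t * norm q"
        using norm_triangle_ineq[of "s *\<^sub>R p" "t *\<^sub>R q"] that by simp
      also have "\<dots> \<le> h * norm p + h * norm q"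
        using that by (intro add_mono mult_right_mono) auto
      moreover have "dist x (x + s *\<^sub>R p + t *\<^sub>R q) = norm (s *\<^sub>R p + t *\<^sub>R q)"
        by (subst dist_commute) (simp add: dist_norm add.assoc)
      ultimately have "dist x (x + s *\<^sub>R p + t *\<^sub>R q) \<le> h * (norm p + norm q)"
        by (simp add: distrib_left)
      then show ?thesis using r h by (auto simp: subset_iff)
    qed
    define k where "k s = f (x + s *\<^sub>R p + h *\<^sub>R q) - f (x + s *\<^sub>R p)" for s
    have dk: "(k has_real_derivative fder f (x + s *\<^sub>R p + h *\<^sub>R q) p - fder f (x + s *\<^sub>R p) p) (at s)"
      if "0 \<le> s" "s \<le> h" for s
    proof -
      have i: "x + s *\<^sub>R p + h *\<^sub>R q \<in> T" "x + s *\<^sub>R p \<in> T"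
        using inT[OF that, of h] inT[OF that, of 0] h by auto
      have d: "((\<lambda>s. x + s *\<^sub>R p + h *\<^sub>R q) has_derivative (\<lambda>s. s *\<^sub>R p)) (at s)"
        "((\<lambda>s. x + s *\<^sub>R p) has_derivative (\<lambda>s. s *\<^sub>R p)) (at s)"
        by (auto intro!: derivative_eq_intros)
      have "(k has_derivative (\<lambda>t. fder f (x + s *\<^sub>R p + h *\<^sub>R q) (t *\<^sub>R p) - fder f (x + s *\<^sub>R p) (t *\<^sub>R p))) (at s)"
        unfolding k_def
        by (intro has_derivative_diff has_derivative_compose[OF d(1)] has_derivative_compose[OF d(2)]
            smooth_on_has_derivative[OF f(1)] i)
      then show ?thesis
        unfolding has_field_derivative_def
        by (rule has_derivative_eq_rhs)
          (auto simp: linear_cmul[OF smooth_on_fder_linear[OF f(1) i(1)]]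
            linear_cmul[OF smooth_on_fder_linear[OF f(1) i(2)]] fun_eq_iff left_diff_distrib right_diff_distrib)
    qed
    obtain s where s: "0 < s" "s < h" "k h - k 0 = (h - 0) *
        (fder f (x + s *\<^sub>R p + h *\<^sub>R q) p - fder f (x + s *\<^sub>R p) p)"
      using MVT2[OF h(1) dk] by blast
    define l where "l t = fder f (x + s *\<^sub>R p + t *\<^sub>R q) p" for t
    have dl: "(l has_real_derivative fder (\<lambda>z. fder f z p) (x + s *\<^sub>R p + t *\<^sub>R q) q) (at t)"
      if "0 \<le> t" "t \<le> h" for t
    proof -
      have i: "x + s *\<^sub>R p + t *\<^sub>R q \<in> T" using inT[of s t] s that by auto
      have d: "((\<lambda>t. x + s *\<^sub>R p + t *\<^sub>R q) has_derivative (\<lambda>t. t *\<^sub>R q)) (at t)"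
        by (auto intro!: derivative_eq_intros)
      note sm = smooth_on_fder[OF f]
      have "(l has_derivative (\<lambda>w. fder (\<lambda>z. fder f z p) (x + s *\<^sub>R p + t *\<^sub>R q) (w *\<^sub>R q))) (at t)"
        unfolding l_def by (rule has_derivative_compose[OF d smooth_on_has_derivative[OF sm i]])
      then show ?thesis
        unfolding has_field_derivative_def
        by (rule has_derivative_eq_rhs) (auto simp: linear_cmul[OF smooth_on_fder_linear[OF sm i]] fun_eq_iff)
    qed
    obtain t where t: "0 < t" "t < h" "l h - l 0 = (h - 0) * fder (\<lambda>z. fder f z p) (x + s *\<^sub>R p + t *\<^sub>R q) q"
      using MVT2[OF h(1) dl] by blast
    show ?thesis
      using inT[of s t] s t by (intro exI[of _ "x + s *\<^sub>R p + t *\<^sub>R q"]) (auto simp: k_def l_def)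
  qed
  define F where "F z = fder (\<lambda>z. fder f z u) z v" for z
  define G where "G z = fder (\<lambda>z. fder f z v) z u" for z
  \<comment> \<open>The summand 1 keeps \<open>C\<close> positive when both directions vanish, so
    that \<open>h = e / C\<close> is a legitimate step.\<close>
  define C where "C = norm u + norm v + 1"
  have C: "C > 0" by (simp add: C_def add_nonneg_pos)
  have "continuous_on T F" "continuous_on T G"
    unfolding F_def G_def
    by (rule smooth_on_imp_continuous_on, rule smooth_on_fder[OF smooth_on_fder[OF f] f(2)])+
  then have cont: "isCont F x" "isCont G x"
    using continuous_on_eq_continuous_at[OF f(2)] x by auto
  have ex: "\<exists>a b. dist x a \<le> e \<and> dist x b \<le> e \<and> F a = G b" if e: "0 < e" "e \<le> r" for e
  proof -
    define h where "h = e / C"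
    have h: "h > 0" "h * C = e" using C e by (auto simp: h_def)
    have le: "h * (norm u + norm v) \<le> e"
      using h by (simp add: C_def algebra_simps)
    obtain a where a: "dist x a \<le> e" "f (x + h *\<^sub>R u + h *\<^sub>R v) - f (x + h *\<^sub>R u) - f (x + h *\<^sub>R v) + f x
       = h * h * F a"
      using one[of h u v] h(1) e le unfolding F_def by (meson order_trans)
    obtain b where b: "dist x b \<le> e" "f (x + h *\<^sub>R v + h *\<^sub>R u) - f (x + h *\<^sub>R v) - f (x + h *\<^sub>R u) + f x
       = h * h * G b"
      using one[of h v u] h(1) e le unfolding G_def add.commute[of "norm v"] by (meson order_trans)
    have "f (x + h *\<^sub>R v + h *\<^sub>R u) = f (x + h *\<^sub>R u + h *\<^sub>R v)"
      by (simp add: ac_simps)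
    then have "h * h * F a = h * h * G b" using a(2) b(2) by linarith
    then show ?thesis using a b h by auto
  qed
  define e where "e n = r / real (Suc n)" for n
  have e: "0 < e n" "e n \<le> r" for n using r by (auto simp: e_def field_simps)
  obtain a b where ab: "\<And>n. dist x (a n) \<le> e n" "\<And>n. dist x (b n) \<le> e n" "\<And>n. F (a n) = G (b n)"
    using ex[OF e] by metis
  have "e \<longlonglongrightarrow> 0" unfolding e_def by (rule LIMSEQ_Suc[OF lim_const_over_n])
  moreover have "s \<longlonglongrightarrow> x" if "\<And>n. dist x (s n) \<le> e n" "e \<longlonglongrightarrow> 0" for s
  proof -
    have "(\<lambda>n. dist (s n) x) \<longlonglongrightarrow> 0"
      by (rule tendsto_sandwich[OF _ _ tendsto_const that(2)]) (use that in \<open>simp_all add: dist_commute\<close>)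
    then show ?thesis using tendsto_dist_iff by blast
  qed
  ultimately have "a \<longlonglongrightarrow> x" "b \<longlonglongrightarrow> x"
    using ab by blast+
  then have "(\<lambda>n. F (a n)) \<longlonglongrightarrow> F x" "(\<lambda>n. G (b n)) \<longlonglongrightarrow> G x"
    using cont isCont_tendsto_compose by blast+
  then have "F x = G x" using ab(3) LIMSEQ_unique by fastforce
  then show ?thesis by (simp add: F_def G_def)
qed

lemma fder_bounded_linear_compose:
  assumes "bounded_linear L" "f differentiable at x"
  shows "fder (\<lambda>y. L (f y)) x v = L (fder f x v)"
  using bounded_linear.has_derivative[OF assms(1)] assms(2)
  by (metis fder_eqI frechet_derivative_works)

lemma fder_fder_commute:
  fixes f :: "'b::euclidean_space \<Rightarrow> 'c::euclidean_space"
  assumes f: "smooth_on T f" "open T" and x: "x \<in> T"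
  shows "fder (\<lambda>z. fder f z u) x v = fder (\<lambda>z. fder f z v) x u"
proof (rule euclidean_eqI)
  fix b :: 'c
  have diff: "f differentiable at y" if "y \<in> T" for y
    using smooth_on_has_derivative[OF f(1) that] unfolding differentiable_def by blast
  have diff2: "(\<lambda>z. fder f z w) differentiable at x" for w
    using smooth_on_has_derivative[OF smooth_on_fder[OF f, of w] x] unfolding differentiable_def by blast
  have eq: "fder (\<lambda>z. fder f z p) x q \<bullet> b = fder (\<lambda>z. fder (\<lambda>y. f y \<bullet> b) z p) x q" for p q
  proof -
    have "fder (\<lambda>z. fder (\<lambda>y. f y \<bullet> b) z p) x = fder (\<lambda>z. fder f z p \<bullet> b) x"
      by (rule fder_cong[OF f(2) x])
        (rule fder_bounded_linear_compose[OF bounded_linear_inner_left diff])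
    then show ?thesis
      using fder_bounded_linear_compose[OF bounded_linear_inner_left diff2[of p]] by metis
  qed
  have "smooth_on T (\<lambda>y. f y \<bullet> b)"
    by (rule smooth_on_bounded_linear_compose[OF bounded_linear_inner_left f(1)])
  from fder_fder_commute_real[OF this f(2) x]
  show "fder (\<lambda>z. fder f z u) x v \<bullet> b = fder (\<lambda>z. fder f z v) x u \<bullet> b"
    unfolding eq .
qed

section \<open>Levi-Civita forms along a map\<close>

text \<open>The rule for linear families is applied once per slot: first with the left argument
  frozen, then to the resulting family, which is linear in the left argument.\<close>

lemma has_derivative_bilinear_family:
  fixes G :: "'f::euclidean_space \<Rightarrow> 'f \<Rightarrow> 'f \<Rightarrow> real"
  assumes G: "\<And>v w. smooth_on W (\<lambda>q. G q v w)" and bil: "\<And>q. q \<in> W \<Longrightarrow> bilinear (G q)"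
    and S: "open S" "x \<in> S" "F ` S \<subseteq> W"
    and F: "(F has_derivative F') (at x)"
    and A: "(A has_derivative A') (at x)" and B: "(B has_derivative B') (at x)"
  shows "((\<lambda>y. G (F y) (A y) (B y)) has_derivative
    (\<lambda>h. fder (\<lambda>q. G q (A x) (B x)) (F x) (F' h) + G (F x) (A x) (B' h) + G (F x) (A' h) (B x))) (at x)"
proof -
  have W: "F y \<in> W" if "y \<in> S" for y using S that by auto
  have lin: "linear (\<lambda>w. G (F y) v w)" "linear (\<lambda>v. G (F y) v w)" if "y \<in> S" for y v w
    using bil[OF W[OF that]] by (auto simp: bilinear_def)
  have d: "((\<lambda>y. G (F y) v w) has_derivative (\<lambda>h. fder (\<lambda>q. G q v w) (F x) (F' h))) (at x)" for v w
    by (rule has_derivative_compose[OF F smooth_on_has_derivative[OF G W[OF S(2)]]])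
  have "((\<lambda>y. G (F y) v (B y)) has_derivative
      (\<lambda>h. fder (\<lambda>q. G q v (B x)) (F x) (F' h) + G (F x) v (B' h))) (at x)" for v
    by (rule has_derivative_linear_family[where A = "\<lambda>y. G (F y) v", OF lin(1) S(1,2) d B])
  from has_derivative_linear_family[where A = "\<lambda>y v. G (F y) v (B y)", OF lin(2) S(1,2) this A]
  show ?thesis .
qed

text \<open>The Koszul formula on the diagonal: by symmetry of \<Gamma>, \<open>dG n u u\<close> is
  twice the unwanted term of \<open>dG u u n\<close>. This is the only contraction of Christoffel
  symbols that is ever evaluated.\<close>

lemma levi_civita_form_diag:
  assumes "levi_civita_form G dG \<Gamma>" "\<And>v w. G v w = G w v"
  shows "G (\<Gamma> u u) n = dG u u n - dG n u u / 2"
proof -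
  have c: "dG u v w = G (\<Gamma> u v) w + G v (\<Gamma> u w)" and s: "\<Gamma> u v = \<Gamma> v u" for u v w
    using assms(1) by (auto simp: levi_civita_form_def)
  show ?thesis
    unfolding c s[of n u] using assms(2)[of u "\<Gamma> u n"] assms(2) by simp
qed

text \<open>The tangential part of the ambient acceleration is the Koszul expression of the induced
  metric. When the pullback is differentiated, the terms with the mixed second derivative of
  \<open>F\<close> along \<open>u\<close> and \<open>z\<close> cancel by symmetry, leaving only the
  one along \<open>u\<close> twice.\<close>

lemma levi_civita_form_pullback:
  fixes G :: "'f::euclidean_space \<Rightarrow> 'f \<Rightarrow> 'f \<Rightarrow> real" and F :: "'e::euclidean_space \<Rightarrow> 'f"
  assumes G: "\<And>v w. smooth_on W (\<lambda>q. G q v w)" and bil: "\<And>q. q \<in> W \<Longrightarrow> bilinear (G q)"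
    and sym: "\<And>q v w. q \<in> W \<Longrightarrow> G q v w = G q w v"
    and F: "smooth_on V F" and V: "open V" "x \<in> V" "F ` V \<subseteq> W"
    and lc: "levi_civita_form (G (F x)) (\<lambda>u v w. fder (\<lambda>q. G q v w) (F x) u) \<Gamma>"
    and g: "\<And>y v w. y \<in> V \<Longrightarrow> g y v w = G (F y) (fder F y v) (fder F y w)"
  shows "G (F x) (fder (\<lambda>y. fder F y u) x u + \<Gamma> (fder F x u) (fder F x u)) (fder F x z)
    = fder (\<lambda>y. g y u z) x u - fder (\<lambda>y. g y u u) x z / 2"
proof -
  have W: "F x \<in> W" using V by auto
  note dF = smooth_on_has_derivative[OF F V(2)]
  have dF2: "((\<lambda>y. fder F y w) has_derivative fder (\<lambda>y. fder F y w) x) (at x)" for w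
    by (rule smooth_on_has_derivative[OF smooth_on_fder[OF F V(1)] V(2)])
  have dg: "fder (\<lambda>y. g y v w) x h = fder (\<lambda>q. G q (fder F x v) (fder F x w)) (F x) (fder F x h)
      + G (F x) (fder F x v) (fder (\<lambda>y. fder F y w) x h)
      + G (F x) (fder (\<lambda>y. fder F y v) x h) (fder F x w)" for v w h
  proof -
    have "fder (\<lambda>y. g y v w) x = fder (\<lambda>y. G (F y) (fder F y v) (fder F y w)) x"
      by (rule fder_cong[OF V(1,2)]) (rule g)
    then show ?thesis
      using fder_eqI[OF has_derivative_bilinear_family[OF G bil V dF dF2[of v] dF2[of w]]] by simp
  qed
  have comm: "fder (\<lambda>y. fder F y u) x z = fder (\<lambda>y. fder F y z) x u"
    by (rule fder_fder_commute[OF F V(1,2)])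
  have add: "G (F x) (a + b) c = G (F x) a c + G (F x) b c" for a b c
    using bil[OF W] by (simp add: bilinear_ladd)
  show ?thesis
    unfolding add dg comm levi_civita_form_diag[OF lc sym[OF W]]
    using sym[OF W] by (simp add: field_simps)
qed

text \<open>The coordinate expression of \<open>doubly_warped_metric\<close>: \<eta> and
  \<open>S\<close> stand for \<open>h\<close> and \<sigma> read in a chart of the Riemannian
  factor.\<close>

definition warped_form ::
  "('e::euclidean_space \<Rightarrow> real) \<Rightarrow> (real \<Rightarrow> real) \<Rightarrow> ('e \<Rightarrow> 'e \<Rightarrow> 'e \<Rightarrow> real) \<Rightarrow>
   real \<times> 'e \<Rightarrow> real \<times> 'e \<Rightarrow> real \<times> 'e \<Rightarrow> real" where
  "warped_form \<eta> \<rho> S q a b =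
     - (\<eta> (snd q))\<^sup>2 * (fst a * fst b) + (\<rho> (fst q))\<^sup>2 * S (snd q) (snd a) (snd b)"

lemma bilinear_warped_form:
  assumes "bilinear (S (snd q))"
  shows "bilinear (warped_form \<eta> \<rho> S q)"
  using assms unfolding bilinear_def[of "warped_form \<eta> \<rho> S q"] warped_form_def
  by (auto intro!: linearI simp: bilinear_ladd bilinear_radd bilinear_lmul bilinear_rmul algebra_simps)

lemma smooth_on_warped_form:
  assumes "smooth_on O' \<eta>" "smooth_on I \<rho>" "\<And>v w. smooth_on O' (\<lambda>y. S y v w)"
  shows "smooth_on (I \<times> O') (\<lambda>q. warped_form \<eta> \<rho> S q a b)"
proof -
  have 1: "smooth_on (I \<times> O') (\<lambda>q. f (fst q))" if "smooth_on I f" for f :: "real \<Rightarrow> real"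
    by (rule smooth_on_compose[OF that smooth_on_bounded_linear[OF bounded_linear_fst]]) auto
  have 2: "smooth_on (I \<times> O') (\<lambda>q. f (snd q))" if "smooth_on O' f" for f :: "'a \<Rightarrow> real"
    by (rule smooth_on_compose[OF that smooth_on_bounded_linear[OF bounded_linear_snd]]) auto
  have "smooth_on (I \<times> O') (\<lambda>q. (- (fst a * fst b)) * (\<eta> (snd q) * \<eta> (snd q)) +
      (\<rho> (fst q) * \<rho> (fst q)) * S (snd q) (snd a) (snd b))"
    using assms by (intro smooth_on_add smooth_on_mult smooth_on_const 1 2) auto
  then show ?thesis by (simp add: warped_form_def power2_eq_square mult.commute)
qed

text \<open>In the diagonal Koszul formula with \<open>n = (1, 0)\<close>, the derivative along
  \<open>a\<close> sees only the lapse, because the spatial part of \<open>(1, 0)\<close> is zero;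
  the derivative along \<open>(1, 0)\<close> sees only \<rho>.\<close>

lemma warped_form_christoffel_time:
  fixes S :: "'e::euclidean_space \<Rightarrow> 'e \<Rightarrow> 'e \<Rightarrow> real"
  assumes lc: "levi_civita_form (warped_form \<eta> \<rho> S q) (\<lambda>u v w. fder (\<lambda>q. warped_form \<eta> \<rho> S q v w) q u) \<Gamma>"
    and O': "open O'" "snd q \<in> O'" and bil: "\<And>y. y \<in> O' \<Longrightarrow> bilinear (S y)"
    and sym: "\<And>v w. S (snd q) v w = S (snd q) w v"
    and \<eta>: "(\<eta> has_derivative \<eta>') (at (snd q))" and \<rho>: "(\<rho> has_real_derivative \<rho>') (at (fst q))"
    and S: "\<And>v w. ((\<lambda>y. S y v w) has_derivative S' v w) (at (snd q))"
  shows "warped_form \<eta> \<rho> S q (\<Gamma> a a) (1, 0) =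
    - 2 * \<eta> (snd q) * \<eta>' (snd a) * fst a - \<rho> (fst q) * \<rho>' * S (snd q) (snd a) (snd a)"
proof -
  have l1: "linear (S' v w)" for v w by (rule has_derivative_linear[OF S])
  have l2: "linear \<eta>'" by (rule has_derivative_linear[OF \<eta>])
  have fstd: "(fst has_derivative fst) (at q)" and sndd: "(snd has_derivative snd) (at q)"
    by (auto intro!: bounded_linear_imp_has_derivative bounded_linear_fst bounded_linear_snd)
  note d1 = has_derivative_compose[OF sndd \<eta>]
  note d2 = has_derivative_compose[OF fstd \<rho>[unfolded has_field_derivative_def]]
  note d3 = has_derivative_compose[OF sndd S]
  have "((\<lambda>q. warped_form \<eta> \<rho> S q v w) has_derivative
     (\<lambda>h. - (2 * \<eta> (snd q) * \<eta>' (snd h)) * (fst v * fst w)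
       + (2 * \<rho> (fst q) * (\<rho>' * fst h) * S (snd q) (snd v) (snd w)
       + (\<rho> (fst q))\<^sup>2 * S' (snd v) (snd w) (snd h)))) (at q)" for v w
    unfolding warped_form_def
    by (rule derivative_eq_intros d1 d2 d3 refl | simp add: fun_eq_iff algebra_simps)+
  note D = fder_eqI[OF this]
  \<comment> \<open>Bilinearity is used in a whole neighbourhood here: the derivative
    \<open>S' v 0\<close> vanishes because \<open>S y v 0\<close> is zero for all \<open>y\<close>
    near the base point.\<close>
  have z: "S y v 0 = 0" if "y \<in> O'" for y v using bil[OF that] bilinear_rzero by blast
  have "((\<lambda>y. S y v 0) has_derivative (\<lambda>h. 0)) (at (snd q))" for v
    by (rule has_derivative_transform_within_open[OF has_derivative_const[of 0] O']) (simp add: z)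
  then have "S' v 0 = (\<lambda>h. 0)" for v
    using has_derivative_unique[OF S[of v 0]] by simp
  moreover have "S (snd q) 0 v = 0" for v using bil[OF O'(2)] bilinear_lzero by blast
  moreover have "warped_form \<eta> \<rho> S q v w = warped_form \<eta> \<rho> S q w v" for v w
    by (simp add: warped_form_def sym)
  ultimately show ?thesis
    using levi_civita_form_diag[OF lc, of a "(1,0)"] z[OF O'(2)]
    by (simp add: D linear_0[OF l1] linear_0[OF l2])
qed

section \<open>The strong maximum principle\<close>

text \<open>If the second derivative along \<open>v\<close> were positive, the first derivative,
  zero at \<open>x\<close>, would be positive just beyond \<open>x\<close> on the line, and the mean
  value theorem would produce a value above the maximum.\<close>

lemma fder_fder_nonpos_at_maximum:
  fixes w :: "'e::euclidean_space \<Rightarrow> real"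
  assumes U: "open U" "x \<in> U" and max: "\<And>y. y \<in> U \<Longrightarrow> w y \<le> w x"
    and w: "\<And>y. y \<in> U \<Longrightarrow> (w has_derivative w' y) (at y)"
    and w2: "((\<lambda>y. w' y v) has_derivative w2) (at x)"
  shows "w' x = (\<lambda>h. 0)" "w2 v \<le> 0"
proof -
  show w0: "w' x = (\<lambda>h. 0)"
    by (rule differential_zero_maxmin[OF U(2,1) w[OF U(2)]]) (use max in blast)
  show "w2 v \<le> 0"
  proof (rule ccontr)
    assume "\<not> w2 v \<le> 0"
    then have pos: "0 < w2 v" by simp
    obtain r where r: "r > 0" "ball x r \<subseteq> U" using U open_contains_ball by blast
    define k where "k s = w' (x + s *\<^sub>R v) v" for s :: real
    have d: "((\<lambda>s. x + s *\<^sub>R v) has_derivative (\<lambda>s. s *\<^sub>R v)) (at s)" for s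
      by (auto intro!: derivative_eq_intros)
    have "(k has_derivative (\<lambda>s. w2 (s *\<^sub>R v))) (at 0)"
      unfolding k_def using has_derivative_compose[OF d[of 0], of "\<lambda>y. w' y v" w2] w2 by simp
    then have "(k has_real_derivative w2 v) (at 0)"
      unfolding has_field_derivative_def
      by (rule has_derivative_eq_rhs) (simp add: fun_eq_iff linear_cmul[OF has_derivative_linear[OF w2]])
    from has_real_derivative_pos_inc_right[OF this pos]
    obtain e where e: "e > 0" "\<And>h. 0 < h \<Longrightarrow> h < e \<Longrightarrow> k 0 < k h" by auto
    \<comment> \<open>The first bound keeps \<open>s\<close> in the range where \<open>k\<close>
      exceeds \<open>k 0\<close>, the second keeps the segment in \<open>ball x r\<close>.\<close>
    define s where "s = min (e / 2) (r / (2 * (norm v + 1)))"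
    have np: "0 < norm v + 1" by (simp add: add_nonneg_pos)
    then have s0: "0 < r / (2 * (norm v + 1))" using r by simp
    have s: "0 < s" "s < e" "s \<le> r / (2 * (norm v + 1))"
      unfolding s_def using e(1) s0 by linarith+
    have "s * (norm v + 1) \<le> r / 2" using s(3) np by (simp add: field_simps)
    then have "s * norm v < r" using s(1) r(1) by (simp add: algebra_simps)
    have inU: "x + t *\<^sub>R v \<in> U" if "0 \<le> t" "t \<le> s" for t
    proof -
      have "t * norm v \<le> s * norm v" using that by (intro mult_right_mono) auto
      then have "x + t *\<^sub>R v \<in> ball x r" using \<open>s * norm v < r\<close> that by (simp add: dist_norm)
      then show ?thesis using r by blast
    qed
    have dw: "((\<lambda>t. w (x + t *\<^sub>R v)) has_real_derivative k t) (at t)" if "0 \<le> t" "t \<le> s" for t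
    proof -
      have "((\<lambda>t. w (x + t *\<^sub>R v)) has_derivative (\<lambda>h. w' (x + t *\<^sub>R v) (h *\<^sub>R v))) (at t)"
        by (rule has_derivative_compose[OF d w[OF inU[OF that]]])
      then show ?thesis
        unfolding has_field_derivative_def k_def
        by (rule has_derivative_eq_rhs)
          (simp add: fun_eq_iff linear_cmul[OF has_derivative_linear[OF w[OF inU[OF that]]]])
    qed
    obtain t where t: "0 < t" "t < s" "w (x + s *\<^sub>R v) - w (x + 0 *\<^sub>R v) = (s - 0) * k t"
      using MVT2[OF s(1), of "\<lambda>t. w (x + t *\<^sub>R v)" k] dw by blast
    have "k t > 0" using e(2)[of t] t s by (simp add: k_def w0)
    then have "s * k t > 0" using t by simp
    then have "w (x + s *\<^sub>R v) > w x" using t(3) by simp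
    then show False using max[OF inU[of s]] s by simp
  qed
qed

text \<open>Hopf's argument. If \<^term>\<open>T\<close> were not constant near a maximum point, some ball would touch the
  set of maximum points at exactly one boundary point \<open>y\<close>. On a small ball around \<open>y\<close>, adding a small
  multiple of the barrier \<open>exp (- \<alpha> |x - a|\<^sup>2)\<close>, with \<open>a\<close> the centre of the touching ball, produces
  an interior maximum, where the differential inequality fails once \<open>\<alpha>\<close> is large.\<close>

lemma strong_maximum_principle:
  fixes T :: "'e::euclidean_space \<Rightarrow> real"
  assumes T: "smooth_on U T" "open U"
    and ell: "\<And>y. y \<in> U \<Longrightarrow> \<exists>r>0. \<exists>l>0. \<exists>C. \<forall>x\<in>ball y r \<inter> U. \<exists>B. finite B \<and>
        (\<forall>\<xi>. l * (norm \<xi>)\<^sup>2 \<le> (\<Sum>u\<in>B. (\<xi> \<bullet> u)\<^sup>2)) \<and> (\<Sum>u\<in>B. (norm u)\<^sup>2) \<le> C \<and>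
        - C * onorm (fder T x) \<le> (\<Sum>u\<in>B. fder (\<lambda>z. fder T z u) x u)"
    and x0: "x0 \<in> U" and max: "\<And>x. x \<in> U \<Longrightarrow> T x \<le> T x0"
  shows "\<exists>e>0. ball x0 e \<subseteq> U \<and> (\<forall>x\<in>ball x0 e. T x = T x0)"
proof -
  obtain e0 where e0: "e0 > 0" "cball x0 e0 \<subseteq> U" using T(2) x0 open_contains_cball by blast
  \<comment> \<open>With half the radius, a ball about a point \<open>c\<close> of
    \<open>ball x0 e\<close> whose radius is at most the distance from \<open>c\<close> to
    \<open>x0\<close> stays inside \<open>cball x0 (2 * e)\<close>.\<close>
  define e where "e = e0 / 2"
  have e: "e > 0" "cball x0 (2 * e) \<subseteq> U" using e0 by (auto simp: e_def)
  have contT: "continuous_on U T" by (rule smooth_on_imp_continuous_on[OF T(1)])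
  have False if c: "c \<in> ball x0 e" "T c \<noteq> T x0" for c
  proof -
    define Z where "Z = {x \<in> cball x0 (2 * e). T x = T x0}"
    have "closed Z"
      unfolding Z_def
      by (rule continuous_closed_preimage_constant[OF continuous_on_subset[OF contT e(2)] closed_cball])
    moreover have "x0 \<in> Z" using e by (simp add: Z_def)
    ultimately obtain y where y: "y \<in> Z" "\<And>z. z \<in> Z \<Longrightarrow> dist c y \<le> dist c z"
      using distance_attains_inf[of Z c] by blast
    have yU: "y \<in> U" using y(1) e(2) by (auto simp: Z_def)
    have Ty: "T y = T x0" using y(1) by (simp add: Z_def)
    have "dist c y \<le> dist c x0" using y(2)[OF \<open>x0 \<in> Z\<close>] .
    then have cy: "dist c y < e" using c by (simp add: dist_commute)
    have less: "T x < T x0" "x \<in> U" if "dist c x < dist c y" for x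
    proof -
      have "dist x0 x \<le> dist x0 c + dist c x" by (rule dist_triangle)
      then have x: "x \<in> cball x0 (2 * e)" using that cy c by simp
      then show "x \<in> U" using e by blast
      have "x \<notin> Z" using y(2)[of x] that by auto
      then have "T x \<noteq> T x0" using x by (auto simp: Z_def)
      then show "T x < T x0" using max[OF \<open>x \<in> U\<close>] by simp
    qed
    \<comment> \<open>The ball around \<open>c\<close> may meet \<open>Z\<close> at several boundary
      points. The ball with diameter from \<open>c\<close> to \<open>y\<close> lies inside it and
      reaches its boundary at \<open>y\<close> alone.\<close>
    define b where "b = (1/2) *\<^sub>R (y - c)"
    define a where "a = c + b"
    define R where "R = norm b"
    have yab: "y = a + b"
    proof -
      have "b + b = 2 *\<^sub>R b" by (simp only: scaleR_2)
      also have "\<dots> = y - c" by (simp add: b_def)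
      finally have "b + b = y - c" .
      then have "c + b + b = c + (y - c)" by (simp only: add.assoc)
      then show ?thesis by (simp add: a_def)
    qed
    have "c \<noteq> y" using c Ty by auto
    then have R: "R > 0" by (auto simp: R_def b_def)
    have dcy: "dist c y = 2 * R"
    proof -
      have "y - c = 2 *\<^sub>R b" by (simp add: b_def)
      then have "norm (y - c) = 2 * R" by (simp add: R_def)
      then show ?thesis by (simp add: dist_norm norm_minus_commute)
    qed
    have touch: "T x < T x0" if x: "dist a x \<le> R" "x \<noteq> y" for x
    proof -
      have "dist c x < dist c y"
      proof (rule ccontr)
        assume "\<not> ?thesis"
        \<comment> \<open>If \<open>x - a\<close> has norm at most \<open>R\<close> and
          \<open>x - a + b\<close> has norm at least \<open>2 * R\<close>, the parallelogram
          identity forces \<open>x - a = b\<close>.\<close>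
        then have "(2 * R)\<^sup>2 \<le> (norm (x - c))\<^sup>2"
          using R dcy by (intro power_mono) (auto simp: dist_norm norm_minus_commute)
        also have "x - c = (x - a) + b" by (simp add: a_def)
        also have "(norm ((x - a) + b))\<^sup>2 = (norm (x - a))\<^sup>2 + 2 * ((x - a) \<bullet> b) + R\<^sup>2"
          by (simp add: power2_norm_eq_inner inner_simps inner_commute R_def)
        finally have 1: "(2 * R)\<^sup>2 \<le> (norm (x - a))\<^sup>2 + 2 * ((x - a) \<bullet> b) + R\<^sup>2" .
        have 2: "(norm (x - a))\<^sup>2 \<le> R\<^sup>2"
          using x(1) by (intro power_mono) (auto simp: dist_norm norm_minus_commute)
        have "(norm ((x - a) - b))\<^sup>2 = (norm (x - a))\<^sup>2 - 2 * ((x - a) \<bullet> b) + R\<^sup>2"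
          by (simp add: power2_norm_eq_inner inner_simps inner_commute R_def)
        then have "(norm ((x - a) - b))\<^sup>2 \<le> 0" using 1 2 by (simp add: power_mult_distrib)
        then have "x = a + b" by (simp add: algebra_simps)
        then show False using x(2) yab by simp
      qed
      then show ?thesis by (rule less)
    qed
    \<comment> \<open>The set \<open>B\<close> encodes the second-order operator at a point: its
      symbol is \<open>\<Sum>u\<in>B. (\<xi> \<bullet> u)\<^sup>2\<close>, so \<open>l\<close> is
      the ellipticity constant, while \<open>C\<close> bounds the trace and the first-order
      coefficient.\<close>
    obtain r l C where r: "r > 0" and l: "l > 0" and "\<forall>x\<in>ball y r \<inter> U. \<exists>B. finite B \<and>
        (\<forall>\<xi>. l * (norm \<xi>)\<^sup>2 \<le> (\<Sum>u\<in>B. (\<xi> \<bullet> u)\<^sup>2)) \<and> (\<Sum>u\<in>B. (norm u)\<^sup>2) \<le> C \<and>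
        - C * onorm (fder T x) \<le> (\<Sum>u\<in>B. fder (\<lambda>z. fder T z u) x u)"
      using ell[OF yU] by (elim exE conjE)
    note B = bspec[OF this(3)]
    have "C \<ge> 0"
    proof -
      have "y \<in> ball y r \<inter> U" using r yU by simp
      from B[OF this] obtain B :: "'e set" where "(\<Sum>u\<in>B. (norm u)\<^sup>2) \<le> C"
        by (elim exE conjE) (rule that)
      moreover have "0 \<le> (\<Sum>u\<in>B. (norm u)\<^sup>2)" by (simp add: sum_nonneg)
      ultimately show ?thesis by linarith
    qed
    obtain r1 where r1: "r1 > 0" "cball y r1 \<subseteq> U" using T(2) yU open_contains_cball by blast
    \<comment> \<open>The ball stays in \<open>U\<close>, in the region where \<open>l\<close> and
      \<open>C\<close> are valid, and away from the centre \<open>a\<close>, where the gradient of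
      the barrier vanishes.\<close>
    define d where "d = Min {r1, r / 2, R / 2}"
    have d: "d > 0" "d \<le> r1" "d < r" "d < R" using r1 r R by (auto simp: d_def min_def)
    have dU: "cball y d \<subseteq> U" using r1 d by (auto simp: subset_iff)
    have dball: "x \<in> ball y r \<inter> U" if "x \<in> cball y d" for x
      using that d dU by auto
    \<comment> \<open>Chosen so that the second-order contribution of the barrier outweighs the
      trace bound \<open>C\<close> together with the gradient contribution
      \<open>2 * R * C\<close>.\<close>
    define \<alpha> where "\<alpha> = (C + 2 * R * C + 1) / (l * (R - d)\<^sup>2)"
    have "(R - d)\<^sup>2 > 0" using d by simp
    then have \<alpha>: "\<alpha> > 0" "\<alpha> * (l * (R - d)\<^sup>2) = C + 2 * R * C + 1"
      using l R \<open>C \<ge> 0\<close> by (auto simp: \<alpha>_def intro!: divide_pos_pos add_nonneg_pos)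
    define E where "E x = exp (- \<alpha> * ((x - a) \<bullet> (x - a)))" for x
    define E' where "E' x v = - 2 * \<alpha> * E x * ((x - a) \<bullet> v)" for x v
    define E2 where "E2 x v h = - 2 * \<alpha> * (E' x h * ((x - a) \<bullet> v) + E x * (h \<bullet> v))" for x v h
    have dE: "(E has_derivative E' x) (at x)" for x
      unfolding E_def E'_def
      by (auto intro!: derivative_eq_intros simp: fun_eq_iff inner_commute)
    have dE2: "((\<lambda>x. E' x v) has_derivative E2 x v) (at x)" for x v
      unfolding E'_def E2_def
      by (rule derivative_eq_intros dE refl | simp add: fun_eq_iff E'_def algebra_simps)+
    have Epos: "E x > 0" "E x \<le> 1" for x using \<alpha>(1) by (auto simp: E_def)
    have Eless: "E x < E y" if "dist a x > R" for x
    proof -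
      have "R\<^sup>2 < (norm (x - a))\<^sup>2"
        using that R by (intro power_strict_mono) (auto simp: dist_norm norm_minus_commute)
      then have "b \<bullet> b < (x - a) \<bullet> (x - a)" by (simp add: R_def power2_norm_eq_inner)
      then show ?thesis using \<alpha>(1) by (simp add: E_def yab)
    qed
    \<comment> \<open>The sphere about \<open>y\<close> splits in two: on \<open>S1\<close>,
      \<open>T\<close> stays below its maximum by a definite amount, by compactness; off
      \<open>S1\<close> the barrier \<open>E x - E y\<close> is negative.\<close>
    define S1 where "S1 = sphere y d \<inter> cball a R"
    have contd: "continuous_on (cball y d) T" by (rule continuous_on_subset[OF contT dU])
    have "\<exists>\<eta>>0. \<forall>x\<in>S1. T x \<le> T x0 - \<eta>"
    proof (cases "S1 = {}")
      case False
      have "compact S1" by (simp add: S1_def compact_Int_closed)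
      moreover have "continuous_on S1 T"
        by (rule continuous_on_subset[OF contd]) (auto simp: S1_def)
      ultimately obtain m where m: "m \<in> S1" "\<And>x. x \<in> S1 \<Longrightarrow> T x \<le> T m"
        using continuous_attains_sup[OF _ False] by blast
      have "T m < T x0" using m(1) d by (intro touch) (auto simp: S1_def)
      then show ?thesis using m(2) by (intro exI[of _ "T x0 - T m"]) auto
    qed (auto intro: exI[of _ 1])
    then obtain \<eta> where \<eta>: "\<eta> > 0" "\<And>x. x \<in> S1 \<Longrightarrow> T x \<le> T x0 - \<eta>" by blast
    \<comment> \<open>As \<open>E x - E y\<close> is at most 1, a barrier scaled by \<delta> <
      \<eta> cannot make up for the loss \<eta> on \<open>S1\<close>.\<close>
    define \<delta> where "\<delta> = \<eta> / 2"
    have \<delta>: "\<delta> > 0" "\<delta> < \<eta>" using \<eta> by (auto simp: \<delta>_def)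
    define w where "w x = T x + \<delta> * (E x - E y)" for x
    have wy: "w y = T x0" by (simp add: w_def Ty)
    have bd: "w x < T x0" if "x \<in> sphere y d" for x
    proof (cases "dist a x \<le> R")
      case True
      then have "T x \<le> T x0 - \<eta>" using that by (intro \<eta>(2)) (auto simp: S1_def)
      moreover have "\<delta> * (E x - E y) \<le> \<delta> * 1"
        using Epos[of x] Epos[of y] \<delta> by (intro mult_left_mono) auto
      ultimately show ?thesis using \<delta> unfolding w_def by linarith
    next
      case False
      then have "E x - E y < 0" using Eless[of x] by simp
      then have "\<delta> * (E x - E y) < 0" using \<delta> by (simp add: mult_pos_neg)
      moreover have "x \<in> U" using dU that by auto
      ultimately show ?thesis using max[of x] by (simp add: w_def)
    qed
    have "continuous_on (cball y d) E"
      unfolding E_def by (intro continuous_intros)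
    then have "continuous_on (cball y d) w"
      unfolding w_def by (intro continuous_intros contd)
    moreover have "cball y d \<noteq> {}" using d by auto
    ultimately obtain x1 where x1: "x1 \<in> cball y d" "\<And>x. x \<in> cball y d \<Longrightarrow> w x \<le> w x1"
      using continuous_attains_sup[OF compact_cball] by blast
    have "w y \<le> w x1" using d by (intro x1(2)) auto
    then have "x1 \<notin> sphere y d" using bd[of x1] wy by auto
    then have x1b: "x1 \<in> ball y d" using x1(1) by auto
    have x1U: "x1 \<in> U" using dU x1(1) by blast
    have dT: "(T has_derivative fder T x) (at x)" if "x \<in> U" for x
      by (rule smooth_on_has_derivative[OF T(1) that])
    have dT2: "((\<lambda>x. fder T x v) has_derivative fder (\<lambda>x. fder T x v) x1) (at x1)" for v
      by (rule smooth_on_has_derivative[OF smooth_on_fder[OF T] x1U])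
    define w' where "w' x v = fder T x v + \<delta> * E' x v" for x v
    have dw: "(w has_derivative w' x) (at x)" if "x \<in> ball y d" for x
    proof -
      have "x \<in> U" using that dU by auto
      have "((\<lambda>x. T x + \<delta> * (E x - E y)) has_derivative (\<lambda>v. fder T x v + \<delta> * (E' x v - 0))) (at x)"
        by (intro has_derivative_add has_derivative_mult_right has_derivative_diff
            has_derivative_const dT dE \<open>x \<in> U\<close>)
      then show ?thesis by (simp add: w_def[abs_def] w'_def[abs_def])
    qed
    have dw2: "((\<lambda>x. w' x v) has_derivative (\<lambda>h. fder (\<lambda>x. fder T x v) x1 h + \<delta> * E2 x1 v h)) (at x1)" for v
      unfolding w'_def by (intro has_derivative_add has_derivative_mult_right dT2 dE2)
    have mx: "w x \<le> w x1" if "x \<in> ball y d" for x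
      using x1(2) that by auto
    \<comment> \<open>At the interior maximum of \<open>w\<close> the gradient of \<open>T\<close>
      equals that of \<open>- \<delta> * E\<close>, and its second derivatives are at most those of
      \<open>- \<delta> * E\<close>; the rest is explicit computation with the exponential.\<close>
    note cr = fder_fder_nonpos_at_maximum[OF open_ball x1b mx dw dw2]
    have T1: "fder T x1 v = 2 * \<alpha> * \<delta> * E x1 * ((x1 - a) \<bullet> v)" for v
      using fun_cong[OF cr(1), of v] by (simp add: w'_def E'_def algebra_simps)
    have T2: "fder (\<lambda>x. fder T x v) x1 v \<le>
        2 * \<alpha> * \<delta> * E x1 * ((norm v)\<^sup>2 - 2 * \<alpha> * ((x1 - a) \<bullet> v)\<^sup>2)" for v
      using cr(2)[of v] unfolding power2_norm_eq_inner
      by (simp add: E2_def E'_def power2_eq_square algebra_simps)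
    define k where "k = 2 * \<alpha> * \<delta> * E x1"
    have k: "k > 0" using \<alpha> \<delta> Epos by (simp add: k_def)
    \<comment> \<open>The distance of \<open>x1\<close> from the centre \<open>a\<close> lies
      between \<open>R - d\<close> and \<open>2 * R\<close>. The lower bound feeds the ellipticity,
      the upper bound the gradient term.\<close>
    have "dist a x1 \<le> dist a y + dist y x1" by (rule dist_triangle)
    moreover have "dist a y = R" by (simp add: yab R_def dist_norm)
    ultimately have up: "norm (x1 - a) \<le> 2 * R"
      using x1b d by (simp add: dist_norm norm_minus_commute)
    have "dist a y \<le> dist a x1 + dist x1 y" by (rule dist_triangle)
    then have lo: "R - d \<le> norm (x1 - a)"
      using x1b \<open>dist a y = R\<close> by (simp add: dist_norm norm_minus_commute)
    have "onorm (fder T x1) \<le> k * (2 * R)"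
    proof (rule onorm_bound)
      show "0 \<le> k * (2 * R)" using k R by simp
      fix v
      have "norm (fder T x1 v) = k * \<bar>(x1 - a) \<bullet> v\<bar>"
        using k by (simp add: T1 k_def[symmetric] abs_mult)
      also have "\<dots> \<le> k * (2 * R * norm v)"
        using k order_trans[OF Cauchy_Schwarz_ineq2[of "x1 - a" v] mult_right_mono[OF up norm_ge_zero]]
        by (intro mult_left_mono) auto
      finally show "norm (fder T x1 v) \<le> k * (2 * R) * norm v" by (simp add: mult.assoc)
    qed
    then have on: "C * onorm (fder T x1) \<le> C * (k * (2 * R))"
      using \<open>C \<ge> 0\<close> by (rule mult_left_mono)
    obtain B where B: "finite B" "\<forall>\<xi>. l * (norm \<xi>)\<^sup>2 \<le> (\<Sum>u\<in>B. (\<xi> \<bullet> u)\<^sup>2)" "(\<Sum>u\<in>B. (norm u)\<^sup>2) \<le> C"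
        "- C * onorm (fder T x1) \<le> (\<Sum>u\<in>B. fder (\<lambda>z. fder T z u) x1 u)"
      using B[OF dball[OF x1(1)]] by (elim exE conjE)
    have "(\<Sum>u\<in>B. fder (\<lambda>z. fder T z u) x1 u) \<le> (\<Sum>u\<in>B. k * ((norm u)\<^sup>2 - 2 * \<alpha> * ((x1 - a) \<bullet> u)\<^sup>2))"
      by (rule sum_mono) (use T2 in \<open>simp add: k_def\<close>)
    also have "\<dots> = k * ((\<Sum>u\<in>B. (norm u)\<^sup>2) - 2 * \<alpha> * (\<Sum>u\<in>B. ((x1 - a) \<bullet> u)\<^sup>2))"
      by (simp only: sum_distrib_left[symmetric] sum_subtractf)
    also have "\<dots> \<le> k * (C - 2 * \<alpha> * (l * (R - d)\<^sup>2))"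
    proof -
      have "l * (R - d)\<^sup>2 \<le> l * (norm (x1 - a))\<^sup>2"
        using l lo d by (intro mult_left_mono power_mono) auto
      also have "\<dots> \<le> (\<Sum>u\<in>B. ((x1 - a) \<bullet> u)\<^sup>2)" by (rule spec[OF B(2)])
      finally have "\<alpha> * (l * (R - d)\<^sup>2) \<le> \<alpha> * (\<Sum>u\<in>B. ((x1 - a) \<bullet> u)\<^sup>2)"
        using \<alpha> by (intro mult_left_mono) auto
      then show ?thesis using k B(3) by (intro mult_left_mono) auto
    qed
    also have "\<dots> = k * (C - 2 * (C + 2 * R * C + 1))" by (simp add: \<alpha>(2) mult.assoc)
    finally have "- (C * (k * (2 * R))) \<le> k * (C - 2 * (C + 2 * R * C + 1))"
      using B(4) on by linarith
    then have "k * (C + 2 * R * C + 2) \<le> 0" by (simp add: algebra_simps)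
    moreover have "C + 2 * R * C + 2 > 0" using \<open>C \<ge> 0\<close> R by (simp add: add_nonneg_pos)
    ultimately show False using k by (meson mult_pos_pos not_less)
  qed
  then have "\<forall>x\<in>ball x0 e. T x = T x0" by blast
  moreover have "ball x0 e \<subseteq> U" using e by (auto simp: subset_iff)
  ultimately show ?thesis using e(1) by blast
qed

section \<open>Uniform bounds for fields of bilinear forms\<close>

text \<open>The weight \<open>n\<close> allows iteration over the slots of a multilinear family: the
  other arguments are packed into the index \<open>x\<close> and their norms into
  \<open>n x\<close>.\<close>

lemma linear_family_bound:
  fixes A :: "'i \<Rightarrow> 'e::euclidean_space \<Rightarrow> real"
  assumes lin: "\<And>x. x \<in> X \<Longrightarrow> linear (A x)"
    and bd: "\<And>b. b \<in> Basis \<Longrightarrow> \<exists>C. \<forall>x\<in>X. \<bar>A x b\<bar> \<le> C * n x"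
    and n: "\<And>x. x \<in> X \<Longrightarrow> n x \<ge> 0"
  shows "\<exists>C\<ge>0. \<forall>x\<in>X. \<forall>v. \<bar>A x v\<bar> \<le> C * n x * norm v"
proof -
  obtain C where C: "\<And>b x. b \<in> Basis \<Longrightarrow> x \<in> X \<Longrightarrow> \<bar>A x b\<bar> \<le> C b * n x"
    using bd by metis
  have "\<bar>A x v\<bar> \<le> (\<Sum>b\<in>Basis. \<bar>C b\<bar>) * n x * norm v" if x: "x \<in> X" for x v
  proof -
    have "\<bar>A x v\<bar> = \<bar>\<Sum>b\<in>Basis. (v \<bullet> b) * A x b\<bar>"
      using linear_basis_expansion[OF lin[OF x], of v] by simp
    also have "\<dots> \<le> (\<Sum>b\<in>Basis. \<bar>(v \<bullet> b) * A x b\<bar>)" by (rule sum_abs)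
    also have "\<dots> \<le> (\<Sum>b\<in>Basis. norm v * (\<bar>C b\<bar> * n x))"
    proof (rule sum_mono)
      fix b :: 'e assume b: "b \<in> Basis"
      have "\<bar>A x b\<bar> \<le> \<bar>C b\<bar> * n x"
        using C[OF b x] n[OF x] by (meson abs_ge_self mult_right_mono order_trans)
      then show "\<bar>(v \<bullet> b) * A x b\<bar> \<le> norm v * (\<bar>C b\<bar> * n x)"
        using Basis_le_norm[OF b] unfolding abs_mult by (intro mult_mono) auto
    qed
    also have "\<dots> = (\<Sum>b\<in>Basis. \<bar>C b\<bar>) * n x * norm v"
      by (simp add: sum_distrib_left sum_distrib_right algebra_simps)
    finally show ?thesis .
  qed
  then show ?thesis by (intro exI[of _ "\<Sum>b\<in>Basis. \<bar>C b\<bar>"]) (simp add: sum_nonneg)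
qed

lemma compact_bound_real:
  fixes f :: "'e::euclidean_space \<Rightarrow> real"
  assumes "compact K" "continuous_on K f"
  shows "\<exists>C. \<forall>x\<in>K. \<bar>f x\<bar> \<le> C"
proof -
  have "bounded (f ` K)" using assms compact_continuous_image compact_imp_bounded by blast
  then show ?thesis by (auto simp: bounded_iff)
qed

lemma smooth_on_fder_bound:
  fixes f :: "'e::euclidean_space \<Rightarrow> real"
  assumes f: "smooth_on U f" "open U" and K: "compact K" "K \<subseteq> U"
  shows "\<exists>C\<ge>0. \<forall>x\<in>K. \<forall>v. \<bar>fder f x v\<bar> \<le> C * norm v"
proof -
  have "\<exists>C\<ge>0. \<forall>x\<in>K. \<forall>v. \<bar>fder f x v\<bar> \<le> C * 1 * norm v"
  proof (rule linear_family_bound)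
    show "linear (fder f x)" if "x \<in> K" for x
      using smooth_on_fder_linear[OF f(1)] K(2) that by blast
    show "\<exists>C. \<forall>x\<in>K. \<bar>fder f x b\<bar> \<le> C * 1" for b
      using compact_bound_real[OF K(1) continuous_on_subset[OF
          smooth_on_imp_continuous_on[OF smooth_on_fder[OF f, of b]] K(2)]] by simp
  qed auto
  then show ?thesis by simp
qed

text \<open>The local form of a Riemannian metric, a field of inner products on an open set of
  coordinates. Estimates and frames are developed at this level, where vectors are elements of the
  model space and not derivations.\<close>

locale metric_form =
  fixes U :: "'e::euclidean_space set" and G :: "'e \<Rightarrow> 'e \<Rightarrow> 'e \<Rightarrow> real"
  assumes open_U: "open U"
    and smooth_G: "\<And>v w. smooth_on U (\<lambda>x. G x v w)"
    and bilinear_G: "\<And>x. x \<in> U \<Longrightarrow> bilinear (G x)"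
    and sym_G: "\<And>x v w. x \<in> U \<Longrightarrow> G x v w = G x w v"
    and pos_G: "\<And>x v. x \<in> U \<Longrightarrow> v \<noteq> 0 \<Longrightarrow> G x v v > 0"
begin

lemma linear_G: "x \<in> U \<Longrightarrow> linear (G x v)" "x \<in> U \<Longrightarrow> linear (\<lambda>v. G x v w)"
  using bilinear_G by (auto simp: bilinear_def)

lemma G_expansion: "x \<in> U \<Longrightarrow> G x v w = (\<Sum>b\<in>Basis. \<Sum>b'\<in>Basis. (v \<bullet> b) * ((w \<bullet> b') * G x b b'))"
  using linear_basis_expansion[OF linear_G(2), of x v w] linear_basis_expansion[OF linear_G(1), of x _ w]
  by (simp add: sum_distrib_left)

text \<open>Smoothness in \<open>x\<close> for fixed vectors gives joint continuity in the point and
  the vector, because the bilinear form is a finite sum over basis pairs.\<close>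

lemma continuous_on_G_diag: "continuous_on (U \<times> UNIV) (\<lambda>(x, v). G x v v)"
proof -
  have c: "continuous_on (U \<times> UNIV) (\<lambda>p. G (fst p) b b')" for b b'
    by (rule continuous_on_compose2[OF smooth_on_imp_continuous_on[OF smooth_G]])
      (auto intro: continuous_intros)
  have "continuous_on (U \<times> UNIV) (\<lambda>p. \<Sum>b\<in>Basis. \<Sum>b'\<in>Basis.
      (snd p \<bullet> b) * ((snd p \<bullet> b') * G (fst p) b b'))"
    by (intro continuous_intros c)
  then show ?thesis
    by (rule continuous_on_eq) (auto simp: G_expansion)
qed

text \<open>The extreme values of \<open>G x v v\<close> over \<open>K\<close> times the unit sphere
  are the two constants, and homogeneity extends them to all \<open>v\<close>. They make the
  Euclidean norm comparable with the metric.\<close>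

lemma G_bounds:
  assumes K: "compact K" "K \<subseteq> U"
  shows "\<exists>l>0. \<exists>L>0. \<forall>x\<in>K. \<forall>v. l * (norm v)\<^sup>2 \<le> G x v v \<and> G x v v \<le> L * (norm v)\<^sup>2"
proof (cases "K = {}")
  case False
  define X where "X = K \<times> sphere (0::'e) 1"
  have X: "compact X" unfolding X_def using K by (simp add: compact_Times)
  obtain b :: 'e where "b \<in> Basis" using nonempty_Basis by blast
  then have "b \<in> sphere 0 1" by simp
  then have ne: "X \<noteq> {}" using False by (auto simp: X_def simp del: mem_sphere_0)
  have c: "continuous_on X (\<lambda>(x, v). G x v v)"
    by (rule continuous_on_subset[OF continuous_on_G_diag]) (use K in \<open>auto simp: X_def\<close>)
  obtain m where m: "m \<in> X" "\<And>q. q \<in> X \<Longrightarrow> (\<lambda>(x, v). G x v v) m \<le> (\<lambda>(x, v). G x v v) q"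
    using continuous_attains_inf[OF X ne c] by blast
  obtain M where M: "M \<in> X" "\<And>q. q \<in> X \<Longrightarrow> (\<lambda>(x, v). G x v v) q \<le> (\<lambda>(x, v). G x v v) M"
    using continuous_attains_sup[OF X ne c] by blast
  define l where "l = (\<lambda>(x, v). G x v v) m"
  define L where "L = (\<lambda>(x, v). G x v v) M"
  have pos: "(\<lambda>(x, v). G x v v) q > 0" if "q \<in> X" for q
  proof -
    have "fst q \<in> U" "snd q \<noteq> 0" using that K by (auto simp: X_def)
    then show ?thesis using pos_G by (auto simp: split_beta)
  qed
  have "l * (norm v)\<^sup>2 \<le> G x v v \<and> G x v v \<le> L * (norm v)\<^sup>2" if x: "x \<in> K" for x v
  proof (cases "v = 0")
    case True
    then show ?thesis using x K linear_0[OF linear_G(1)] by auto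
  next
    case nz: False
    define u where "u = v /\<^sub>R norm v"
    have "(x, u) \<in> X" using x nz by (simp add: X_def u_def)
    from m(2)[OF this] M(2)[OF this] have u: "l \<le> G x u u" "G x u u \<le> L" by (auto simp: l_def L_def)
    have xU: "x \<in> U" using x K by blast
    have "v = norm v *\<^sub>R u" using nz by (simp add: u_def)
    then have "G x v v = G x (norm v *\<^sub>R u) (norm v *\<^sub>R u)" by (rule arg_cong[where f = "\<lambda>z. G x z z"])
    then have "G x v v = (norm v)\<^sup>2 * G x u u"
      by (simp add: bilinear_lmul[OF bilinear_G[OF xU]] bilinear_rmul[OF bilinear_G[OF xU]] power2_eq_square)
    then show ?thesis using u by (simp add: mult.commute mult_left_mono mult_right_mono)
  qed
  then show ?thesis
    using pos[OF m(1)] pos[OF M(1)] unfolding l_def[symmetric] L_def[symmetric] by blast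
qed (auto intro: exI[of _ 1])

text \<open>Linearity in the metric slots is inherited by differentiating the linearity of
  \<open>G\<close> on the open set. The bound is then extended slot by slot: over \<open>v\<close>
  with index \<open>(x, u)\<close>, over \<open>w\<close> with index
  \<open>(x, u, v)\<close>.\<close>

lemma fder_G_bound:
  assumes K: "compact K" "K \<subseteq> U"
  shows "\<exists>C\<ge>0. \<forall>x\<in>K. \<forall>u v w. \<bar>fder (\<lambda>y. G y v w) x u\<bar> \<le> C * norm u * norm v * norm w"
proof -
  have d: "((\<lambda>y. G y v w) has_derivative fder (\<lambda>y. G y v w) x) (at x)" if "x \<in> K" for x v w
    by (rule smooth_on_has_derivative[OF smooth_G]) (use K that in auto)
  have lin: "linear (\<lambda>v. fder (\<lambda>y. G y v w) x u)" if x: "x \<in> K" for x u w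
  proof (rule linearI)
    have xU: "x \<in> U" using K x by blast
    fix a b and r :: real
    have "fder (\<lambda>y. G y (a + b) w) x = fder (\<lambda>y. G y a w + G y b w) x"
      by (rule fder_cong[OF open_U xU]) (rule linear_add[OF linear_G(2)])
    then show "fder (\<lambda>y. G y (a + b) w) x u = fder (\<lambda>y. G y a w) x u + fder (\<lambda>y. G y b w) x u"
      using fder_eqI[OF has_derivative_add[OF d[OF x, of a w] d[OF x, of b w]]] by simp
    have "fder (\<lambda>y. G y (r *\<^sub>R a) w) x = fder (\<lambda>y. r *\<^sub>R G y a w) x"
      by (rule fder_cong[OF open_U xU]) (rule linear_cmul[OF linear_G(2)])
    then show "fder (\<lambda>y. G y (r *\<^sub>R a) w) x u = r *\<^sub>R fder (\<lambda>y. G y a w) x u"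
      using fder_eqI[OF has_derivative_scaleR_right[OF d[OF x, of a w]]] by simp
  qed
  have swap: "fder (\<lambda>y. G y v w) x u = fder (\<lambda>y. G y w v) x u" if x: "x \<in> K" for x u v w
    by (rule fun_cong[OF fder_cong[OF open_U]]) (use x K sym_G in auto)
  have lin': "linear (\<lambda>w. fder (\<lambda>y. G y v w) x u)" if x: "x \<in> K" for x u v
    using lin[OF x, of v u] by (simp add: swap[OF x, of v])
  have "\<exists>C\<ge>0. \<forall>q\<in>K\<times>UNIV. \<forall>v. \<bar>fder (\<lambda>y. G y v c) (fst q) (snd q)\<bar> \<le> C * norm (snd q) * norm v" for c
  proof (rule linear_family_bound)
    show "\<exists>C. \<forall>q\<in>K\<times>UNIV. \<bar>fder (\<lambda>y. G y b c) (fst q) (snd q)\<bar> \<le> C * norm (snd q)" for b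
      using smooth_on_fder_bound[OF smooth_G open_U K, of b c] by fastforce
  qed (auto intro: lin)
  note 1 = this
  have 2: "\<exists>C. \<forall>q\<in>K\<times>UNIV\<times>UNIV. \<bar>fder (\<lambda>y. G y (snd (snd q)) c) (fst q) (fst (snd q))\<bar>
      \<le> C * (norm (fst (snd q)) * norm (snd (snd q)))" for c
  proof -
    obtain C where C: "\<And>q v. q \<in> K \<times> UNIV \<Longrightarrow>
        \<bar>fder (\<lambda>y. G y v c) (fst q) (snd q)\<bar> \<le> C * norm (snd q) * norm v"
      using 1[of c] by blast
    show ?thesis
    proof (intro exI[of _ C] ballI)
      fix q :: "'e \<times> 'e \<times> 'e" assume "q \<in> K \<times> UNIV \<times> UNIV"
      then show "\<bar>fder (\<lambda>y. G y (snd (snd q)) c) (fst q) (fst (snd q))\<bar>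
          \<le> C * (norm (fst (snd q)) * norm (snd (snd q)))"
        using C[of "(fst q, fst (snd q))" "snd (snd q)"] by (simp add: mult.assoc mem_Times_iff)
    qed
  qed
  have "\<exists>C\<ge>0. \<forall>q\<in>K\<times>UNIV\<times>UNIV. \<forall>w. \<bar>fder (\<lambda>y. G y (snd (snd q)) w) (fst q) (fst (snd q))\<bar>
      \<le> C * (norm (fst (snd q)) * norm (snd (snd q))) * norm w"
  proof (rule linear_family_bound)
    fix q :: "'e \<times> 'e \<times> 'e" assume "q \<in> K \<times> UNIV \<times> UNIV"
    then show "linear (\<lambda>w. fder (\<lambda>y. G y (snd (snd q)) w) (fst q) (fst (snd q)))"
      by (intro lin') auto
  qed (rule 2, simp)
  then obtain C where "C \<ge> 0" and C: "\<And>q w. q \<in> K \<times> UNIV \<times> UNIV \<Longrightarrow>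
      \<bar>fder (\<lambda>y. G y (snd (snd q)) w) (fst q) (fst (snd q))\<bar>
      \<le> C * (norm (fst (snd q)) * norm (snd (snd q))) * norm w" by blast
  have "\<bar>fder (\<lambda>y. G y v w) x u\<bar> \<le> C * norm u * norm v * norm w" if "x \<in> K" for x u v w
    using C[of "(x, u, v)" w] that by (simp add: mult.assoc)
  then show ?thesis using \<open>C \<ge> 0\<close> by blast
qed

end

section \<open>Charts, tangent vectors and metrics\<close>

locale smooth_mfd =
  fixes A :: "('a::{t2_space, second_countable_topology}, 'e::euclidean_space) atlas"
  assumes smooth_manifold: "smooth_manifold A"
begin

lemma open_cdom: "c \<in> A \<Longrightarrow> open (cdom c)"
  and open_cmap_image: "c \<in> A \<Longrightarrow> open (cmap c ` cdom c)"
  and chart_homeomorphism: "c \<in> A \<Longrightarrow> homeomorphism (cdom c) (cmap c ` cdom c) (cmap c) (cinv c)"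
  and smooth_on_transition:
    "c \<in> A \<Longrightarrow> d \<in> A \<Longrightarrow> smooth_on (cmap c ` (cdom c \<inter> cdom d)) (cmap d \<circ> cinv c)"
  using smooth_manifold unfolding smooth_manifold_def by blast+

lemma open_carrier: "open (carrier A)"
  unfolding carrier_def by (auto intro: open_cdom)

lemma cinv_cmap: "c \<in> A \<Longrightarrow> p \<in> cdom c \<Longrightarrow> cinv c (cmap c p) = p"
  using homeomorphism_apply1[OF chart_homeomorphism] by blast

lemma cmap_cinv: "c \<in> A \<Longrightarrow> x \<in> cmap c ` cdom c \<Longrightarrow> cmap c (cinv c x) = x"
  using homeomorphism_apply2[OF chart_homeomorphism] by blast

lemma cinv_in_cdom: "x \<in> cmap c ` cdom c \<Longrightarrow> cinv c x \<in> cdom c"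
  by (rule inv_into_into)

lemma cinv_in: "c \<in> A \<Longrightarrow> W \<subseteq> cdom c \<Longrightarrow> x \<in> cmap c ` W \<Longrightarrow> cinv c x \<in> W"
  using cinv_cmap by auto

lemma continuous_on_cmap: "c \<in> A \<Longrightarrow> continuous_on (cdom c) (cmap c)"
  and continuous_on_cinv: "c \<in> A \<Longrightarrow> continuous_on (cmap c ` cdom c) (cinv c)"
  using chart_homeomorphism homeomorphism_def by blast+

lemma open_cmap_image_Int:
  assumes "c \<in> A" "open W"
  shows "open (cmap c ` (cdom c \<inter> W))"
proof -
  have "cmap c ` (cdom c \<inter> W) = cmap c ` cdom c \<inter> cinv c -` W"
    using cinv_cmap[OF assms(1)] by auto
  then show ?thesis
    using continuous_open_preimage[OF continuous_on_cinv open_cmap_image] assms by simp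
qed

lemma open_cmap_image_subset: "c \<in> A \<Longrightarrow> open W \<Longrightarrow> W \<subseteq> cdom c \<Longrightarrow> open (cmap c ` W)"
  using open_cmap_image_Int[of c W] by (simp add: Int_absorb1)

lemma chart_at: "p \<in> carrier A \<Longrightarrow> chart_at A p \<in> A \<and> p \<in> cdom (chart_at A p)"
  unfolding chart_at_def carrier_def by (rule someI_ex) auto

lemma cdom_subset_carrier: "c \<in> A \<Longrightarrow> cdom c \<subseteq> carrier A"
  by (auto simp: carrier_def)

text \<open>One chart suffices, since transition maps carry smoothness on \<open>W\<close> to every
  other chart of the atlas.\<close>

lemma smooth_nearI:
  assumes c: "c \<in> A" and W: "open W" "p \<in> W" "W \<subseteq> cdom c"
    and f: "smooth_on (cmap c ` W) (f \<circ> cinv c)"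
  shows "smooth_near A p f"
  unfolding smooth_near_def
proof (intro exI[of _ W] conjI)
  show "W \<subseteq> carrier A" using W cdom_subset_carrier[OF c] by blast
  show "smooth_fun_on A W f"
    unfolding smooth_fun_on_def
  proof
    fix d assume d: "d \<in> A"
    have "smooth_on (cmap d ` (cdom d \<inter> W)) (\<lambda>x. (f \<circ> cinv c) ((cmap c \<circ> cinv d) x))"
    proof (rule smooth_on_compose[OF f])
      show "smooth_on (cmap d ` (cdom d \<inter> W)) (cmap c \<circ> cinv d)"
        by (rule smooth_on_subset[OF smooth_on_transition[OF d c]]) (use W in auto)
      show "(cmap c \<circ> cinv d) ` cmap d ` (cdom d \<inter> W) \<subseteq> cmap c ` W"
        using cinv_cmap[OF d] by auto
    qed
    then show "smooth_on (cmap d ` (cdom d \<inter> W)) (f \<circ> cinv d)"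
      by (rule smooth_on_cong[OF open_cmap_image_Int[OF d W(1)], rotated])
        (use W cinv_cmap[OF d] cinv_cmap[OF c] in \<open>auto simp: subset_iff\<close>)
  qed
qed (use W in auto)

lemma smooth_nearD:
  assumes "smooth_near A p f" and c: "c \<in> A" "p \<in> cdom c"
  obtains W where "open W" "p \<in> W" "W \<subseteq> cdom c" "smooth_on (cmap c ` W) (f \<circ> cinv c)"
proof -
  obtain W where W: "open W" "p \<in> W" "smooth_fun_on A W f"
    using assms(1) by (auto simp: smooth_near_def)
  show ?thesis
    by (rule that[OF open_Int[OF open_cdom[OF c(1)] W(1)]])
      (use W c in \<open>auto simp: smooth_fun_on_def\<close>)
qed

lemma smooth_near_has_derivative:
  assumes "smooth_near A p f" "c \<in> A" "p \<in> cdom c"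
  shows "((f \<circ> cinv c) has_derivative fder (f \<circ> cinv c) (cmap c p)) (at (cmap c p))"
proof -
  obtain W where "p \<in> W" "smooth_on (cmap c ` W) (f \<circ> cinv c)"
    using smooth_nearD[OF assms] by metis
  then show ?thesis by (intro smooth_on_has_derivative) auto
qed

lemma coord_vec_sum_scaleR:
  assumes "c \<in> A" "p \<in> cdom c"
  shows "coord_vec A c p (\<Sum>i\<in>J. a i *\<^sub>R u i) = (\<lambda>f. \<Sum>i\<in>J. a i * coord_vec A c p (u i) f)"
proof
  fix f
  show "coord_vec A c p (\<Sum>i\<in>J. a i *\<^sub>R u i) f = (\<Sum>i\<in>J. a i * coord_vec A c p (u i) f)"
  proof (cases "smooth_near A p f")
    case True
    have "linear (fder (f \<circ> cinv c) (cmap c p))"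
      by (rule has_derivative_linear[OF smooth_near_has_derivative[OF True assms]])
    then show ?thesis using True by (simp add: coord_vec_def linear_sum linear_cmul)
  qed (simp add: coord_vec_def)
qed

lemma coord_vec_lincomb:
  assumes "c \<in> A" "p \<in> cdom c"
  shows "coord_vec A c p (a *\<^sub>R u + b *\<^sub>R v) = (\<lambda>f. a * coord_vec A c p u f + b * coord_vec A c p v f)"
proof
  fix f
  show "coord_vec A c p (a *\<^sub>R u + b *\<^sub>R v) f = a * coord_vec A c p u f + b * coord_vec A c p v f"
  proof (cases "smooth_near A p f")
    case True
    have "linear (fder (f \<circ> cinv c) (cmap c p))"
      by (rule has_derivative_linear[OF smooth_near_has_derivative[OF True assms]])
    then show ?thesis using True by (simp add: coord_vec_def linear_add linear_cmul)
  qed (simp add: coord_vec_def)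
qed

lemma smooth_near_coordinate:
  assumes c: "c \<in> A" "p \<in> cdom c" and L: "bounded_linear L"
  shows "smooth_near A p (\<lambda>q. L (cmap c q))"
proof (rule smooth_nearI[OF c(1) open_cdom[OF c(1)] c(2) order_refl])
  show "smooth_on (cmap c ` cdom c) ((\<lambda>q. L (cmap c q)) \<circ> cinv c)"
    by (rule smooth_on_cong[OF open_cmap_image[OF c(1)] _ smooth_on_bounded_linear[OF L]])
      (simp add: cmap_cinv[OF c(1)])
qed

text \<open>Any linear functional \<open>L\<close> of the coordinates is allowed, so that both the
  inner products in \<open>components\<close> and the time coordinate \<open>fst\<close> of a
  product chart are covered.\<close>

lemma coord_vec_coordinate:
  assumes c: "c \<in> A" "p \<in> cdom c" and L: "bounded_linear L"
  shows "coord_vec A c p u (\<lambda>q. L (cmap c q)) = L u"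
proof -
  have "fder ((\<lambda>q. L (cmap c q)) \<circ> cinv c) (cmap c p) = fder L (cmap c p)"
    by (rule fder_cong[OF open_cmap_image[OF c(1)]]) (use c in \<open>auto simp: cmap_cinv[OF c(1)] cinv_cmap\<close>)
  then show ?thesis
    using smooth_near_coordinate[OF assms] by (simp add: coord_vec_def fder_bounded_linear[OF L])
qed

lemma components_coord_vec:
  assumes "c \<in> A" "p \<in> cdom c"
  shows "components c (coord_vec A c p u) = u"
  unfolding components_def
  using coord_vec_coordinate[OF assms bounded_linear_inner_left]
  by (simp add: euclidean_representation)

lemma coord_vec_change:
  assumes c: "c \<in> A" "p \<in> cdom c" and d: "d \<in> A" "p \<in> cdom d"
  shows "coord_vec A c p u = coord_vec A d p (fder (cmap d \<circ> cinv c) (cmap c p) u)"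
proof
  fix f
  show "coord_vec A c p u f = coord_vec A d p (fder (cmap d \<circ> cinv c) (cmap c p) u) f"
  proof (cases "smooth_near A p f")
    case True
    have pI: "cmap c p \<in> cmap c ` (cdom c \<inter> cdom d)" using c d by auto
    have "((cmap d \<circ> cinv c) has_derivative fder (cmap d \<circ> cinv c) (cmap c p)) (at (cmap c p))"
      by (rule smooth_on_has_derivative[OF smooth_on_transition[OF c(1) d(1)] pI])
    moreover have "((f \<circ> cinv d) has_derivative fder (f \<circ> cinv d) (cmap d p)) (at ((cmap d \<circ> cinv c) (cmap c p)))"
      using smooth_near_has_derivative[OF True d] by (simp add: cinv_cmap[OF c])
    ultimately have "((\<lambda>x. (f \<circ> cinv d) ((cmap d \<circ> cinv c) x)) has_derivative
        (\<lambda>v. fder (f \<circ> cinv d) (cmap d p) (fder (cmap d \<circ> cinv c) (cmap c p) v))) (at (cmap c p))"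
      by (rule has_derivative_compose)
    then have "((f \<circ> cinv c) has_derivative
        (\<lambda>v. fder (f \<circ> cinv d) (cmap d p) (fder (cmap d \<circ> cinv c) (cmap c p) v))) (at (cmap c p))"
      by (rule has_derivative_transform_within_open[OF _ open_cmap_image_Int[OF c(1) open_cdom[OF d(1)]] pI])
        (auto simp: cinv_cmap[OF c(1)] cinv_cmap[OF d(1)])
    then show ?thesis using True by (simp add: coord_vec_def fder_eqI)
  qed (simp add: coord_vec_def)
qed

lemma tangent_space_eq:
  assumes "c \<in> A" "p \<in> cdom c"
  shows "tangent_space A p = range (coord_vec A c p)"
  unfolding tangent_space_def using assms coord_vec_change[OF _ _ assms] by blast

lemma coord_vec_in_tangent_space:
  "c \<in> A \<Longrightarrow> p \<in> cdom c \<Longrightarrow> coord_vec A c p u \<in> tangent_space A p"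
  unfolding tangent_space_def by blast

lemma metric_form_metric_coord:
  assumes g: "riemannian_metric A g" and c: "c \<in> A"
  shows "metric_form (cmap c ` cdom c) (metric_coord A g c)"
proof
  fix x v w :: 'e
  show "open (cmap c ` cdom c)" by (rule open_cmap_image[OF c])
  show "smooth_on (cmap c ` cdom c) (\<lambda>x. metric_coord A g c x v w)"
    using g c by (simp add: riemannian_metric_def)
  assume x: "x \<in> cmap c ` cdom c"
  define p where "p = cinv c x"
  have p: "p \<in> cdom c" using x by (simp add: p_def cinv_in_cdom)
  have pA: "p \<in> carrier A" using p cdom_subset_carrier[OF c] by blast
  note T = coord_vec_in_tangent_space[OF c p]
  have sym: "g p (coord_vec A c p u) (coord_vec A c p u') = g p (coord_vec A c p u') (coord_vec A c p u)"
    for u u'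
    using g pA T unfolding riemannian_metric_def by blast
  have lin: "g p (coord_vec A c p (a *\<^sub>R u + b *\<^sub>R u')) (coord_vec A c p z) =
      a * g p (coord_vec A c p u) (coord_vec A c p z) + b * g p (coord_vec A c p u') (coord_vec A c p z)"
    for a b u u' z
    using g pA T unfolding riemannian_metric_def coord_vec_lincomb[OF c p] by blast
  have lin1: "linear (\<lambda>u. g p (coord_vec A c p u) (coord_vec A c p z))" for z
    using lin[of 1 _ 1 _ z] lin[of _ _ 0 0 z] by (auto intro!: linearI)
  then have "linear (\<lambda>u. g p (coord_vec A c p z) (coord_vec A c p u))" for z
    by (simp add: sym[of z])
  with lin1 show "bilinear (metric_coord A g c x)"
    by (simp add: bilinear_def metric_coord_def p_def)
  show "metric_coord A g c x v w = metric_coord A g c x w v"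
    using sym[of v w] by (simp add: metric_coord_def p_def)
  \<comment> \<open>Positivity of the metric is stated for nonzero derivations;
    \<open>components\<close> detects that a nonzero coordinate vector gives one.\<close>
  assume "v \<noteq> 0"
  moreover have "components c (\<lambda>f. 0) = 0" by (simp add: components_def)
  ultimately have "coord_vec A c p v \<noteq> (\<lambda>f. 0)"
    using components_coord_vec[OF c p, of v] by metis
  then have "g p (coord_vec A c p v) (coord_vec A c p v) > 0"
    using g pA T unfolding riemannian_metric_def by blast
  then show "metric_coord A g c x v v > 0"
    by (simp add: metric_coord_def p_def)
qed

end

section \<open>Smooth maps and their differentials in charts\<close>

locale smooth_mfd_map = S: smooth_mfd A + T: smooth_mfd B
  for A :: "('a::{t2_space, second_countable_topology}, 'e::euclidean_space) atlas"
    and B :: "('b::{t2_space, second_countable_topology}, 'f::euclidean_space) atlas" +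
  fixes \<psi> :: "'a \<Rightarrow> 'b"
  assumes smooth_map: "smooth_map A B \<psi>"
begin

lemma map_in_carrier: "p \<in> carrier A \<Longrightarrow> \<psi> p \<in> carrier B"
  and continuous_on_map: "continuous_on (carrier A) \<psi>"
  and smooth_on_rep: "c \<in> A \<Longrightarrow> d \<in> B \<Longrightarrow>
    smooth_on (cmap c ` (cdom c \<inter> \<psi> -` cdom d)) (cmap d \<circ> \<psi> \<circ> cinv c)"
  using smooth_map unfolding smooth_map_def by auto

lemma open_Int_vimage:
  assumes "c \<in> A" "open W"
  shows "open (cdom c \<inter> \<psi> -` W)"
  by (rule continuous_open_preimage[OF continuous_on_subset[OF continuous_on_map
          S.cdom_subset_carrier[OF assms(1)]] S.open_cdom[OF assms(1)] assms(2)])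

lemma open_rep_dom: "c \<in> A \<Longrightarrow> d \<in> B \<Longrightarrow> open (cmap c ` (cdom c \<inter> \<psi> -` cdom d))"
  by (rule S.open_cmap_image_subset[OF _ open_Int_vimage[OF _ T.open_cdom]]) auto

text \<open>Tangent vectors send functions that are not smooth near their base point to 0. This
  lemma keeps that default value out of the differential on every function smooth near the image
  point.\<close>

lemma smooth_near_compose:
  assumes p: "p \<in> carrier A" and f: "smooth_near B (\<psi> p) f"
  shows "smooth_near A p (f \<circ> \<psi>)"
proof -
  obtain c where c: "c \<in> A" "p \<in> cdom c" using p by (auto simp: carrier_def)
  obtain d where d: "d \<in> B" "\<psi> p \<in> cdom d" using map_in_carrier[OF p] by (auto simp: carrier_def)
  obtain W where W: "open W" "\<psi> p \<in> W" "W \<subseteq> cdom d" "smooth_on (cmap d ` W) (f \<circ> cinv d)"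
    using T.smooth_nearD[OF f d] by metis
  define V where "V = cdom c \<inter> \<psi> -` W"
  have V: "open V" "p \<in> V" "V \<subseteq> cdom c"
    using open_Int_vimage[OF c(1) W(1)] c W by (auto simp: V_def)
  have "smooth_on (cmap c ` V) (\<lambda>x. (f \<circ> cinv d) ((cmap d \<circ> \<psi> \<circ> cinv c) x))"
  proof (rule smooth_on_compose[OF W(4)])
    show "smooth_on (cmap c ` V) (cmap d \<circ> \<psi> \<circ> cinv c)"
      by (rule smooth_on_subset[OF smooth_on_rep[OF c(1) d(1)]]) (use W in \<open>auto simp: V_def\<close>)
    show "(cmap d \<circ> \<psi> \<circ> cinv c) ` cmap c ` V \<subseteq> cmap d ` W"
      using S.cinv_cmap[OF c(1)] by (auto simp: V_def)
  qed
  then have "smooth_on (cmap c ` V) (f \<circ> \<psi> \<circ> cinv c)"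
    by (rule smooth_on_cong[OF S.open_cmap_image_subset[OF c(1) V(1,3)], rotated])
      (use W S.cinv_cmap[OF c(1)] T.cinv_cmap[OF d(1)] in \<open>auto simp: V_def subset_iff\<close>)
  then show ?thesis by (rule S.smooth_nearI[OF c(1) V])
qed

lemma differential_coord_vec:
  assumes c: "c \<in> A" "p \<in> cdom c" and d: "d \<in> B" "\<psi> p \<in> cdom d"
  shows "differential B \<psi> p (coord_vec A c p u) =
    coord_vec B d (\<psi> p) (fder (cmap d \<circ> \<psi> \<circ> cinv c) (cmap c p) u)"
proof
  fix f
  have pA: "p \<in> carrier A" using c by (auto simp: carrier_def)
  show "differential B \<psi> p (coord_vec A c p u) f =
    coord_vec B d (\<psi> p) (fder (cmap d \<circ> \<psi> \<circ> cinv c) (cmap c p) u) f"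
  proof (cases "smooth_near B (\<psi> p) f")
    case True
    have pI: "cmap c p \<in> cmap c ` (cdom c \<inter> \<psi> -` cdom d)" using c d by auto
    have "((cmap d \<circ> \<psi> \<circ> cinv c) has_derivative fder (cmap d \<circ> \<psi> \<circ> cinv c) (cmap c p)) (at (cmap c p))"
      by (rule smooth_on_has_derivative[OF smooth_on_rep[OF c(1) d(1)] pI])
    moreover have "((f \<circ> cinv d) has_derivative fder (f \<circ> cinv d) (cmap d (\<psi> p)))
        (at ((cmap d \<circ> \<psi> \<circ> cinv c) (cmap c p)))"
      using T.smooth_near_has_derivative[OF True d] by (simp add: S.cinv_cmap[OF c])
    ultimately have "((\<lambda>x. (f \<circ> cinv d) ((cmap d \<circ> \<psi> \<circ> cinv c) x)) has_derivative
        (\<lambda>v. fder (f \<circ> cinv d) (cmap d (\<psi> p)) (fder (cmap d \<circ> \<psi> \<circ> cinv c) (cmap c p) v))) (at (cmap c p))"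
      by (rule has_derivative_compose)
    then have "((f \<circ> \<psi> \<circ> cinv c) has_derivative
        (\<lambda>v. fder (f \<circ> cinv d) (cmap d (\<psi> p)) (fder (cmap d \<circ> \<psi> \<circ> cinv c) (cmap c p) v))) (at (cmap c p))"
      by (rule has_derivative_transform_within_open[OF _ open_rep_dom[OF c(1) d(1)] pI])
        (auto simp: S.cinv_cmap[OF c(1)] T.cinv_cmap[OF d(1)])
    then show ?thesis using True smooth_near_compose[OF pA True]
      by (simp add: differential_def coord_vec_def fder_eqI)
  qed (simp add: differential_def coord_vec_def)
qed

end

section \<open>Doubly warped products\<close>

definition product_chart :: "real set \<Rightarrow> ('p, 'e) chart \<Rightarrow> (real \<times> 'p, real \<times> 'e) chart" where
  "product_chart I c = (I \<times> cdom c, \<lambda>(t, x). (t, cmap c x))"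

lemma product_atlas_eq: "product_atlas I P = product_chart I ` P"
  by (simp add: product_atlas_def product_chart_def)

lemma cdom_product_chart: "cdom (product_chart I c) = I \<times> cdom c"
  and cmap_product_chart: "cmap (product_chart I c) q = (fst q, cmap c (snd q))"
  and cmap_product_chart_image:
    "cmap (product_chart I c) ` (J \<times> W) = J \<times> cmap c ` W"
  by (auto simp: product_chart_def split_beta image_iff)

locale warped_product = P: smooth_mfd P
  for P :: "('p::{t2_space, second_countable_topology}, 'e::euclidean_space) atlas" +
  fixes I :: "real set" and h :: "'p \<Rightarrow> real" and \<rho> :: "real \<Rightarrow> real" and \<sigma> :: "'p metric_field"
  assumes warped: "doubly_warped_data I h \<rho> P \<sigma>"
begin

abbreviation "PA \<equiv> product_atlas I P"
abbreviation "gbar \<equiv> doubly_warped_metric P h \<rho> \<sigma>"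

lemma open_I: "open I"
  and rho_smooth: "smooth_on I \<rho>"
  and rho_pos: "t \<in> I \<Longrightarrow> \<rho> t > 0"
  and h_pos: "x \<in> carrier P \<Longrightarrow> h x > 0"
  and riemannian: "riemannian_metric P \<sigma>"
  and connected_P: "connected (carrier P)"
  using warped unfolding doubly_warped_data_def by blast+

lemma h_smooth: "c \<in> P \<Longrightarrow> smooth_on (cmap c ` cdom c) (h \<circ> cinv c)"
  using warped P.cdom_subset_carrier[of c] unfolding doubly_warped_data_def smooth_fun_on_def
  by (metis Int_absorb2)

lemma carrier_product: "carrier PA = I \<times> carrier P"
  by (auto simp: carrier_def product_atlas_eq cdom_product_chart)

lemma cinv_product_chart:
  assumes "c \<in> P" "t \<in> I" "x \<in> cmap c ` cdom c"
  shows "cinv (product_chart I c) (t, x) = (t, cinv c x)"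
proof -
  have inj: "inj_on (cmap (product_chart I c)) (cdom (product_chart I c))"
  proof (rule inj_onI)
    fix a b assume "a \<in> cdom (product_chart I c)" "b \<in> cdom (product_chart I c)"
      and eq: "cmap (product_chart I c) a = cmap (product_chart I c) b"
    then have "snd a \<in> cdom c" "snd b \<in> cdom c" by (auto simp: cdom_product_chart)
    then have "snd a = snd b"
      using eq P.cinv_cmap[OF assms(1)] by (metis cmap_product_chart prod.inject)
    then show "a = b" using eq by (simp add: cmap_product_chart prod_eq_iff)
  qed
  show ?thesis
    by (rule inv_into_f_eq[OF inj])
      (use assms P.cinv_in_cdom[OF assms(3)] P.cmap_cinv[OF assms(1,3)] in
        \<open>auto simp: cdom_product_chart cmap_product_chart\<close>)
qed

lemma smooth_mfd_product: "smooth_mfd PA"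
  unfolding smooth_mfd_def smooth_manifold_def
proof (intro conjI ballI)
  fix d assume "d \<in> PA"
  then obtain c where c: "c \<in> P" "d = product_chart I c" by (auto simp: product_atlas_eq)
  have img: "cmap d ` cdom d = I \<times> cmap c ` cdom c"
    by (simp add: c cdom_product_chart cmap_product_chart_image)
  show "open (cdom d)" using open_I P.open_cdom[OF c(1)] by (simp add: c cdom_product_chart open_Times)
  show "open (cmap d ` cdom d)"
    using open_I P.open_cmap_image[OF c(1)] by (simp add: img open_Times)
  have inv: "cinv d q = (fst q, cinv c (snd q))" if "q \<in> cmap d ` cdom d" for q
  proof -
    have "fst q \<in> I" "snd q \<in> cmap c ` cdom c" using that unfolding img by auto
    then show ?thesis
      using cinv_product_chart[OF c(1), of "fst q" "snd q"] c(2) by simp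
  qed
  show "homeomorphism (cdom d) (cmap d ` cdom d) (cmap d) (cinv d)"
  proof (rule homeomorphismI)
    have "continuous_on (I \<times> cdom c) (\<lambda>q. (fst q, cmap c (snd q)))"
      by (intro continuous_intros continuous_on_compose2[OF P.continuous_on_cmap[OF c(1)]]) auto
    then show "continuous_on (cdom d) (cmap d)"
      by (simp add: c cdom_product_chart cmap_product_chart cong: continuous_on_cong)
    have "continuous_on (I \<times> cmap c ` cdom c) (\<lambda>q. (fst q, cinv c (snd q)))"
      by (intro continuous_intros continuous_on_compose2[OF P.continuous_on_cinv[OF c(1)]]) auto
    then show "continuous_on (cmap d ` cdom d) (cinv d)"
      using inv by (simp add: img cong: continuous_on_cong)
    show "cinv d ` (cmap d ` cdom d) \<subseteq> cdom d" by (auto intro!: inv_into_into)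
    show "cinv d (cmap d p) = p" if "p \<in> cdom d" for p
      using inv[of "cmap d p"] that P.cinv_cmap[OF c(1)]
      by (auto simp: c cmap_product_chart cdom_product_chart)
    show "cmap d (cinv d q) = q" if "q \<in> cmap d ` cdom d" for q
      using that by (rule f_inv_into_f)
  qed auto
  fix d' assume "d' \<in> PA"
  then obtain c' where c': "c' \<in> P" "d' = product_chart I c'" by (auto simp: product_atlas_eq)
  have dom: "cmap d ` (cdom d \<inter> cdom d') = I \<times> cmap c ` (cdom c \<inter> cdom c')"
    unfolding c c' cdom_product_chart by (simp add: Times_Int_Times cmap_product_chart_image)
  have "smooth_on (I \<times> cmap c ` (cdom c \<inter> cdom c')) (\<lambda>q. (fst q, (cmap c' \<circ> cinv c) (snd q)))"
    by (intro smooth_on_Pair smooth_on_bounded_linear bounded_linear_fst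
        smooth_on_compose[OF P.smooth_on_transition[OF c(1) c'(1)]] bounded_linear_snd) auto
  then show "smooth_on (cmap d ` (cdom d \<inter> cdom d')) (cmap d' \<circ> cinv d)"
    unfolding dom
    by (rule smooth_on_cong[rotated -1])
      (use open_I P.open_cmap_image_Int[OF c(1) P.open_cdom[OF c'(1)]] in
        \<open>auto simp: open_Times c c' cmap_product_chart cinv_product_chart\<close>)
qed

sublocale Q: smooth_mfd PA by (rule smooth_mfd_product)

lemma product_chart_in: "c \<in> P \<Longrightarrow> product_chart I c \<in> PA"
  by (simp add: product_atlas_eq)

lemma smooth_mfd_map_snd: "smooth_mfd_map PA P snd"
  unfolding smooth_mfd_map_def smooth_mfd_map_axioms_def smooth_map_def
proof (intro conjI ballI)
  fix d c' assume "d \<in> PA" and c': "c' \<in> P"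
  then obtain c where c: "c \<in> P" "d = product_chart I c" by (auto simp: product_atlas_eq)
  have dom: "cmap d ` (cdom d \<inter> snd -` cdom c') = I \<times> cmap c ` (cdom c \<inter> cdom c')"
  proof -
    have "cdom d \<inter> snd -` cdom c' = I \<times> (cdom c \<inter> cdom c')" by (auto simp: c cdom_product_chart)
    then show ?thesis by (simp add: c cmap_product_chart_image)
  qed
  have "smooth_on (I \<times> cmap c ` (cdom c \<inter> cdom c')) (\<lambda>q. (cmap c' \<circ> cinv c) (snd q))"
    by (intro smooth_on_bounded_linear
        smooth_on_compose[OF P.smooth_on_transition[OF c(1) c']] bounded_linear_snd) auto
  then show "smooth_on (cmap d ` (cdom d \<inter> snd -` cdom c')) (cmap c' \<circ> snd \<circ> cinv d)"
    unfolding dom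
    by (rule smooth_on_cong[rotated -1])
      (use open_I P.open_cmap_image_Int[OF c(1) P.open_cdom[OF c']] in
        \<open>auto simp: open_Times c cinv_product_chart\<close>)
qed (auto simp: carrier_product intro: P.smooth_mfd_axioms Q.smooth_mfd_axioms continuous_intros)

sublocale sndmap: smooth_mfd_map PA P snd by (rule smooth_mfd_map_snd)

lemma coord_vec_fst:
  assumes "c \<in> P" "q \<in> I \<times> cdom c"
  shows "coord_vec PA (product_chart I c) q a fst = fst a"
  using Q.coord_vec_coordinate[OF product_chart_in[OF assms(1)] _ bounded_linear_fst, of q a] assms
  by (simp add: cdom_product_chart cmap_product_chart)

lemma differential_snd_coord_vec:
  assumes c: "c \<in> P" and q: "q \<in> I \<times> cdom c"
  shows "differential P snd q (coord_vec PA (product_chart I c) q a) = coord_vec P c (snd q) (snd a)"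
proof -
  have q': "q \<in> cdom (product_chart I c)" "snd q \<in> cdom c" using q by (auto simp: cdom_product_chart)
  have "fder (cmap c \<circ> snd \<circ> cinv (product_chart I c)) (cmap (product_chart I c) q)
      = fder snd (cmap (product_chart I c) q)"
  proof (rule fder_cong)
    show "open (I \<times> cmap c ` cdom c)" using open_I P.open_cmap_image[OF c] by (simp add: open_Times)
    show "cmap (product_chart I c) q \<in> I \<times> cmap c ` cdom c" using q by (auto simp: cmap_product_chart)
  qed (auto simp: cinv_product_chart[OF c] P.cmap_cinv[OF c] P.cinv_cmap[OF c])
  then show ?thesis
    using sndmap.differential_coord_vec[OF product_chart_in[OF c] q'(1) c q'(2), of a]
    by (simp add: fder_bounded_linear bounded_linear_snd)
qed

text \<open>The passage from derivations to coordinate vectors: the factor \<open>v fst\<close>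
  becomes a component because \<open>fst\<close> is itself a coordinate of a product chart.\<close>

lemma gbar_coord_vec:
  assumes "c \<in> P" "q \<in> I \<times> cdom c"
  shows "gbar q (coord_vec PA (product_chart I c) q a) (coord_vec PA (product_chart I c) q b) =
    warped_form (h \<circ> cinv c) \<rho> (metric_coord P \<sigma> c) (cmap (product_chart I c) q) a b"
proof -
  have "cinv c (cmap c (snd q)) = snd q" using assms P.cinv_cmap by auto
  then show ?thesis
    unfolding doubly_warped_metric_def warped_form_def pullback_metric_def metric_coord_def
    using assms by (simp add: coord_vec_fst differential_snd_coord_vec cmap_product_chart)
qed

lemma metric_coord_gbar:
  assumes c: "c \<in> P" and q: "q \<in> I \<times> cmap c ` cdom c"
  shows "metric_coord PA gbar (product_chart I c) q a b =
    warped_form (h \<circ> cinv c) \<rho> (metric_coord P \<sigma> c) q a b"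
proof -
  obtain t x where tx: "q = (t, cmap c x)" "t \<in> I" "x \<in> cdom c" using q by auto
  then have "cinv (product_chart I c) q = (t, x)" using cinv_product_chart[OF c] P.cinv_cmap[OF c] by auto
  then show ?thesis
    using gbar_coord_vec[OF c, of "(t, x)"] tx by (simp add: metric_coord_def cmap_product_chart)
qed

text \<open>The time orientation of the normal is stated with the derivation
  \<open>time_field\<close>; as a coordinate vector it can be paired by means of
  \<open>warped_form\<close>.\<close>

lemma time_field_eq:
  assumes c: "c \<in> P" and q: "q \<in> I \<times> cdom c"
  shows "time_field I P q = coord_vec PA (product_chart I c) q (1, 0)"
proof
  fix f
  show "time_field I P q f = coord_vec PA (product_chart I c) q (1, 0) f"
  proof (cases "smooth_near PA q f")
    case True
    have q': "q \<in> cdom (product_chart I c)" using q by (auto simp: cdom_product_chart)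
    let ?y = "cmap c (snd q)"
    have "((\<lambda>s. (s, ?y)) has_derivative (\<lambda>s. (s, 0))) (at (fst q))"
      by (auto intro!: derivative_eq_intros)
    moreover have "((f \<circ> cinv (product_chart I c)) has_derivative
        fder (f \<circ> cinv (product_chart I c)) (cmap (product_chart I c) q)) (at (fst q, ?y))"
      using Q.smooth_near_has_derivative[OF True product_chart_in[OF c] q']
      by (simp add: cmap_product_chart)
    ultimately have d: "((\<lambda>s. (f \<circ> cinv (product_chart I c)) (s, ?y)) has_derivative
        (\<lambda>s. fder (f \<circ> cinv (product_chart I c)) (cmap (product_chart I c) q) (s, 0))) (at (fst q))"
      by (rule has_derivative_compose)
    have d: "((\<lambda>s. f (s, snd q)) has_derivative
        (\<lambda>s. fder (f \<circ> cinv (product_chart I c)) (cmap (product_chart I c) q) (s, 0))) (at (fst q))"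
      by (rule has_derivative_transform_within_open[OF d open_I])
        (use q in \<open>auto simp: cinv_product_chart[OF c] P.cinv_cmap[OF c]\<close>)
    have lin: "linear (fder (f \<circ> cinv (product_chart I c)) (cmap (product_chart I c) q))"
      by (rule has_derivative_linear[OF Q.smooth_near_has_derivative[OF True product_chart_in[OF c] q']])
    have "fder (f \<circ> cinv (product_chart I c)) (cmap (product_chart I c) q) (s, 0) =
        fder (f \<circ> cinv (product_chart I c)) (cmap (product_chart I c) q) (1, 0) * s" for s
      using linear_cmul[OF lin, of s "(1, 0)"] by (simp add: mult.commute)
    then have "(\<lambda>s. fder (f \<circ> cinv (product_chart I c)) (cmap (product_chart I c) q) (s, 0)) =
        (*) (fder (f \<circ> cinv (product_chart I c)) (cmap (product_chart I c) q) (1, 0))"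
      by (rule ext)
    with d have "((\<lambda>s. f (s, snd q)) has_real_derivative
        fder (f \<circ> cinv (product_chart I c)) (cmap (product_chart I c) q) (1, 0)) (at (fst q))"
      unfolding has_field_derivative_def by simp
    then show ?thesis using True by (simp add: time_field_def coord_vec_def DERIV_imp_deriv)
  qed (simp add: time_field_def coord_vec_def)
qed

end

section \<open>Orthonormal frames\<close>

context metric_form
begin

text \<open>No cardinality is imposed, in contrast to \<open>orthonormal_basis\<close>, because the
  existence proof maximises the cardinality over all orthonormal sets.\<close>

definition orthonormal :: "'e \<Rightarrow> 'e set \<Rightarrow> bool" where
  "orthonormal x B \<longleftrightarrow> finite B \<and> (\<forall>u\<in>B. \<forall>v\<in>B. G x u v = (if u = v then 1 else 0))"

lemma orthonormal_G_sum:
  assumes "x \<in> U" "orthonormal x B" "b \<in> B"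
  shows "G x (\<Sum>u\<in>B. c u *\<^sub>R u) b = c b"
proof -
  have "G x (\<Sum>u\<in>B. c u *\<^sub>R u) b = (\<Sum>u\<in>B. c u * G x u b)"
    by (simp add: linear_sum[OF linear_G(2)[OF assms(1)]] linear_cmul[OF linear_G(2)[OF assms(1)]])
  also have "\<dots> = (\<Sum>u\<in>B. if u = b then c u else 0)"
    by (rule sum.cong) (use assms in \<open>auto simp: orthonormal_def\<close>)
  finally show ?thesis using assms by (simp add: orthonormal_def)
qed

lemma orthonormal_independent:
  assumes "x \<in> U" "orthonormal x B"
  shows "independent B"
  unfolding independent_explicit
proof (intro conjI allI impI ballI)
  show "finite B" using assms by (simp add: orthonormal_def)
  fix c v assume "(\<Sum>u\<in>B. c u *\<^sub>R u) = 0" "v \<in> B"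
  then show "c v = 0"
    using orthonormal_G_sum[OF assms, of v c] linear_0[OF linear_G(2)[OF assms(1)]] by simp
qed

lemma orthonormal_residual:
  assumes "x \<in> U" "orthonormal x B" "b \<in> B"
  shows "G x (v - (\<Sum>u\<in>B. G x v u *\<^sub>R u)) b = 0"
  using orthonormal_G_sum[OF assms, of "G x v"] by (simp add: linear_diff[OF linear_G(2)[OF assms(1)]])

lemma orthonormal_expansion:
  assumes "x \<in> U" "orthonormal x B" "card B = DIM('e)"
  shows "v = (\<Sum>u\<in>B. G x v u *\<^sub>R u)"
proof -
  define w where "w = v - (\<Sum>u\<in>B. G x v u *\<^sub>R u)"
  have "UNIV \<subseteq> span B"
    by (rule card_ge_dim_independent[OF _ orthonormal_independent[OF assms(1,2)]]) (auto simp: assms(3))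
  then have "w \<in> span B" by auto
  moreover have "finite B" using assms(2) by (simp add: orthonormal_def)
  ultimately obtain c where c: "w = (\<Sum>u\<in>B. c u *\<^sub>R u)" by (auto simp: span_finite)
  have "G x w w = (\<Sum>u\<in>B. c u * G x w u)"
    by (subst (2) c) (simp add: linear_sum[OF linear_G(1)[OF assms(1)]] linear_cmul[OF linear_G(1)[OF assms(1)]])
  also have "\<dots> = 0"
    unfolding w_def using orthonormal_residual[OF assms(1,2)] by simp
  finally have "w = 0" using pos_G[OF assms(1), of w] by force
  then show ?thesis by (simp add: w_def)
qed

text \<open>Independence bounds the cardinality, so a largest orthonormal set exists. If it did not
  span, the normalised Gram-Schmidt residual of a vector outside its span would enlarge it.\<close>

lemma ex_orthonormal:
  assumes x: "x \<in> U"
  shows "\<exists>B. orthonormal x B \<and> card B = DIM('e)"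
proof -
  have le: "card B \<le> DIM('e)" if "orthonormal x B" for B
    using independent_bound[OF orthonormal_independent[OF x that]] by simp
  have "orthonormal x {}" by (simp add: orthonormal_def)
  then have "\<exists>B. orthonormal x B \<and> (\<forall>B'. orthonormal x B' \<longrightarrow> card B' \<le> card B)"
    by (rule ex_has_greatest_nat[of "orthonormal x" _ card "Suc DIM('e)"]) (auto simp: less_Suc_eq_le le)
  then obtain B where B: "orthonormal x B" "\<And>B'. orthonormal x B' \<Longrightarrow> card B' \<le> card B" by blast
  have fin: "finite B" using B(1) by (simp add: orthonormal_def)
  have "card B = DIM('e)"
  proof (rule ccontr)
    assume "card B \<noteq> DIM('e)"
    then have "card B < DIM('e)" using le[OF B(1)] by simp
    then have "span B \<noteq> UNIV"
      using dim_le_card'[OF fin] by (metis dim_UNIV dim_span linorder_not_le)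
    then obtain v where v: "v \<notin> span B" by auto
    define w where "w = v - (\<Sum>u\<in>B. G x v u *\<^sub>R u)"
    have "(\<Sum>u\<in>B. G x v u *\<^sub>R u) \<in> span B" by (intro span_sum span_scale span_base)
    then have w0: "w \<noteq> 0" using v by (auto simp: w_def)
    define e where "e = (1 / sqrt (G x w w)) *\<^sub>R w"
    have ortho: "G x w b = 0" if "b \<in> B" for b
      unfolding w_def by (rule orthonormal_residual[OF x B(1) that])
    have pos: "G x w w > 0" by (rule pos_G[OF x w0])
    have ee: "G x e e = 1"
      using pos unfolding e_def
      by (simp add: bilinear_lmul[OF bilinear_G[OF x]] bilinear_rmul[OF bilinear_G[OF x]] flip: power2_eq_square)
    have eb: "G x e b = 0" "G x b e = 0" if "b \<in> B" for b
      using ortho[OF that] sym_G[OF x, of b w] unfolding e_def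
      by (simp_all add: bilinear_lmul[OF bilinear_G[OF x]] bilinear_rmul[OF bilinear_G[OF x]])
    have "e \<notin> B" using eb(1)[of e] ee by auto
    have "orthonormal x (insert e B)"
      using B(1) ee eb \<open>e \<notin> B\<close> by (auto simp: orthonormal_def)
    from B(2)[OF this] \<open>e \<notin> B\<close> fin show False by simp
  qed
  with B(1) show ?thesis by blast
qed

text \<open>Pair the expansion of \<xi> in the frame with \<xi> in the Euclidean inner product and
  apply the Cauchy-Schwarz inequality. By Parseval the squared coefficients sum to
  \<open>G x \<xi> \<xi>\<close>, which \<open>L\<close> bounds. Thus an upper bound on the metric
  becomes ellipticity of the frame.\<close>

lemma orthonormal_elliptic:
  assumes x: "x \<in> U" "orthonormal x B" "card B = DIM('e)"
    and L: "L > 0" "\<And>v. G x v v \<le> L * (norm v)\<^sup>2"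
  shows "(1 / L) * (norm \<xi>)\<^sup>2 \<le> (\<Sum>u\<in>B. (\<xi> \<bullet> u)\<^sup>2)"
proof (cases "\<xi> = 0")
  case False
  have "(norm \<xi>)\<^sup>2 = \<xi> \<bullet> (\<Sum>u\<in>B. G x \<xi> u *\<^sub>R u)"
    using orthonormal_expansion[OF x, of \<xi>] by (simp add: power2_norm_eq_inner)
  also have "\<dots> = (\<Sum>u\<in>B. G x \<xi> u * (\<xi> \<bullet> u))" by (simp add: inner_sum_right)
  finally have "((norm \<xi>)\<^sup>2)\<^sup>2 \<le> (\<Sum>u\<in>B. (G x \<xi> u)\<^sup>2) * (\<Sum>u\<in>B. (\<xi> \<bullet> u)\<^sup>2)"
    using Cauchy_Schwarz_ineq_sum[of "G x \<xi>" "\<lambda>u. \<xi> \<bullet> u" B] by simp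
  also have "(\<Sum>u\<in>B. (G x \<xi> u)\<^sup>2) = G x \<xi> (\<Sum>u\<in>B. G x \<xi> u *\<^sub>R u)"
    by (simp add: linear_sum[OF linear_G(1)[OF x(1)]] linear_cmul[OF linear_G(1)[OF x(1)]] power2_eq_square)
  also have "\<dots> = G x \<xi> \<xi>" using orthonormal_expansion[OF x, of \<xi>] by simp
  also have "G x \<xi> \<xi> * (\<Sum>u\<in>B. (\<xi> \<bullet> u)\<^sup>2) \<le> L * (norm \<xi>)\<^sup>2 * (\<Sum>u\<in>B. (\<xi> \<bullet> u)\<^sup>2)"
    by (intro mult_right_mono L(2) sum_nonneg) auto
  finally have "(norm \<xi>)\<^sup>2 * (norm \<xi>)\<^sup>2 \<le> (norm \<xi>)\<^sup>2 * (L * (\<Sum>u\<in>B. (\<xi> \<bullet> u)\<^sup>2))"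
    by (simp add: power2_eq_square mult.assoc mult.left_commute)
  then have "(norm \<xi>)\<^sup>2 \<le> L * (\<Sum>u\<in>B. (\<xi> \<bullet> u)\<^sup>2)"
    by (rule mult_left_le_imp_le) (use False in simp)
  then show ?thesis using L by (simp add: field_simps)
qed (simp add: sum_nonneg)

end

text \<open>Used for the height and the lapse, whose smoothness is visible only on pieces of a chart
  domain, one for each chart of the Riemannian factor.\<close>

lemma smooth_on_locally:
  assumes "\<And>x. x \<in> S \<Longrightarrow> \<exists>V. open V \<and> x \<in> V \<and> smooth_on V f"
  shows "smooth_on S f"
  unfolding smooth_on_def
proof
  fix k
  show "Ck_on k S f"
    using assms
  proof (induction k arbitrary: f)
    case 0
    have "isCont f x" if x: "x \<in> S" for x
    proof -
      obtain V where "open V" "x \<in> V" "smooth_on V f" using 0 x by blast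
      then show ?thesis
        using smooth_on_imp_continuous_on continuous_on_eq_continuous_at by blast
    qed
    then show ?case by (simp add: continuous_at_imp_continuous_on)
  next
    case (Suc k)
    have "(f has_derivative fder f x) (at x)" if "x \<in> S" for x
      using Suc.prems[OF that] smooth_on_has_derivative by blast
    moreover have "Ck_on k S (\<lambda>x. fder f x v)" for v
      using Suc.prems smooth_on_fder by (intro Suc.IH) blast
    ultimately show ?case by (auto intro!: exI[of _ "fder f"])
  qed
qed

section \<open>Spacelike hypersurfaces in a doubly warped product\<close>

context warped_product
begin

abbreviation ambient :: "('p, 'e) chart \<Rightarrow> real \<times> 'e \<Rightarrow> real \<times> 'e \<Rightarrow> real \<times> 'e \<Rightarrow> real" where
  "ambient c \<equiv> warped_form (h \<circ> cinv c) \<rho> (metric_coord P \<sigma> c)"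

abbreviation ambient_dom :: "('p, 'e) chart \<Rightarrow> (real \<times> 'e) set" where
  "ambient_dom c \<equiv> I \<times> cmap c ` cdom c"

lemma open_ambient_dom: "c \<in> P \<Longrightarrow> open (ambient_dom c)"
  using open_I P.open_cmap_image by (simp add: open_Times)

lemma metric_form_base: "c \<in> P \<Longrightarrow> metric_form (cmap c ` cdom c) (metric_coord P \<sigma> c)"
  by (rule P.metric_form_metric_coord[OF riemannian])

lemma bilinear_ambient: "c \<in> P \<Longrightarrow> q \<in> ambient_dom c \<Longrightarrow> bilinear (ambient c q)"
  by (rule bilinear_warped_form[OF metric_form.bilinear_G[OF metric_form_base]]) auto

lemma sym_ambient: "c \<in> P \<Longrightarrow> q \<in> ambient_dom c \<Longrightarrow> ambient c q a b = ambient c q b a"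
  using metric_form.sym_G[OF metric_form_base, of c "snd q" "snd a" "snd b"]
  by (simp add: warped_form_def mult.commute mem_Times_iff)

lemma smooth_ambient: "c \<in> P \<Longrightarrow> smooth_on (ambient_dom c) (\<lambda>q. ambient c q a b)"
  by (rule smooth_on_warped_form[OF h_smooth rho_smooth metric_form.smooth_G[OF metric_form_base]])

lemma h_cinv_pos: "c \<in> P \<Longrightarrow> x \<in> cmap c ` cdom c \<Longrightarrow> h (cinv c x) > 0"
  by (rule h_pos[OF subsetD[OF P.cdom_subset_carrier P.cinv_in_cdom]])

lemma ambient_time:
  assumes "c \<in> P" "q \<in> ambient_dom c"
  shows "ambient c q a (1, 0) = - (h (cinv c (snd q)))\<^sup>2 * fst a"
proof -
  have "snd q \<in> cmap c ` cdom c" using assms(2) by auto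
  then show ?thesis
    using bilinear_rzero[OF metric_form.bilinear_G[OF metric_form_base[OF assms(1)]]]
    by (simp add: warped_form_def)
qed

text \<open>\<open>christoffel\<close> is a definite description, so existence and uniqueness must
  be supplied. The ambient form is indefinite but nondegenerate: pairing with \<open>(1, 0)\<close>
  kills the time component, and what remains is positive definite.\<close>

lemma levi_civita_christoffel:
  assumes c: "c \<in> P" and q: "q \<in> ambient_dom c"
  shows "levi_civita_form (ambient c q) (\<lambda>u v w. fder (\<lambda>y. ambient c y v w) q u)
    (christoffel PA gbar (product_chart I c) q)"
proof -
  note o = open_ambient_dom[OF c]
  have eq: "metric_coord PA gbar (product_chart I c) q = ambient c q"
    using metric_coord_gbar[OF c q] by (intro ext)
  have deq: "fder (\<lambda>y. metric_coord PA gbar (product_chart I c) y v w) q = fder (\<lambda>y. ambient c y v w) q" for v w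
    by (rule fder_cong[OF o q]) (rule metric_coord_gbar[OF c])
  have d: "((\<lambda>y. ambient c y v w) has_derivative fder (\<lambda>y. ambient c y v w) q) (at q)" for v w
    by (rule smooth_on_has_derivative[OF smooth_ambient[OF c] q])
  have lin: "linear (\<lambda>v. ambient c y v w)" if "y \<in> ambient_dom c" for y w
    using bilinear_ambient[OF c that] unfolding bilinear_def by blast
  have "\<exists>!\<Gamma>. levi_civita_form (ambient c q) (\<lambda>u v w. fder (\<lambda>y. ambient c y v w) q u) \<Gamma>"
  proof (rule levi_civita_form_ex1)
    show "bilinear (ambient c q)" by (rule bilinear_ambient[OF c q])
    show "ambient c q v w = ambient c q w v" for v w by (rule sym_ambient[OF c q])
    show "linear (\<lambda>u. fder (\<lambda>y. ambient c y v w) q u)" for v w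
      by (rule has_derivative_linear[OF d])
    show "fder (\<lambda>y. ambient c y v w) q u = fder (\<lambda>y. ambient c y w v) q u" for u v w
      by (rule fun_cong[OF fder_cong[OF o q]]) (rule sym_ambient[OF c])
    show "linear (\<lambda>v. fder (\<lambda>y. ambient c y v w) q u)" for u w
    proof (rule linearI)
      fix a b and r :: real
      have "fder (\<lambda>y. ambient c y (a + b) w) q = fder (\<lambda>y. ambient c y a w + ambient c y b w) q"
        by (rule fder_cong[OF o q]) (rule linear_add[OF lin])
      then show "fder (\<lambda>y. ambient c y (a + b) w) q u = fder (\<lambda>y. ambient c y a w) q u + fder (\<lambda>y. ambient c y b w) q u"
        using fder_eqI[OF has_derivative_add[OF d[of a w] d[of b w]]] by simp
      have "fder (\<lambda>y. ambient c y (r *\<^sub>R a) w) q = fder (\<lambda>y. r *\<^sub>R ambient c y a w) q"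
        by (rule fder_cong[OF o q]) (rule linear_cmul[OF lin])
      then show "fder (\<lambda>y. ambient c y (r *\<^sub>R a) w) q u = r *\<^sub>R fder (\<lambda>y. ambient c y a w) q u"
        using fder_eqI[OF has_derivative_scaleR_right[OF d[of a w]]] by simp
    qed
    fix v assume v: "\<And>w. ambient c q v w = 0"
    have sq: "snd q \<in> cmap c ` cdom c" "fst q \<in> I" using q by auto
    have "fst v = 0"
      using v[of "(1, 0)"] h_cinv_pos[OF c sq(1)] unfolding ambient_time[OF c q] by simp
    moreover from this have "metric_coord P \<sigma> c (snd q) (snd v) (snd v) = 0"
      using v[of v] rho_pos[OF sq(2)] by (simp add: warped_form_def)
    then have "snd v = 0"
      using metric_form.pos_G[OF metric_form_base[OF c] sq(1), of "snd v"] by force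
    ultimately show "v = 0" by (simp add: prod_eq_iff)
  qed
  from theI'[OF this] show ?thesis
    unfolding christoffel_def eq deq .
qed

end

section \<open>The immersion in coordinates and the trace formula for its mean curvature\<close>

locale hypersurface = warped_product P I h \<rho> \<sigma>
  for P :: "('p::{t2_space, second_countable_topology}, 'e::euclidean_space) atlas"
    and I :: "real set" and h :: "'p \<Rightarrow> real" and \<rho> :: "real \<Rightarrow> real" and \<sigma> :: "'p metric_field" +
  fixes M :: "('a::{t2_space, second_countable_topology}, 'e) atlas"
    and \<psi> :: "'a \<Rightarrow> real \<times> 'p"
  assumes spacelike: "spacelike_hypersurface M PA gbar \<psi>"
begin

sublocale psi: smooth_mfd_map M PA \<psi>
  using spacelike smooth_mfd_product
  by (auto simp: spacelike_hypersurface_def smooth_mfd_map_def smooth_mfd_map_axioms_def smooth_mfd_def)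

abbreviation "g \<equiv> pullback_metric PA \<psi> gbar"

abbreviation rep :: "('a, 'e) chart \<Rightarrow> ('p, 'e) chart \<Rightarrow> 'e \<Rightarrow> real \<times> 'e" where
  "rep c d \<equiv> cmap (product_chart I d) \<circ> \<psi> \<circ> cinv c"

abbreviation rep_dom :: "('a, 'e) chart \<Rightarrow> ('p, 'e) chart \<Rightarrow> 'e set" where
  "rep_dom c d \<equiv> cmap c ` (cdom c \<inter> \<psi> -` cdom (product_chart I d))"

lemma riemannian_g: "riemannian_metric M g"
  using spacelike by (simp add: spacelike_hypersurface_def)

lemma metric_form_g: "c \<in> M \<Longrightarrow> metric_form (cmap c ` cdom c) (metric_coord M g c)"
  by (rule psi.S.metric_form_metric_coord[OF riemannian_g])

lemma open_rep_dom: "c \<in> M \<Longrightarrow> d \<in> P \<Longrightarrow> open (rep_dom c d)"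
  by (rule psi.open_rep_dom[OF _ product_chart_in])

lemma smooth_rep: "c \<in> M \<Longrightarrow> d \<in> P \<Longrightarrow> smooth_on (rep_dom c d) (rep c d)"
  by (rule psi.smooth_on_rep[OF _ product_chart_in])

lemma rep_in: "c \<in> M \<Longrightarrow> rep c d ` rep_dom c d \<subseteq> ambient_dom d"
  using psi.S.cinv_cmap by (auto simp: cdom_product_chart cmap_product_chart)

lemma cinv_rep_dom:
  assumes "c \<in> M" "x \<in> rep_dom c d"
  shows "cinv c x \<in> cdom c" "\<psi> (cinv c x) \<in> I \<times> cdom d" "cmap c (cinv c x) = x"
  using assms psi.S.cinv_cmap by (auto simp: cdom_product_chart)

lemma metric_coord_rep:
  assumes c: "c \<in> M" and d: "d \<in> P" and x: "x \<in> rep_dom c d"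
  shows "metric_coord M g c x v w = ambient d (rep c d x) (fder (rep c d) x v) (fder (rep c d) x w)"
proof -
  note p = cinv_rep_dom[OF c x]
  have "\<psi> (cinv c x) \<in> cdom (product_chart I d)" using p(2) by (simp add: cdom_product_chart)
  from psi.differential_coord_vec[OF c p(1) product_chart_in[OF d] this]
  show ?thesis
    unfolding metric_coord_def[of M] pullback_metric_def p(3)
    by (simp add: gbar_coord_vec[OF d p(2)])
qed

lemma chart_at_product:
  assumes "p \<in> carrier M"
  obtains d where "d \<in> P" "\<psi> p \<in> I \<times> cdom d" "chart_at PA (\<psi> p) = product_chart I d"
proof -
  have "chart_at PA (\<psi> p) \<in> PA \<and> \<psi> p \<in> cdom (chart_at PA (\<psi> p))"
    by (rule Q.chart_at[OF psi.map_in_carrier[OF assms]])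
  then show ?thesis using that by (auto simp: product_atlas_eq cdom_product_chart)
qed

text \<open>The ambient acceleration of the coordinate line through \<^term>\<open>x\<close> in the direction
  \<^term>\<open>u\<close>. It is not invariant under a change of the chart \<^term>\<open>c\<close>, but its normal part is.\<close>

definition accel :: "('a, 'e) chart \<Rightarrow> ('p, 'e) chart \<Rightarrow> 'e \<Rightarrow> 'e \<Rightarrow> real \<times> 'e" where
  "accel c d x u = fder (\<lambda>y. fder (rep c d) y u) x u +
     christoffel PA gbar (product_chart I d) (rep c d x) (fder (rep c d) x u) (fder (rep c d) x u)"

text \<open>An extension with constant components \<open>u\<close> is represented along the
  immersion by \<open>y \<mapsto> fder (rep c d) y u\<close>, whose derivative along
  \<open>u\<close> is the second derivative occurring in \<open>accel\<close>.\<close>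

lemma cov_deriv_const_extension:
  assumes p: "p \<in> carrier M" and d: "d \<in> P" "\<psi> p \<in> I \<times> cdom d" "chart_at PA (\<psi> p) = product_chart I d"
  shows "cov_deriv M PA gbar \<psi> (\<lambda>q. differential PA \<psi> q (const_extension M p e q)) p (const_extension M p e p)
    = coord_vec PA (product_chart I d) (\<psi> p)
        (accel (chart_at M p) d (cmap (chart_at M p) p) (components (chart_at M p) e))"
proof -
  define c where "c = chart_at M p"
  have c: "c \<in> M" "p \<in> cdom c" using psi.S.chart_at[OF p] by (auto simp: c_def)
  define u where "u = components c e"
  define x where "x = cmap c p"
  have x: "x \<in> rep_dom c d" using c d by (auto simp: x_def cdom_product_chart)
  have u: "components c (const_extension M p e p) = u"
    by (simp add: const_extension_def c_def[symmetric] u_def[symmetric] psi.S.components_coord_vec[OF c])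
  have y: "components (product_chart I d) (differential PA \<psi> (cinv c y) (const_extension M p e (cinv c y)))
      = fder (rep c d) y u" if "y \<in> rep_dom c d" for y
  proof -
    note q = cinv_rep_dom[OF c(1) that]
    have q': "\<psi> (cinv c y) \<in> cdom (product_chart I d)" using q by (simp add: cdom_product_chart)
    show ?thesis
      unfolding const_extension_def c_def[symmetric] u_def[symmetric]
        psi.differential_coord_vec[OF c(1) q(1) product_chart_in[OF d(1)] q'] q(3)
      by (rule Q.components_coord_vec[OF product_chart_in[OF d(1)] q'])
  qed
  have "fder (\<lambda>y. components (product_chart I d) (differential PA \<psi> (cinv c y) (const_extension M p e (cinv c y)))) x
      = fder (\<lambda>y. fder (rep c d) y u) x"
    by (rule fder_cong[OF open_rep_dom[OF c(1) d(1)] x y])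
  then show ?thesis
    unfolding cov_deriv_def Let_def d(3) c_def[symmetric] u u_def[symmetric] x_def[symmetric] accel_def
    using y[OF x] by simp
qed

text \<open>The second-order chain rule adds the image, under the derivative of
  \<open>rep c d\<close>, of the second derivative of the transition map. That vector is tangent,
  and its preimage is the witness \<open>k\<close>.\<close>

lemma accel_change:
  assumes c: "c \<in> M" "p \<in> cdom c" and c': "c' \<in> M" "p \<in> cdom c'" and d: "d \<in> P" "\<psi> p \<in> I \<times> cdom d"
    and u: "coord_vec M c p u = coord_vec M c' p u'"
  shows "\<exists>k. accel c' d (cmap c' p) u' = accel c d (cmap c p) u + fder (rep c d) (cmap c p) k"
    and "rep c' d (cmap c' p) = rep c d (cmap c p)"
    and "fder (rep c' d) (cmap c' p) u' = fder (rep c d) (cmap c p) u"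
proof -
  define T where "T = cmap c \<circ> cinv c'"
  define V where "V = cmap c' ` (cdom c' \<inter> (cdom c \<inter> \<psi> -` cdom (product_chart I d)))"
  define x' where "x' = cmap c' p"
  define x where "x = cmap c p"
  have V: "open V"
    unfolding V_def
    by (rule psi.S.open_cmap_image_Int[OF c'(1) psi.open_Int_vimage[OF c(1) Q.open_cdom[OF product_chart_in[OF d(1)]]]])
  have x': "x' \<in> V" using c c' d by (auto simp: V_def x'_def cdom_product_chart)
  have Tx: "T x' = x" using c' by (simp add: T_def x'_def x_def psi.S.cinv_cmap)
  have smT: "smooth_on V T"
    unfolding T_def
    by (rule smooth_on_subset[OF psi.S.smooth_on_transition[OF c'(1) c(1)]]) (auto simp: V_def)
  have TV: "T ` V \<subseteq> rep_dom c d"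
    using psi.S.cinv_cmap[OF c'(1)] by (auto simp: V_def T_def)
  have comp: "rep c' d y = rep c d (T y)" if "y \<in> V" for y
    using that psi.S.cinv_cmap[OF c'(1)] psi.S.cinv_cmap[OF c(1)] by (auto simp: V_def T_def)
  note smR = smooth_rep[OF c(1) d(1)] and oR = open_rep_dom[OF c(1) d(1)]
  have dcomp: "fder (rep c' d) y v = fder (rep c d) (T y) (fder T y v)" if y: "y \<in> V" for y v
  proof -
    have "((\<lambda>y. rep c d (T y)) has_derivative (\<lambda>v. fder (rep c d) (T y) (fder T y v))) (at y)"
      by (rule has_derivative_compose[OF smooth_on_has_derivative[OF smT y] smooth_on_has_derivative[OF smR]])
        (use TV y in auto)
    moreover have "fder (rep c' d) y = fder (\<lambda>y. rep c d (T y)) y"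
      by (rule fder_cong[OF V y comp])
    ultimately show ?thesis by (simp add: fder_eqI)
  qed
  have "coord_vec M c' p u' = coord_vec M c p (fder T x' u')"
    unfolding T_def x'_def by (rule psi.S.coord_vec_change[OF c' c])
  then have u_eq: "u = fder T x' u'"
    using u psi.S.components_coord_vec[OF c] by metis
  have "((\<lambda>y. fder (rep c d) (T y) (fder T y u')) has_derivative
      (\<lambda>v. fder (\<lambda>z. fder (rep c d) z (fder T x' u')) (T x') (fder T x' v) +
        fder (rep c d) (T x') (fder (\<lambda>y. fder T y u') x' v))) (at x')"
    by (rule has_derivative_fder_along[OF smR oR V x' TV smooth_on_has_derivative[OF smT x']
          smooth_on_has_derivative[OF smooth_on_fder[OF smT V] x']])
  moreover have "fder (\<lambda>y. fder (rep c' d) y u') x' = fder (\<lambda>y. fder (rep c d) (T y) (fder T y u')) x'"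
    by (rule fder_cong[OF V x' dcomp])
  ultimately have "fder (\<lambda>y. fder (rep c' d) y u') x' u' =
      fder (\<lambda>z. fder (rep c d) z u) x u + fder (rep c d) x (fder (\<lambda>y. fder T y u') x' u')"
    by (simp add: fder_eqI u_eq[symmetric] Tx)
  then show "\<exists>k. accel c' d (cmap c' p) u' = accel c d (cmap c p) u + fder (rep c d) (cmap c p) k"
    unfolding accel_def x'_def[symmetric] x_def[symmetric]
    using comp[OF x'] dcomp[OF x', of u'] u_eq Tx by (auto simp: algebra_simps)
  show "rep c' d (cmap c' p) = rep c d (cmap c p)"
    using comp[OF x'] Tx by (simp add: x_def x'_def)
  show "fder (rep c' d) (cmap c' p) u' = fder (rep c d) (cmap c p) u"
    using dcomp[OF x', of u'] u_eq Tx by (simp add: x_def x'_def)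
qed

text \<open>Guarantees that \<open>SOME E\<close> in \<open>mean_curvature_vector\<close> denotes an
  orthonormal basis. A coordinate frame is transported by \<open>coord_vec\<close>, which is
  injective because \<open>components\<close> inverts it.\<close>

lemma ex_orthonormal_basis:
  assumes p: "p \<in> carrier M"
  shows "\<exists>E. orthonormal_basis M g p E"
proof -
  obtain c where c: "c \<in> M" "p \<in> cdom c" using p by (auto simp: carrier_def)
  interpret m: metric_form "cmap c ` cdom c" "metric_coord M g c" by (rule metric_form_g[OF c(1)])
  have "cmap c p \<in> cmap c ` cdom c" using c by blast
  from m.ex_orthonormal[OF this] obtain B where B: "m.orthonormal (cmap c p) B" "card B = DIM('e)" by blast
  have inj: "coord_vec M c p u = coord_vec M c p v \<longleftrightarrow> u = v" for u v
    using psi.S.components_coord_vec[OF c] by metis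
  have "card (coord_vec M c p ` B) = DIM('e)"
    using B(2) by (simp add: card_image inj_on_def inj)
  moreover have "g p (coord_vec M c p u) (coord_vec M c p v) = (if u = v then 1 else 0)" if "u \<in> B" "v \<in> B" for u v
    using B(1) that by (simp add: m.orthonormal_def metric_coord_def psi.S.cinv_cmap[OF c])
  ultimately have "orthonormal_basis M g p (coord_vec M c p ` B)"
    using B psi.S.coord_vec_in_tangent_space[OF c]
    by (auto simp: orthonormal_basis_def m.orthonormal_def inj)
  then show ?thesis by blast
qed

text \<open>Frees the mean curvature from \<open>chart_at M p\<close>: the chart \<open>c\<close> is
  arbitrary. The intrinsic covariant derivatives and the discrepancy between the two charts are both
  tangential, hence orthogonal to \<open>N p\<close>.\<close>

lemma mean_curvature_trace:
  assumes N: "future_unit_normal M I P gbar \<psi> N" and c: "c \<in> M" "p \<in> cdom c"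
  obtains d n B where "d \<in> P" "\<psi> p \<in> I \<times> cdom d" "N p = coord_vec PA (product_chart I d) (\<psi> p) n"
    "metric_form.orthonormal (metric_coord M g c) (cmap c p) B" "card B = DIM('e)"
    "real DIM('e) * mean_curvature M PA gbar \<psi> N p =
      - (\<Sum>u\<in>B. ambient d (rep c d (cmap c p)) (accel c d (cmap c p) u) n)"
proof -
  have p: "p \<in> carrier M" using c by (auto simp: carrier_def)
  obtain d where d: "d \<in> P" "\<psi> p \<in> I \<times> cdom d" "chart_at PA (\<psi> p) = product_chart I d"
    using chart_at_product[OF p] by metis
  have pd: "\<psi> p \<in> cdom (product_chart I d)" using d by (simp add: cdom_product_chart)
  note pc = product_chart_in[OF d(1)]
  define cv where "cv = coord_vec PA (product_chart I d) (\<psi> p)"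
  have "N p \<in> tangent_space PA (\<psi> p)" using N p by (simp add: future_unit_normal_def)
  then obtain n where n: "N p = cv n"
    unfolding cv_def Q.tangent_space_eq[OF pc pd] by blast
  define c' where "c' = chart_at M p"
  have c': "c' \<in> M" "p \<in> cdom c'" using psi.S.chart_at[OF p] by (auto simp: c'_def)
  define x' where "x' = cmap c' p"
  define x where "x = cmap c p"
  define q where "q = rep c d x"
  have xr: "x \<in> rep_dom c d" "x' \<in> rep_dom c' d" using c c' pd by (auto simp: x_def x'_def)
  have q: "q \<in> ambient_dom d" using rep_in[OF c(1), of d] xr by (auto simp: q_def)
  have q_eq: "cmap (product_chart I d) (\<psi> p) = q"
    by (simp add: q_def x_def psi.S.cinv_cmap[OF c])
  note bil = bilinear_ambient[OF d(1) q]
  define E where "E = (SOME E. orthonormal_basis M g p E)"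
  have E: "orthonormal_basis M g p E" unfolding E_def by (rule someI_ex[OF ex_orthonormal_basis[OF p]])
  have finE: "finite E" using E by (simp add: orthonormal_basis_def)
  define w where "w e = components c' e" for e
  define acc where "acc e = accel c' d x' (w e)" for e
  \<comment> \<open>The intrinsic covariant derivative is recorded as some coordinate vector at
    \<open>p\<close>; tangency is the property that makes it vanish against
    \<open>n\<close>.\<close>
  have "\<exists>k. cov_deriv M M g id (const_extension M p e) p (const_extension M p e p) = coord_vec M c' p k" for e
    unfolding cov_deriv_def Let_def c'_def[symmetric] id_apply by blast
  then obtain k where k: "\<And>e. cov_deriv M M g id (const_extension M p e) p (const_extension M p e p) = coord_vec M c' p (k e)"
    by metis
  have II: "second_ff M PA gbar \<psi> (const_extension M p e) (const_extension M p e) p =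
      (\<lambda>f. cv (acc e) f - cv (fder (rep c' d) x' (k e)) f)" for e
    unfolding second_ff_def k cov_deriv_const_extension[OF p d]
      psi.differential_coord_vec[OF c' pc pd] c'_def[symmetric] x'_def[symmetric] cv_def acc_def w_def
    by (rule refl)
  define X where "X = (\<Sum>e\<in>E. (1 / real DIM('e)) *\<^sub>R (acc e - fder (rep c' d) x' (k e)))"
  have diff: "cv (a - b) = (\<lambda>f. cv a f - cv b f)" for a b
    using Q.coord_vec_lincomb[OF pc pd, of 1 a "-1" b] by (simp add: cv_def)
  have H: "mean_curvature_vector M PA gbar \<psi> p = cv X"
    unfolding mean_curvature_vector_def Let_def E_def[symmetric] II X_def
    unfolding cv_def Q.coord_vec_sum_scaleR[OF pc pd]
    unfolding cv_def[symmetric] diff by (simp add: sum_distrib_left)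
  have gb: "gbar (\<psi> p) (cv a) (cv b) = ambient d q a b" for a b
    unfolding cv_def q_eq[symmetric] by (rule gbar_coord_vec[OF d(1,2)])
  have norm0: "ambient d q (fder (rep c' d) x' v) n = 0" for v
  proof -
    have "gbar (\<psi> p) (N p) (differential PA \<psi> p (coord_vec M c' p v)) = 0"
      using N p psi.S.coord_vec_in_tangent_space[OF c'] by (simp add: future_unit_normal_def)
    then have "ambient d q n (fder (rep c' d) x' v) = 0"
      unfolding psi.differential_coord_vec[OF c' pc pd] cv_def[symmetric] x'_def[symmetric] n gb .
    then show ?thesis using sym_ambient[OF d(1) q] by simp
  qed
  have u0: "\<exists>u. e = coord_vec M c p u" if "e \<in> E" for e
    using E that psi.S.tangent_space_eq[OF c] by (auto simp: orthonormal_basis_def)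
  define v where "v e = components c e" for e
  have v: "e = coord_vec M c p (v e)" if "e \<in> E" for e
    using u0[OF that] psi.S.components_coord_vec[OF c] by (auto simp: v_def)
  have w: "e = coord_vec M c' p (w e)" if "e \<in> E" for e
  proof -
    have "e \<in> tangent_space M p" using E that by (auto simp: orthonormal_basis_def)
    then show ?thesis
      using psi.S.components_coord_vec[OF c'] psi.S.tangent_space_eq[OF c'] by (auto simp: w_def)
  qed
  \<comment> \<open>The coordinates \<open>w e\<close> and \<open>v e\<close> represent the same
    tangent vector in the two charts, so the accelerations differ by a tangent vector.\<close>
  have accn: "ambient d q (acc e) n = ambient d q (accel c d x (v e)) n" if e: "e \<in> E" for e
  proof -
    have eq: "coord_vec M c' p (w e) = coord_vec M c p (v e)" using v[OF e] w[OF e] by simp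
    obtain j where "accel c d x (v e) = acc e + fder (rep c' d) x' j"
      using accel_change(1)[OF c' c d(1,2) eq] unfolding x_def x'_def acc_def by blast
    then show ?thesis using norm0 by (simp add: bilinear_ladd[OF bil])
  qed
  define B where "B = v ` E"
  have injv: "inj_on v E" by (rule inj_onI) (metis v)
  have "metric_form.orthonormal (metric_coord M g c) x B"
    unfolding metric_form.orthonormal_def[OF metric_form_g[OF c(1)]] B_def
  proof (intro conjI ballI)
    show "finite (v ` E)" using finE by simp
    fix a b assume "a \<in> v ` E" "b \<in> v ` E"
    then obtain e e' where e: "e \<in> E" "e' \<in> E" "a = v e" "b = v e'" by blast
    have "metric_coord M g c x a b = g p e e'"
      using v[OF e(1)] v[OF e(2)] e by (simp add: metric_coord_def x_def psi.S.cinv_cmap[OF c])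
    then show "metric_coord M g c x a b = (if a = b then 1 else 0)"
      using E e inj_on_eq_iff[OF injv e(1,2)] by (simp add: orthonormal_basis_def)
  qed
  moreover have "card B = DIM('e)"
    using E by (simp add: B_def card_image[OF injv] orthonormal_basis_def)
  moreover have "real DIM('e) * mean_curvature M PA gbar \<psi> N p = - (\<Sum>u\<in>B. ambient d q (accel c d x u) n)"
  proof -
    have lin: "linear (\<lambda>a. ambient d q a n)" using bil unfolding bilinear_def by blast
    have "mean_curvature M PA gbar \<psi> N p = - ambient d q X n"
      by (simp add: mean_curvature_def H n gb)
    also have "ambient d q X n = (\<Sum>e\<in>E. (1 / real DIM('e)) * ambient d q (acc e) n)"
      unfolding X_def linear_sum[OF lin] linear_cmul[OF lin] linear_diff[OF lin] norm0 by simp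
    also have "\<dots> = (1 / real DIM('e)) * (\<Sum>e\<in>E. ambient d q (accel c d x (v e)) n)"
      by (simp add: accn sum_distrib_left)
    finally have "real DIM('e) * mean_curvature M PA gbar \<psi> N p = - (\<Sum>e\<in>E. ambient d q (accel c d x (v e)) n)"
      by simp
    then show ?thesis by (simp add: B_def sum.reindex[OF injv])
  qed
  ultimately show ?thesis
    using that[OF d(1,2), of n B] n unfolding cv_def q_def x_def by blast
qed

end

section \<open>The height function\<close>

context hypersurface
begin

abbreviation height :: "('a, 'e) chart \<Rightarrow> 'e \<Rightarrow> real" where
  "height c \<equiv> fst \<circ> \<psi> \<circ> cinv c"

abbreviation lapse :: "('a, 'e) chart \<Rightarrow> 'e \<Rightarrow> real" where
  "lapse c \<equiv> h \<circ> snd \<circ> \<psi> \<circ> cinv c"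

lemma psi_in: "p \<in> carrier M \<Longrightarrow> fst (\<psi> p) \<in> I" "p \<in> carrier M \<Longrightarrow> snd (\<psi> p) \<in> carrier P"
  using psi.map_in_carrier unfolding carrier_product by (auto simp: mem_Times_iff)

lemma fst_rep: "fst (rep c d y) = height c y"
  by (simp add: cmap_product_chart)

lemma lapse_rep:
  assumes "c \<in> M" "d \<in> P" "y \<in> rep_dom c d"
  shows "lapse c y = (h \<circ> cinv d) (snd (rep c d y))"
  using cinv_rep_dom[OF assms(1,3)] P.cinv_cmap[OF assms(2)] by (auto simp: cmap_product_chart)

lemma smooth_height_lapse:
  assumes c: "c \<in> M"
  shows "smooth_on (cmap c ` cdom c) (height c)" "smooth_on (cmap c ` cdom c) (lapse c)"
proof -
  have *: "\<exists>V. open V \<and> x \<in> V \<and> smooth_on V (height c) \<and> smooth_on V (lapse c)"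
    if x: "x \<in> cmap c ` cdom c" for x
  proof -
    obtain p where p: "p \<in> cdom c" "x = cmap c p" using x by blast
    then have pM: "p \<in> carrier M" using c by (auto simp: carrier_def)
    obtain d where d: "d \<in> P" "snd (\<psi> p) \<in> cdom d" using psi_in(2)[OF pM] by (auto simp: carrier_def)
    have "smooth_on (rep_dom c d) (\<lambda>y. fst (rep c d y))"
      by (rule smooth_on_bounded_linear_compose[OF bounded_linear_fst smooth_rep[OF c d(1)]])
    then have "smooth_on (rep_dom c d) (height c)"
      by (rule smooth_on_cong[OF open_rep_dom[OF c d(1)], rotated]) (rule fst_rep)
    moreover have "smooth_on (rep_dom c d) (\<lambda>y. (h \<circ> cinv d) (snd (rep c d y)))"
      by (rule smooth_on_compose[OF h_smooth[OF d(1)]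
            smooth_on_bounded_linear_compose[OF bounded_linear_snd smooth_rep[OF c d(1)]]])
        (use rep_in[OF c, of d] in fastforce)
    then have "smooth_on (rep_dom c d) (lapse c)"
      by (rule smooth_on_cong[OF open_rep_dom[OF c d(1)], rotated]) (rule lapse_rep[OF c d(1), symmetric])
    moreover have "x \<in> rep_dom c d"
      using p d psi_in(1)[OF pM] by (auto simp: cdom_product_chart mem_Times_iff)
    ultimately show ?thesis using open_rep_dom[OF c d(1)] by blast
  qed
  show "smooth_on (cmap c ` cdom c) (height c)" "smooth_on (cmap c ` cdom c) (lapse c)"
    by (rule smooth_on_locally, use * in blast)+
qed

lemma height_in: "c \<in> M \<Longrightarrow> y \<in> cmap c ` cdom c \<Longrightarrow> height c y \<in> I"
  and lapse_pos: "c \<in> M \<Longrightarrow> y \<in> cmap c ` cdom c \<Longrightarrow> lapse c y > 0"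
proof -
  assume c: "c \<in> M" "y \<in> cmap c ` cdom c"
  have "cinv c y \<in> carrier M"
    by (rule subsetD[OF psi.S.cdom_subset_carrier[OF c(1)] psi.S.cinv_in_cdom[OF c(2)]])
  then show "height c y \<in> I" "lapse c y > 0" using psi_in h_pos by auto
qed

text \<open>The normal is \<open>n = dF z + \<kappa> \<partial>\<^sub>t\<close> with \<open>z\<close> tangential, and \<open>\<kappa> \<eta>\<^sup>2 dt(n) = 1\<close>. The tangential part of
  the acceleration is expressed by the induced metric, and its \<open>\<partial>\<^sub>t\<close> part contains the second
  derivative of the height.\<close>

lemma height_trace_inequality:
  assumes N: "future_unit_normal M I P gbar \<psi> N" and c: "c \<in> M" "p \<in> cdom c"
    and \<rho>': "deriv \<rho> (fst (\<psi> p)) \<ge> 0"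
    and H: "mean_curvature M PA gbar \<psi> N p \<ge> deriv \<rho> (fst (\<psi> p)) / (h (snd (\<psi> p)) * \<rho> (fst (\<psi> p)))"
  defines "x \<equiv> cmap c p" and "m \<equiv> metric_coord M g c"
  obtains B z \<kappa> where "metric_form.orthonormal m x B" "card B = DIM('e)" "\<kappa> > 0"
    "\<And>v. m x v z = \<kappa> * (lapse c x)\<^sup>2 * fder (height c) x v"
    "(\<Sum>u\<in>B. (fder (\<lambda>y. m y u z) x u - fder (\<lambda>y. m y u u) x z / 2) / (\<kappa> * (lapse c x)\<^sup>2)
        - 2 * fder (lapse c) x u * fder (height c) x u / lapse c x
        - deriv \<rho> (height c x) / \<rho> (height c x) * (fder (height c) x u)\<^sup>2)
      \<le> (\<Sum>u\<in>B. fder (\<lambda>y. fder (height c) y u) x u)"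
proof -
  obtain d n B where d: "d \<in> P" "\<psi> p \<in> I \<times> cdom d" and n: "N p = coord_vec PA (product_chart I d) (\<psi> p) n"
    and B: "metric_form.orthonormal m x B" "card B = DIM('e)"
    and tr: "real DIM('e) * mean_curvature M PA gbar \<psi> N p = - (\<Sum>u\<in>B. ambient d (rep c d x) (accel c d x u) n)"
    using mean_curvature_trace[OF N c] unfolding x_def m_def by metis
  have pM: "p \<in> carrier M" using c by (auto simp: carrier_def)
  have pd: "\<psi> p \<in> cdom (product_chart I d)" using d by (simp add: cdom_product_chart)
  interpret mf: metric_form "cmap c ` cdom c" m unfolding m_def by (rule metric_form_g[OF c(1)])
  have xU: "x \<in> cmap c ` cdom c" using c by (simp add: x_def)
  define V where "V = rep_dom c d"
  have V: "open V" "x \<in> V"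
    using open_rep_dom[OF c(1) d(1)] c pd by (auto simp: V_def x_def)
  define F where "F = rep c d"
  define q where "q = F x"
  have smF: "smooth_on V F" unfolding V_def F_def by (rule smooth_rep[OF c(1) d(1)])
  have FV: "F ` V \<subseteq> ambient_dom d" unfolding V_def F_def by (rule rep_in[OF c(1)])
  have q: "q \<in> ambient_dom d" using FV V by (auto simp: q_def)
  have xinv: "cinv c x = p" using c by (simp add: x_def psi.S.cinv_cmap)
  have q_eq: "cmap (product_chart I d) (\<psi> p) = q" by (simp add: q_def F_def xinv)
  define \<eta> where "\<eta> = lapse c x"
  define r where "r = \<rho> (height c x)"
  define r' where "r' = deriv \<rho> (height c x)"
  have ht: "height c x = fst (\<psi> p)" by (simp add: xinv)
  have eta: "\<eta> = h (snd (\<psi> p))" by (simp add: \<eta>_def xinv)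
  have eta': "h (cinv d (snd q)) = \<eta>"
    using lapse_rep[OF c(1) d(1), of x] V by (simp add: \<eta>_def V_def q_def F_def)
  have fq: "fst q = height c x" unfolding q_def F_def by (rule fst_rep)
  have \<eta>: "\<eta> > 0" using h_pos[OF psi_in(2)[OF pM]] unfolding eta .
  have r: "r > 0" using rho_pos[OF psi_in(1)[OF pM]] unfolding r_def ht .
  have r': "r' \<ge> 0" using \<rho>' unfolding r'_def ht .
  define G where "G = ambient d q"
  have bil: "bilinear G" unfolding G_def by (rule bilinear_ambient[OF d(1) q])
  have sym: "G a b = G b a" for a b unfolding G_def by (rule sym_ambient[OF d(1) q])
  define S where "S = metric_coord P \<sigma> d (snd q)"
  have sq: "snd q \<in> cmap d ` cdom d" using q by auto
  interpret sf: metric_form "cmap d ` cdom d" "metric_coord P \<sigma> d" by (rule metric_form_base[OF d(1)])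
  have Spos: "S a a \<ge> 0" for a
    using sf.pos_G[OF sq, of a] linear_0[OF sf.linear_G(1)[OF sq]] by (cases "a = 0") (auto simp: S_def)
  have Geq: "G a b = - \<eta>\<^sup>2 * (fst a * fst b) + r\<^sup>2 * S (snd a) (snd b)" for a b
    by (simp add: G_def warped_form_def S_def eta' fq r_def)
  have time: "G a (1, 0) = - \<eta>\<^sup>2 * fst a" for a
    unfolding G_def ambient_time[OF d(1) q] eta' ..
  define DF where "DF = fder F x"
  define D where "D = fder (height c) x"
  have linDF: "linear DF" unfolding DF_def by (rule smooth_on_fder_linear[OF smF V(2)])
  have dF: "(F has_derivative DF) (at x)" unfolding DF_def by (rule smooth_on_has_derivative[OF smF V(2)])
  have height_eq: "height c = (\<lambda>y. fst (F y))" by (simp add: fun_eq_iff F_def cmap_product_chart)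
  have fder_height: "fder (height c) y v = fst (fder F y v)" if "y \<in> V" for y v
  proof -
    have "(height c has_derivative (\<lambda>v. fst (fder F y v))) (at y)"
      unfolding height_eq by (rule has_derivative_fst[OF smooth_on_has_derivative[OF smF that]])
    then show ?thesis by (simp add: fder_eqI)
  qed
  have D: "fst (DF v) = D v" for v
    unfolding DF_def D_def by (rule fder_height[OF V(2), symmetric])
  have D2: "fst (fder (\<lambda>y. fder F y u) x v) = fder (\<lambda>y. fder (height c) y u) x v" for u v
  proof -
    have "fder (\<lambda>y. fder (height c) y u) x = fder (\<lambda>y. fst (fder F y u)) x"
      by (rule fder_cong[OF V fder_height])
    moreover have "((\<lambda>y. fst (fder F y u)) has_derivative (\<lambda>v. fst (fder (\<lambda>y. fder F y u) x v))) (at x)"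
      by (rule has_derivative_fst[OF smooth_on_has_derivative[OF smooth_on_fder[OF smF V(1)] V(2)]])
    ultimately show ?thesis by (simp add: fder_eqI)
  qed
  have hd: "((h \<circ> cinv d) has_derivative fder (h \<circ> cinv d) (snd q)) (at (snd q))"
    by (rule smooth_on_has_derivative[OF h_smooth[OF d(1)] sq])
  have dlapse: "fder (lapse c) x v = fder (h \<circ> cinv d) (snd q) (snd (DF v))" for v
  proof -
    have "fder (lapse c) x = fder (\<lambda>y. (h \<circ> cinv d) (snd (F y))) x"
      by (rule fder_cong[OF V]) (simp only: F_def V_def lapse_rep[OF c(1) d(1)])
    moreover have "((\<lambda>y. (h \<circ> cinv d) (snd (F y))) has_derivative
        (\<lambda>v. fder (h \<circ> cinv d) (snd q) (snd (DF v)))) (at x)"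
      by (rule has_derivative_compose[OF has_derivative_snd[OF dF]]) (fold q_def, rule hd)
    ultimately show ?thesis by (simp add: fder_eqI)
  qed
  have mG: "m y v w = ambient d (F y) (fder F y v) (fder F y w)" if "y \<in> V" for y v w
    unfolding m_def F_def by (rule metric_coord_rep[OF c(1) d(1)]) (use that in \<open>simp add: V_def\<close>)
  have mx: "m x v w = G (DF v) (DF w)" for v w
    using mG[OF V(2)] by (simp add: G_def q_def DF_def)
  have rep_x: "fder (cmap (product_chart I d) \<circ> \<psi> \<circ> cinv c) (cmap c p) = DF"
    by (simp add: DF_def F_def x_def)
  have gb: "gbar (\<psi> p) (coord_vec PA (product_chart I d) (\<psi> p) a) (coord_vec PA (product_chart I d) (\<psi> p) b) = G a b" for a b
    unfolding G_def q_eq[symmetric] by (rule gbar_coord_vec[OF d])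
  note Np = N[unfolded future_unit_normal_def, rule_format, OF pM]
  have n1: "G n (DF v) = 0" for v
  proof -
    have "gbar (\<psi> p) (N p) (differential PA \<psi> p (coord_vec M c p v)) = 0"
      using Np psi.S.coord_vec_in_tangent_space[OF c] by blast
    then show ?thesis
      unfolding psi.differential_coord_vec[OF c product_chart_in[OF d(1)] pd] rep_x n gb .
  qed
  have n2: "G n n = - 1" using Np n gb by simp
  have n3: "G n (1, 0) < 0"
    using Np unfolding time_field_eq[OF d] n gb by blast
  have nt: "fst n > 0"
  proof -
    have "\<eta>\<^sup>2 * fst n > 0" using n3 by (simp add: time)
    then show ?thesis using \<eta> by (simp add: zero_less_mult_iff)
  qed
  \<comment> \<open>The spatial part of \<open>DF\<close> is injective, as the induced metric would
    be nonpositive on a vector with no spatial part. By equality of dimensions it is onto, so some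
    tangent vector has the spatial part of \<open>n\<close> and differs from \<open>n\<close> by a
    multiple of \<open>(1, 0)\<close>.\<close>
  have "linear (\<lambda>v. snd (DF v))"
    using linDF by (auto intro!: linearI simp: linear_add linear_cmul)
  moreover have "v = 0" if "snd (DF v) = 0" for v
  proof (rule ccontr)
    assume "v \<noteq> 0"
    then have "m x v v > 0" by (rule mf.pos_G[OF xU])
    moreover have "S 0 0 = 0" using linear_0[OF sf.linear_G(1)[OF sq]] by (simp add: S_def)
    ultimately have "- \<eta>\<^sup>2 * (D v * D v) > 0"
      using that by (simp add: mx Geq D)
    moreover have "\<eta>\<^sup>2 * (D v * D v) \<ge> 0" by simp
    ultimately show False by simp
  qed
  ultimately have "surj (\<lambda>v. snd (DF v))"
    using linear_injective_imp_surjective linear_injective_0 by blast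
  then obtain z where z: "snd (DF z) = snd n" by (metis surjD)
  define \<kappa> where "\<kappa> = fst n - D z"
  have n_eq: "n = DF z + \<kappa> *\<^sub>R (1, 0)"
    by (simp add: prod_eq_iff z D \<kappa>_def)
  have Gn: "G a n = G a (DF z) + \<kappa> * G a (1, 0)" for a
    unfolding n_eq by (simp only: bilinear_radd[OF bil] bilinear_rmul[OF bil] real_scaleR_def)
  have mz: "m x v z = \<kappa> * \<eta>\<^sup>2 * D v" for v
    using Gn[of "DF v"] n1[of v] sym[of n] by (simp add: mx time D algebra_simps)
  \<comment> \<open>The decomposition of \<open>n\<close> paired with \<open>n\<close> itself; the
    tangential part contributes nothing and \<open>G n n = - 1\<close>.\<close>
  have k1: "\<kappa> * \<eta>\<^sup>2 * fst n = 1"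
    using Gn[of n] n1[of z] n2 by (simp add: time mult.assoc)
  then have \<kappa>: "\<kappa> > 0"
    using nt \<eta> by (metis mult_pos_pos not_one_less_zero zero_less_mult_pos2 zero_less_one zero_less_power)
  \<comment> \<open>The reversed Cauchy-Schwarz inequality for the future unit timelike vectors
    \<open>n\<close> and \<open>(1, 0)\<close> divided by \<eta>.\<close>
  have nt1: "fst n \<ge> 1 / \<eta>"
  proof -
    have "1 = \<eta>\<^sup>2 * (fst n * fst n) - r\<^sup>2 * S (snd n) (snd n)" using n2 by (simp add: Geq)
    also have "\<dots> \<le> \<eta>\<^sup>2 * (fst n * fst n)" using Spos[of "snd n"] by simp
    also have "\<dots> = (\<eta> * fst n)\<^sup>2" by (simp add: power2_eq_square)
    finally have "1 \<le> \<eta> * fst n" using \<eta> nt by (intro power2_le_imp_le[of 1]) auto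
    then show ?thesis using \<eta> by (simp add: field_simps)
  qed
  define K where "K u = fder (\<lambda>y. m y u z) x u - fder (\<lambda>y. m y u u) x z / 2" for u
  define \<Gamma> where "\<Gamma> = christoffel PA gbar (product_chart I d) q"
  have lc: "levi_civita_form (ambient d q) (\<lambda>u v w. fder (\<lambda>y. ambient d y v w) q u) \<Gamma>"
    unfolding \<Gamma>_def by (rule levi_civita_christoffel[OF d(1) q])
  have acc: "accel c d x u = fder (\<lambda>y. fder F y u) x u + \<Gamma> (DF u) (DF u)" for u
    by (simp add: accel_def F_def[symmetric] q_def[symmetric] \<Gamma>_def DF_def)
  have acc1: "G (accel c d x u) (DF z) = K u" for u
    unfolding acc K_def G_def DF_def q_def
    by (rule levi_civita_form_pullback[OF smooth_ambient[OF d(1)] bilinear_ambient[OF d(1)]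
          sym_ambient[OF d(1)] smF V FV lc[unfolded q_def] mG])
  have rd: "(\<rho> has_real_derivative r') (at (fst q))"
  proof -
    have "(\<rho> has_derivative fder \<rho> (fst q)) (at (fst q))"
      by (rule smooth_on_has_derivative[OF rho_smooth]) (use q in auto)
    then have "\<rho> differentiable (at (fst q))" by (auto simp: differentiable_def)
    then show ?thesis unfolding r'_def fq[symmetric]
      by (simp add: DERIV_deriv_iff_real_differentiable)
  qed
  have acc2: "G (accel c d x u) (1, 0) =
      - \<eta>\<^sup>2 * fder (\<lambda>y. fder (height c) y u) x u - 2 * \<eta> * fder (lapse c) x u * D u
      - r * r' * S (snd (DF u)) (snd (DF u))" for u
  proof -
    have "G (\<Gamma> (DF u) (DF u)) (1, 0) = - 2 * \<eta> * fder (lapse c) x u * D u - r * r' * S (snd (DF u)) (snd (DF u))"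
      unfolding G_def
      using warped_form_christoffel_time[OF lc sf.open_U sq sf.bilinear_G sf.sym_G[OF sq] hd rd
          smooth_on_has_derivative[OF sf.smooth_G sq], of "DF u"]
      by (simp add: eta' dlapse D S_def r_def fq)
    then show ?thesis
      unfolding acc bilinear_ladd[OF bil] by (simp add: time D2)
  qed
  have muu: "m x u u = 1" if "u \<in> B" for u
    using B(1) that by (simp add: mf.orthonormal_def)
  have accn: "G (accel c d x u) n = K u + \<kappa> * (- \<eta>\<^sup>2 * fder (\<lambda>y. fder (height c) y u) x u
      - 2 * \<eta> * fder (lapse c) x u * D u - r' / r * (1 + \<eta>\<^sup>2 * (D u)\<^sup>2))" if "u \<in> B" for u
  proof -
    \<comment> \<open>The induced length 1 of \<open>u\<close> determines the spatial length of
      \<open>DF u\<close> from its time component, which separates the warping term into a constant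
      and a multiple of the square of \<open>D u\<close>.\<close>
    have "r\<^sup>2 * S (snd (DF u)) (snd (DF u)) = 1 + \<eta>\<^sup>2 * (D u)\<^sup>2"
      using muu[OF that] by (simp add: mx Geq D power2_eq_square)
    then have "r * r' * S (snd (DF u)) (snd (DF u)) = r' / r * (1 + \<eta>\<^sup>2 * (D u)\<^sup>2)"
      using r by (simp add: field_simps power2_eq_square)
    then show ?thesis by (simp add: Gn acc1 acc2)
  qed
  \<comment> \<open>The first-order remainder: \<open>K u\<close> is linear in \<open>z\<close> and
    the other summands contain \<open>D u\<close>, so each can be bounded by a multiple of the
    differential of the height.\<close>
  define W where "W u = K u / (\<kappa> * \<eta>\<^sup>2) - 2 * fder (lapse c) x u * D u / \<eta> - r' / r * (D u)\<^sup>2" for u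
  have W: "W u = G (accel c d x u) n / (\<kappa> * \<eta>\<^sup>2) + fder (\<lambda>y. fder (height c) y u) x u + r' / (r * \<eta>\<^sup>2)"
    if "u \<in> B" for u
    unfolding accn[OF that] W_def using \<kappa> \<eta> r by (simp add: field_simps power2_eq_square)
  have "(\<Sum>u\<in>B. W u) = (\<Sum>u\<in>B. G (accel c d x u) n) / (\<kappa> * \<eta>\<^sup>2)
      + (\<Sum>u\<in>B. fder (\<lambda>y. fder (height c) y u) x u) + real DIM('e) * (r' / (r * \<eta>\<^sup>2))"
    by (simp add: W sum.distrib sum_divide_distrib B(2))
  also have "(\<Sum>u\<in>B. G (accel c d x u) n) = - (real DIM('e) * mean_curvature M PA gbar \<psi> N p)"
    using tr by (simp add: G_def q_def F_def)
  also have "- (real DIM('e) * mean_curvature M PA gbar \<psi> N p) / (\<kappa> * \<eta>\<^sup>2) =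
      - (real DIM('e) * mean_curvature M PA gbar \<psi> N p * fst n)"
    using k1 \<kappa> \<eta> by (simp add: field_simps)
  \<comment> \<open>The bound on the mean curvature is multiplied by
    \<open>fst n \<ge> 1 / \<eta>\<close>. This requires a nonnegative mean curvature, which the
    bound provides because \<open>r' \<ge> 0\<close>.\<close>
  also have "real DIM('e) * (r' / (r * \<eta>\<^sup>2)) \<le> real DIM('e) * mean_curvature M PA gbar \<psi> N p * fst n"
  proof -
    have "r' / (r * \<eta>\<^sup>2) = r' / (\<eta> * r) * (1 / \<eta>)" by (simp add: power2_eq_square)
    also have "\<dots> \<le> mean_curvature M PA gbar \<psi> N p * fst n"
      using H nt1 \<eta> r r' unfolding r_def[symmetric] r'_def[symmetric] ht[symmetric] eta[symmetric]
      by (intro mult_mono) (auto intro: order_trans[rotated])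
    finally show ?thesis unfolding mult.assoc by (rule mult_left_mono) simp
  qed
  finally have "(\<Sum>u\<in>B. W u) \<le> (\<Sum>u\<in>B. fder (\<lambda>y. fder (height c) y u) x u)" by linarith
  then show ?thesis
    using that[OF B \<kappa>, of z] mz unfolding W_def K_def D_def \<eta>_def r_def r'_def by blast
qed

text \<open>On a compact coordinate ball all coefficients are bounded, so it remains to find a
  factor \<open>d\<tau>\<close> in each error term. In the first,
  \<open>m x v z = \<kappa> * \<eta>\<^sup>2 * d\<tau>(v)\<close> identifies \<open>z\<close>
  divided by \<open>\<kappa> * \<eta>\<^sup>2\<close> as the gradient of the height; the other two
  contain \<open>fder (height c) x u\<close>.\<close>

lemma height_elliptic:
  assumes N: "future_unit_normal M I P gbar \<psi> N" and c: "c \<in> M" and y: "y \<in> cmap c ` cdom c"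
    and \<rho>': "\<And>t. t \<in> I \<Longrightarrow> deriv \<rho> t \<ge> 0"
    and H: "\<And>p. p \<in> carrier M \<Longrightarrow>
      mean_curvature M PA gbar \<psi> N p \<ge> deriv \<rho> (fst (\<psi> p)) / (h (snd (\<psi> p)) * \<rho> (fst (\<psi> p)))"
  shows "\<exists>r>0. \<exists>l>0. \<exists>C. \<forall>x\<in>ball y r \<inter> cmap c ` cdom c. \<exists>B. finite B \<and>
        (\<forall>\<xi>. l * (norm \<xi>)\<^sup>2 \<le> (\<Sum>u\<in>B. (\<xi> \<bullet> u)\<^sup>2)) \<and> (\<Sum>u\<in>B. (norm u)\<^sup>2) \<le> C \<and>
        - C * onorm (fder (height c) x) \<le> (\<Sum>u\<in>B. fder (\<lambda>z. fder (height c) z u) x u)"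
proof -
  define U where "U = cmap c ` cdom c"
  define m where "m = metric_coord M g c"
  interpret mf: metric_form U m unfolding m_def U_def by (rule metric_form_g[OF c])
  obtain r where r: "r > 0" "cball y r \<subseteq> U" using mf.open_U y open_contains_cball unfolding U_def by blast
  note sm = smooth_height_lapse[OF c, folded U_def]
  have K: "compact (cball y r)" by simp
  obtain l L where l: "l > 0" "L > 0" and lL: "\<And>x v. x \<in> cball y r \<Longrightarrow> l * (norm v)\<^sup>2 \<le> m x v v"
      "\<And>x v. x \<in> cball y r \<Longrightarrow> m x v v \<le> L * (norm v)\<^sup>2"
    using mf.G_bounds[OF K r(2)] by blast
  obtain C1 where C1: "C1 \<ge> 0" "\<And>x u v w. x \<in> cball y r \<Longrightarrow> \<bar>fder (\<lambda>y. m y v w) x u\<bar> \<le> C1 * norm u * norm v * norm w"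
    using mf.fder_G_bound[OF K r(2)] by blast
  obtain Ck where Ck: "Ck \<ge> 0" "\<And>x v. x \<in> cball y r \<Longrightarrow> \<bar>fder (lapse c) x v\<bar> \<le> Ck * norm v"
    using smooth_on_fder_bound[OF sm(2) mf.open_U K r(2)] by blast
  obtain CT where CT: "CT \<ge> 0" "\<And>x v. x \<in> cball y r \<Longrightarrow> \<bar>fder (height c) x v\<bar> \<le> CT * norm v"
    using smooth_on_fder_bound[OF sm(1) mf.open_U K r(2)] by blast
  have lpos: "lapse c x > 0" and hin: "height c x \<in> I" if "x \<in> cball y r" for x
    using lapse_pos[OF c, of x] height_in[OF c, of x] r(2) that unfolding U_def by blast+
  have contl: "continuous_on (cball y r) (lapse c)" and conth: "continuous_on (cball y r) (height c)"
    using continuous_on_subset[OF smooth_on_imp_continuous_on r(2)] sm by blast+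
  have "continuous_on (cball y r) (\<lambda>x. 1 / lapse c x)"
    using lpos by (intro continuous_intros contl) force
  from compact_bound_real[OF K this]
  obtain Ce where Ce: "\<And>x. x \<in> cball y r \<Longrightarrow> \<bar>1 / lapse c x\<bar> \<le> Ce" by blast
  have yK: "y \<in> cball y r" using r(1) by simp
  have Ce0: "Ce \<ge> 0" by (rule order_trans[OF abs_ge_zero Ce[OF yK]])
  have "continuous_on I (\<lambda>t. fder \<rho> t 1)"
    by (rule smooth_on_imp_continuous_on[OF smooth_on_fder[OF rho_smooth open_I]])
  moreover have "fder \<rho> t 1 = deriv \<rho> t" if "t \<in> I" for t
  proof -
    have d: "(\<rho> has_derivative fder \<rho> t) (at t)" by (rule smooth_on_has_derivative[OF rho_smooth that])
    have "fder \<rho> t s = fder \<rho> t 1 * s" for s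
      using linear_cmul[OF has_derivative_linear[OF d], of s 1] by (simp add: mult.commute)
    then have "(\<rho> has_real_derivative fder \<rho> t 1) (at t)"
      using d unfolding has_field_derivative_def by (metis (no_types, lifting) ext)
    then show ?thesis by (simp add: DERIV_imp_deriv)
  qed
  ultimately have "continuous_on I (deriv \<rho>)" by (simp cong: continuous_on_cong)
  moreover have "\<rho> t \<noteq> 0" if "t \<in> I" for t using rho_pos[OF that] by simp
  ultimately have "continuous_on I (\<lambda>t. deriv \<rho> t / \<rho> t)"
    by (intro continuous_on_divide smooth_on_imp_continuous_on[OF rho_smooth]) blast+
  then have "continuous_on (cball y r) (\<lambda>x. deriv \<rho> (height c x) / \<rho> (height c x))"
    by (rule continuous_on_compose2[OF _ conth]) (use hin in auto)
  from compact_bound_real[OF K this]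
  obtain Cr where Cr: "\<And>x. x \<in> cball y r \<Longrightarrow> \<bar>deriv \<rho> (height c x) / \<rho> (height c x)\<bar> \<le> Cr" by blast
  have Cr0: "Cr \<ge> 0" by (rule order_trans[OF abs_ge_zero Cr[OF yK]])
  \<comment> \<open>One summand per error term. The factors \<open>1 / l\<close> come from
    \<open>(norm u)\<^sup>2 \<le> 1 / l\<close> for frame vectors and, in the first summand, also
    from the gradient bound \<open>zb\<close>. The constant \<open>C\<close> below serves as trace
    bound and as gradient coefficient, hence it adds the two.\<close>
  define C2 where "C2 = 3 / 2 * C1 / (l * l) + 2 * Ck * Ce / l + Cr * CT / l"
  have C20: "C2 \<ge> 0" using C1 Ck Ce0 Cr0 CT l by (simp add: C2_def)
  define C where "C = real DIM('e) * (1 / l) + real DIM('e) * C2"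
  have main: "\<exists>B. finite B \<and>
        (\<forall>\<xi>. (1 / L) * (norm \<xi>)\<^sup>2 \<le> (\<Sum>u\<in>B. (\<xi> \<bullet> u)\<^sup>2)) \<and> (\<Sum>u\<in>B. (norm u)\<^sup>2) \<le> C \<and>
        - C * onorm (fder (height c) x) \<le> (\<Sum>u\<in>B. fder (\<lambda>z. fder (height c) z u) x u)"
    if x: "x \<in> cball y r" for x
  proof -
    have xU: "x \<in> U" using x r by blast
    define p where "p = cinv c x"
    have p: "p \<in> cdom c" "cmap c p = x"
      unfolding p_def
      by (rule psi.S.cinv_in_cdom[OF xU[unfolded U_def]], rule psi.S.cmap_cinv[OF c xU[unfolded U_def]])
    have pM: "p \<in> carrier M" using p c by (auto simp: carrier_def)
    obtain B z \<kappa> where B: "mf.orthonormal x B" "card B = DIM('e)" and \<kappa>: "\<kappa> > 0"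
      and z: "\<And>v. m x v z = \<kappa> * (lapse c x)\<^sup>2 * fder (height c) x v"
      and ineq: "(\<Sum>u\<in>B. (fder (\<lambda>y. m y u z) x u - fder (\<lambda>y. m y u u) x z / 2) / (\<kappa> * (lapse c x)\<^sup>2)
        - 2 * fder (lapse c) x u * fder (height c) x u / lapse c x
        - deriv \<rho> (height c x) / \<rho> (height c x) * (fder (height c) x u)\<^sup>2)
      \<le> (\<Sum>u\<in>B. fder (\<lambda>y. fder (height c) y u) x u)"
      by (rule height_trace_inequality[OF N c p(1) \<rho>'[OF psi_in(1)[OF pM]] H[OF pM],
            folded m_def, unfolded p(2)]) (rule that)
    define k where "k = onorm (fder (height c) x)"
    have bl: "bounded_linear (fder (height c) x)"
      using smooth_on_has_derivative[OF sm(1) xU] by (rule has_derivative_bounded_linear)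
    have Dk: "\<bar>fder (height c) x v\<bar> \<le> k * norm v" for v
      using onorm[OF bl, of v] by (simp add: k_def)
    have k0: "k \<ge> 0" unfolding k_def by (rule onorm_pos_le[OF bl])
    define \<eta> where "\<eta> = lapse c x"
    have \<eta>: "\<eta> > 0" using lpos[OF x] by (simp add: \<eta>_def)
    have kn: "\<kappa> * \<eta>\<^sup>2 > 0" using \<kappa> \<eta> by simp
    \<comment> \<open>The lower bound of the metric is tested on \<open>z\<close> itself and one
      factor \<open>norm z\<close> is cancelled.\<close>
    have zb: "norm z / (\<kappa> * \<eta>\<^sup>2) \<le> k / l"
    proof (cases "z = 0")
      case False
      have "l * (norm z)\<^sup>2 \<le> \<kappa> * \<eta>\<^sup>2 * fder (height c) x z"
        using lL(1)[OF x, of z] z[of z] by (simp add: \<eta>_def)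
      also have "\<dots> \<le> \<kappa> * \<eta>\<^sup>2 * (k * norm z)"
        using Dk[of z] kn by (intro mult_left_mono) auto
      finally have "(l * norm z) * norm z \<le> (\<kappa> * \<eta>\<^sup>2 * k) * norm z"
        by (simp add: power2_eq_square mult.assoc)
      then have "l * norm z \<le> \<kappa> * \<eta>\<^sup>2 * k" using False by simp
      then show ?thesis using kn l by (simp add: field_simps)
    qed (use k0 l in simp)
    have ub: "(norm u)\<^sup>2 \<le> 1 / l" if "u \<in> B" for u
      using lL(1)[OF x, of u] B(1) that l by (simp add: mf.orthonormal_def field_simps)
    have low: "- (C2 * k) \<le> (fder (\<lambda>y. m y u z) x u - fder (\<lambda>y. m y u u) x z / 2) / (\<kappa> * \<eta>\<^sup>2)
        - 2 * fder (lapse c) x u * fder (height c) x u / \<eta>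
        - deriv \<rho> (height c x) / \<rho> (height c x) * (fder (height c) x u)\<^sup>2" if u: "u \<in> B" for u
    proof -
      have "\<bar>fder (\<lambda>y. m y u z) x u - fder (\<lambda>y. m y u u) x z / 2\<bar> \<le> 3 / 2 * C1 * (norm u)\<^sup>2 * norm z"
      proof -
        define t where "t = C1 * (norm u)\<^sup>2 * norm z"
        have "\<bar>fder (\<lambda>y. m y u z) x u\<bar> \<le> t" "\<bar>fder (\<lambda>y. m y u u) x z\<bar> \<le> t"
          using C1(2)[OF x, of u z u] C1(2)[OF x, of u u z]
          by (simp_all add: t_def power2_eq_square mult.assoc mult.commute mult.left_commute)
        then have "\<bar>fder (\<lambda>y. m y u z) x u - fder (\<lambda>y. m y u u) x z / 2\<bar> \<le> 3 / 2 * t"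
          by linarith
        then show ?thesis by (simp add: t_def)
      qed
      also have "\<dots> \<le> 3 / 2 * C1 * (1 / l) * norm z"
        using ub[OF u] C1 by (intro mult_right_mono mult_left_mono) auto
      finally have "\<bar>fder (\<lambda>y. m y u z) x u - fder (\<lambda>y. m y u u) x z / 2\<bar> / (\<kappa> * \<eta>\<^sup>2)
          \<le> 3 / 2 * C1 * (1 / l) * norm z / (\<kappa> * \<eta>\<^sup>2)"
        using kn by (intro divide_right_mono) auto
      also have "\<dots> = 3 / 2 * C1 * (1 / l) * (norm z / (\<kappa> * \<eta>\<^sup>2))" by simp
      also have "\<dots> \<le> 3 / 2 * C1 * (1 / l) * (k / l)"
        using zb C1 l by (intro mult_left_mono) auto
      finally have t1: "\<bar>(fder (\<lambda>y. m y u z) x u - fder (\<lambda>y. m y u u) x z / 2) / (\<kappa> * \<eta>\<^sup>2)\<bar>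
          \<le> 3 / 2 * C1 / (l * l) * k"
        using kn by (simp add: abs_divide)
      have "\<bar>fder (lapse c) x u * fder (height c) x u\<bar> \<le> (Ck * norm u) * (k * norm u)"
        unfolding abs_mult using Ck(2)[OF x, of u] Dk[of u] Ck(1) by (intro mult_mono) auto
      also have "\<dots> = Ck * k * (norm u)\<^sup>2" by (simp add: power2_eq_square)
      also have "\<dots> \<le> Ck * k * (1 / l)" using ub[OF u] Ck k0 by (intro mult_left_mono) auto
      finally have "\<bar>fder (lapse c) x u * fder (height c) x u\<bar> * \<bar>1 / \<eta>\<bar> \<le> Ck * k * (1 / l) * Ce"
        using Ce[OF x] Ck k0 l unfolding \<eta>_def by (intro mult_mono) auto
      then have "2 * (\<bar>fder (lapse c) x u * fder (height c) x u\<bar> * \<bar>1 / \<eta>\<bar>) \<le> 2 * (Ck * k * (1 / l) * Ce)"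
        by simp
      moreover have "\<bar>2 * fder (lapse c) x u * fder (height c) x u / \<eta>\<bar> =
          2 * (\<bar>fder (lapse c) x u * fder (height c) x u\<bar> * \<bar>1 / \<eta>\<bar>)"
        by (simp add: abs_mult abs_divide)
      moreover have "2 * (Ck * k * (1 / l) * Ce) = 2 * Ck * Ce / l * k" by simp
      ultimately have t2: "\<bar>2 * fder (lapse c) x u * fder (height c) x u / \<eta>\<bar> \<le> 2 * Ck * Ce / l * k"
        by linarith
      \<comment> \<open>Of the two factors, one is bounded by the constant \<open>CT\<close> and the
        other through \<open>k\<close>, so the quadratic term also becomes linear in
        \<open>k\<close>.\<close>
      have "(fder (height c) x u)\<^sup>2 = \<bar>fder (height c) x u\<bar> * \<bar>fder (height c) x u\<bar>"
        by (simp add: power2_eq_square)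
      also have "\<dots> \<le> (CT * norm u) * (k * norm u)"
        using CT(2)[OF x, of u] Dk[of u] CT(1) by (intro mult_mono) auto
      also have "\<dots> = CT * k * (norm u)\<^sup>2" by (simp add: power2_eq_square)
      also have "\<dots> \<le> CT * k * (1 / l)" using ub[OF u] CT k0 by (intro mult_left_mono) auto
      finally have "\<bar>deriv \<rho> (height c x) / \<rho> (height c x)\<bar> * (fder (height c) x u)\<^sup>2 \<le> Cr * (CT * k * (1 / l))"
        using Cr[OF x] Cr0 by (intro mult_mono) auto
      then have t3: "\<bar>deriv \<rho> (height c x) / \<rho> (height c x) * (fder (height c) x u)\<^sup>2\<bar> \<le> Cr * CT / l * k"
        by (simp add: abs_mult mult.assoc)
      have "C2 * k = 3 / 2 * C1 / (l * l) * k + 2 * Ck * Ce / l * k + Cr * CT / l * k"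
        by (simp add: C2_def algebra_simps)
      then show ?thesis using t1 t2 t3 by linarith
    qed
    have finB: "finite B" using B(1) by (simp add: mf.orthonormal_def)
    have "(\<Sum>u\<in>B. - (C2 * k)) \<le> (\<Sum>u\<in>B. fder (\<lambda>y. fder (height c) y u) x u)"
      by (rule order_trans[OF sum_mono ineq]) (use low in \<open>simp add: \<eta>_def\<close>)
    then have "- (real DIM('e) * C2) * k \<le> (\<Sum>u\<in>B. fder (\<lambda>y. fder (height c) y u) x u)"
      using B(2) by simp
    moreover have "- C * k \<le> - (real DIM('e) * C2) * k"
      using k0 l by (intro mult_right_mono) (auto simp: C_def)
    ultimately have 1: "- C * k \<le> (\<Sum>u\<in>B. fder (\<lambda>y. fder (height c) y u) x u)" by linarith
    have "(\<Sum>u\<in>B. (norm u)\<^sup>2) \<le> (\<Sum>u\<in>B. 1 / l)" by (rule sum_mono) (rule ub)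
    also have "\<dots> = real DIM('e) * (1 / l)" using B(2) by simp
    also have "\<dots> \<le> C" using C20 by (simp add: C_def)
    finally have 2: "(\<Sum>u\<in>B. (norm u)\<^sup>2) \<le> C" .
    have 3: "(1 / L) * (norm \<xi>)\<^sup>2 \<le> (\<Sum>u\<in>B. (\<xi> \<bullet> u)\<^sup>2)" for \<xi>
      by (rule mf.orthonormal_elliptic[OF xU B l(2) lL(2)[OF x]])
    show ?thesis
      by (intro exI[of _ B] conjI allI finB 3 2 1[unfolded k_def])
  qed
  have all: "\<forall>x\<in>ball y r \<inter> cmap c ` cdom c. \<exists>B. finite B \<and>
        (\<forall>\<xi>. (1 / L) * (norm \<xi>)\<^sup>2 \<le> (\<Sum>u\<in>B. (\<xi> \<bullet> u)\<^sup>2)) \<and> (\<Sum>u\<in>B. (norm u)\<^sup>2) \<le> C \<and>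
        - C * onorm (fder (height c) x) \<le> (\<Sum>u\<in>B. fder (\<lambda>z. fder (height c) z u) x u)"
    by (rule ballI, rule main) auto
  have pos: "1 / L > 0" using l by simp
  show ?thesis
    by (rule exI[of _ r], rule conjI, rule r(1), rule exI[of _ "1 / L"], rule conjI, rule pos,
        rule exI[of _ C], rule all)
qed

text \<open>The set of maximum points is relatively closed by continuity and open by the strong
  maximum principle in a chart around each of its points; connectedness does the rest.\<close>

lemma height_constant:
  assumes N: "future_unit_normal M I P gbar \<psi> N" and conn: "connected (carrier M)"
    and \<rho>': "\<And>t. t \<in> I \<Longrightarrow> deriv \<rho> t \<ge> 0"
    and H: "\<And>p. p \<in> carrier M \<Longrightarrow>
      mean_curvature M PA gbar \<psi> N p \<ge> deriv \<rho> (fst (\<psi> p)) / (h (snd (\<psi> p)) * \<rho> (fst (\<psi> p)))"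
    and max: "p0 \<in> carrier M" "\<And>p. p \<in> carrier M \<Longrightarrow> fst (\<psi> p) \<le> fst (\<psi> p0)"
    and p: "p \<in> carrier M"
  shows "fst (\<psi> p) = fst (\<psi> p0)"
proof -
  define Z where "Z = {p \<in> carrier M. fst (\<psi> p) = fst (\<psi> p0)}"
  have "continuous_on (carrier M) (\<lambda>p. fst (\<psi> p))"
    by (intro continuous_intros psi.continuous_on_map)
  then have closed: "closedin (top_of_set (carrier M)) Z"
    unfolding Z_def by (rule continuous_closedin_preimage_constant)
  have "\<exists>W. open W \<and> p \<in> W \<and> W \<subseteq> Z" if "p \<in> Z" for p
  proof -
    have pM: "p \<in> carrier M" and eq: "fst (\<psi> p) = fst (\<psi> p0)" using that by (auto simp: Z_def)
    obtain c where c: "c \<in> M" "p \<in> cdom c" using pM by (auto simp: carrier_def)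
    have xU: "cmap c p \<in> cmap c ` cdom c" using c by blast
    have hp: "height c (cmap c p) = fst (\<psi> p0)" using psi.S.cinv_cmap[OF c] eq by simp
    have mx: "height c x \<le> height c (cmap c p)" if "x \<in> cmap c ` cdom c" for x
      unfolding hp using max(2)[of "cinv c x"] psi.S.cinv_in_cdom[OF that] psi.S.cdom_subset_carrier[OF c(1)]
      by auto
    obtain e where e: "e > 0" "ball (cmap c p) e \<subseteq> cmap c ` cdom c"
      "\<And>x. x \<in> ball (cmap c p) e \<Longrightarrow> height c x = height c (cmap c p)"
      using strong_maximum_principle[OF smooth_height_lapse(1)[OF c(1)] psi.S.open_cmap_image[OF c(1)]
          height_elliptic[OF N c(1) _ \<rho>' H] xU mx] by blast
    define W where "W = cdom c \<inter> cmap c -` ball (cmap c p) e"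
    have "open W"
      unfolding W_def
      by (rule continuous_open_preimage[OF psi.S.continuous_on_cmap[OF c(1)] psi.S.open_cdom[OF c(1)] open_ball])
    moreover have "p \<in> W" using c e by (simp add: W_def)
    moreover have "W \<subseteq> Z"
    proof
      fix w assume w: "w \<in> W"
      then have "height c (cmap c w) = fst (\<psi> p0)" using e(3)[of "cmap c w"] hp by (simp add: W_def)
      then show "w \<in> Z"
        using w psi.S.cinv_cmap[OF c(1)] psi.S.cdom_subset_carrier[OF c(1)] by (auto simp: W_def Z_def)
    qed
    ultimately show ?thesis by blast
  qed
  then have "open Z" by (subst open_subopen) blast
  then have "openin (top_of_set (carrier M)) Z"
    by (rule open_openin_trans[OF psi.S.open_carrier]) (auto simp: Z_def)
  with closed conn have "Z = {} \<or> Z = carrier M" by (simp add: connected_clopen)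
  moreover have "p0 \<in> Z" using max(1) by (simp add: Z_def)
  ultimately show ?thesis using p by (auto simp: Z_def)
qed

end

section \<open>Inverse functions and linear systems\<close>

text \<open>Continuity of the derivative in each direction is turned into continuity as an
  operator-valued map, which is componentwise in finite dimension. In equal dimensions injectivity
  at \<open>x\<close> supplies the inverse operator.\<close>

lemma inverse_function_smooth:
  fixes f :: "'e::euclidean_space \<Rightarrow> 'e"
  assumes f: "smooth_on S f" "open S" and x: "x \<in> S" and inj: "\<And>v. fder f x v = 0 \<Longrightarrow> v = 0"
  obtains U V g where "open U" "U \<subseteq> S" "x \<in> U" "open V" "homeomorphism U V f g"
    "\<And>y. y \<in> V \<Longrightarrow> (g has_derivative inv (fder f (g y))) (at y)"
    "\<And>y. y \<in> V \<Longrightarrow> bij (fder f (g y))"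
proof -
  define f' where "f' y = Blinfun (fder f y)" for y
  have d: "(f has_derivative fder f y) (at y)" if "y \<in> S" for y
    by (rule smooth_on_has_derivative[OF f(1) that])
  have f': "blinfun_apply (f' y) = fder f y" if "y \<in> S" for y
    unfolding f'_def by (rule bounded_linear_Blinfun_apply[OF has_derivative_bounded_linear[OF d[OF that]]])
  have "continuous_on S f'"
  proof (rule continuous_on_blinfun_componentwise)
    fix i :: 'e
    have "continuous_on S (\<lambda>y. fder f y i)"
      by (rule smooth_on_imp_continuous_on[OF smooth_on_fder[OF f]])
    then show "continuous_on S (\<lambda>y. blinfun_apply (f' y) i)"
      using f' by (simp cong: continuous_on_cong)
  qed
  have lin: "linear (fder f x)" by (rule has_derivative_linear[OF d[OF x]])
  then have "inj (fder f x)" using inj linear_injective_0 by blast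
  then obtain k where k: "linear k" "k \<circ> fder f x = id"
    using linear_injective_left_inverse[OF lin] by blast
  have "Blinfun k o\<^sub>L f' x = id_blinfun"
    by (rule blinfun_eqI)
      (use fun_cong[OF k(2)] in \<open>simp add: f'[OF x] bounded_linear_Blinfun_apply[OF linear_linear[THEN iffD2, OF k(1)]]\<close>)
  from inverse_function_theorem[OF f(2) _ \<open>continuous_on S f'\<close> x this]
  obtain U V g g' where "open U" "U \<subseteq> S" "x \<in> U" "open V" "f x \<in> V" and hom: "homeomorphism U V f g"
    and g: "\<And>y. y \<in> V \<Longrightarrow> (g has_derivative (g' y)) (at y)"
      "\<And>y. y \<in> V \<Longrightarrow> g' y = inv (blinfun_apply (f'(g y)))"
      "\<And>y. y \<in> V \<Longrightarrow> bij (blinfun_apply (f'(g y)))"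
    using f' d by metis
  have "g y \<in> S" if "y \<in> V" for y
    using hom that \<open>U \<subseteq> S\<close> unfolding homeomorphism_def by blast
  then show ?thesis
    using that[OF \<open>open U\<close> \<open>U \<subseteq> S\<close> \<open>x \<in> U\<close> \<open>open V\<close> hom] g f' by simp
qed

text \<open>Near \<open>x0\<close> the operator \<open>A x\<close> stays bounded below by half the
  constant of \<open>A x0\<close>, so \<open>D x - D x0\<close> is controlled by
  \<open>A x (D x0) - A x0 (D x0)\<close>. It yields continuity of the velocity of a lift, which
  solves such a system.\<close>

lemma continuous_on_linear_solution:
  fixes A :: "'x::t2_space \<Rightarrow> 'e::euclidean_space \<Rightarrow> 'e"
  assumes lin: "\<And>x. x \<in> X \<Longrightarrow> linear (A x)" and inj: "\<And>x v. x \<in> X \<Longrightarrow> A x v = 0 \<Longrightarrow> v = 0"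
    and cont: "\<And>v. continuous_on X (\<lambda>x. A x v)" and D: "\<And>x. x \<in> X \<Longrightarrow> A x (D x) = w"
  shows "continuous_on X D"
  unfolding continuous_on_def
proof
  fix x0 assume x0: "x0 \<in> X"
  have "inj (A x0)" using linear_injective_0[OF lin[OF x0]] inj[OF x0] by blast
  then obtain k where k: "k > 0" "\<And>v. k * norm v \<le> norm (A x0 v)"
    using linear_inj_bounded_below_pos[OF lin[OF x0]] by blast
  have lim: "((\<lambda>x. A x v) \<longlongrightarrow> A x0 v) (at x0 within X)" for v
    using cont[of v] x0 by (simp add: continuous_on_def)
  have "((\<lambda>x. \<Sum>b\<in>Basis. norm (A x b - A x0 b)) \<longlongrightarrow> (\<Sum>b\<in>Basis. norm (A x0 b - A x0 b))) (at x0 within X)"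
    by (intro tendsto_intros lim)
  then have "eventually (\<lambda>x. (\<Sum>b\<in>Basis. norm (A x b - A x0 b)) < k / 2) (at x0 within X)"
    using k(1) by (intro order_tendstoD(2)) auto
  moreover have "eventually (\<lambda>x. x \<in> X) (at x0 within X)"
    by (simp add: eventually_at_filter)
  ultimately have "eventually (\<lambda>x. norm (D x - D x0) \<le> 2 / k * norm (A x (D x0) - A x0 (D x0))) (at x0 within X)"
  proof eventually_elim
    case (elim x)
    define v where "v = D x - D x0"
    have "A x v - A x0 v = (\<Sum>b\<in>Basis. (v \<bullet> b) *\<^sub>R (A x b - A x0 b))"
      using linear_basis_expansion[OF lin[OF elim(2)], of v] linear_basis_expansion[OF lin[OF x0], of v]
      by (simp add: sum_subtractf scaleR_diff_right)
    then have "norm (A x v - A x0 v) \<le> (\<Sum>b\<in>Basis. norm ((v \<bullet> b) *\<^sub>R (A x b - A x0 b)))"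
      by (simp only: norm_sum)
    also have "\<dots> \<le> (\<Sum>b\<in>Basis. norm v * norm (A x b - A x0 b))"
      by (rule sum_mono) (auto intro!: mult_right_mono Basis_le_norm)
    also have "\<dots> = norm v * (\<Sum>b\<in>Basis. norm (A x b - A x0 b))" by (simp add: sum_distrib_left)
    also have "\<dots> \<le> norm v * (k / 2)" using elim(1) by (intro mult_left_mono) auto
    finally have 1: "norm (A x v - A x0 v) \<le> k / 2 * norm v" by (simp add: mult.commute)
    have "norm (A x0 v) \<le> norm (A x v) + norm (A x v - A x0 v)"
      using norm_triangle_ineq4[of "A x v" "A x v - A x0 v"] by simp
    then have "k / 2 * norm v \<le> norm (A x v)" using 1 k(2)[of v] by (simp add: field_simps)
    moreover have "A x v = A x0 (D x0) - A x (D x0)"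
      by (simp add: v_def linear_diff[OF lin[OF elim(2)]] D[OF elim(2)] D[OF x0])
    ultimately show ?case using k(1) unfolding v_def by (simp add: field_simps norm_minus_commute)
  qed
  moreover have "((\<lambda>x. 2 / k * norm (A x (D x0) - A x0 (D x0))) \<longlongrightarrow> 2 / k * norm (A x0 (D x0) - A x0 (D x0))) (at x0 within X)"
    by (intro tendsto_intros lim)
  ultimately have "((\<lambda>x. D x - D x0) \<longlongrightarrow> 0) (at x0 within X)"
    by (intro Lim_null_comparison[of "\<lambda>x. D x - D x0"]) auto
  then show "(D \<longlongrightarrow> D x0) (at x0 within X)" by (simp add: LIM_zero_iff)
qed

section \<open>Length of curves and the topology of the Riemannian distance\<close>

text \<open>The derivative of a piecewise $C^1$ path need not be bounded near the exceptional points, so the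
  right-hand side may be infinite.\<close>

lemma norm_diff_le_nn_integral:
  fixes f :: "real \<Rightarrow> 'e::euclidean_space"
  assumes ab: "a \<le> b" and S: "finite S" and cont: "continuous_on {a..b} f"
    and f: "\<And>t. t \<in> {a..b} - S \<Longrightarrow> (f has_vector_derivative D t) (at t)"
    and D: "continuous_on ({a..b} - S) D"
  shows "ennreal (norm (f b - f a)) \<le> (\<integral>\<^sup>+t. ennreal (norm (D t)) * indicator ({a..b} - S) t \<partial>lborel)"
proof (cases "(\<integral>\<^sup>+t. ennreal (norm (D t)) * indicator ({a..b} - S) t \<partial>lborel) < \<infinity>")
  case True
  define E where "E t = indicator ({a..b} - S) t *\<^sub>R D t" for t
  have nE: "ennreal (norm (E t)) = ennreal (norm (D t)) * indicator ({a..b} - S) t" for t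
    by (simp add: E_def indicator_def)
  have "E \<in> borel_measurable borel"
    unfolding E_def
    by (rule borel_measurable_continuous_on_indicator[OF _ D]) (simp add: S sets.Diff finite_imp_closed borel_closed)
  then have "integrable lborel E"
    using True by (intro integrableI_bounded) (simp_all add: nE)
  then have int: "(E has_integral (integral\<^sup>L lborel E)) UNIV"
    and le: "ennreal (norm (integral\<^sup>L lborel E)) \<le> (\<integral>\<^sup>+t. ennreal (norm (E t)) \<partial>lborel)"
    by (rule has_integral_integral_lborel, rule integral_norm_bound_ennreal)
  \<comment> \<open>The fundamental theorem gives the gauge integral of \<open>D\<close> with no
    bound on \<open>D\<close>. Finiteness of the right-hand side made \<open>E\<close> Lebesgue
    integrable, and the two integrals agree.\<close>
  have "(D has_integral (f b - f a)) {a..b}"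
    by (rule fundamental_theorem_of_calculus_strong[OF S ab f cont])
  then have "(E has_integral (f b - f a)) {a..b}"
    by (rule has_integral_spike_finite[OF S, rotated]) (simp add: E_def)
  moreover have "(E has_integral (integral\<^sup>L lborel E)) {a..b}"
  proof -
    have "E = (\<lambda>t. if t \<in> {a..b} then E t else 0)" by (auto simp: E_def indicator_def)
    then show ?thesis using int has_integral_restrict_UNIV[of "{a..b}" E] by simp
  qed
  ultimately have "f b - f a = integral\<^sup>L lborel E" by (rule has_integral_unique)
  then show ?thesis using le by (simp add: nE)
next
  case False
  then show ?thesis by (simp add: not_less top_unique)
qed

context smooth_mfd
begin

lemma velocity_coord_vec:
  assumes c: "c \<in> A" and J: "open J" "t \<in> J" "\<gamma> ` J \<subseteq> cdom c"
    and W: "((cmap c \<circ> \<gamma>) has_vector_derivative W) (at t)"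
  shows "velocity A \<gamma> t = coord_vec A c (\<gamma> t) W"
proof
  fix f
  show "velocity A \<gamma> t f = coord_vec A c (\<gamma> t) W f"
  proof (cases "smooth_near A (\<gamma> t) f")
    case True
    have gt: "\<gamma> t \<in> cdom c" using J by auto
    let ?L = "fder (f \<circ> cinv c) (cmap c (\<gamma> t))"
    note d = smooth_near_has_derivative[OF True c gt]
    have "((\<lambda>s. (f \<circ> cinv c) ((cmap c \<circ> \<gamma>) s)) has_derivative (\<lambda>s. ?L (s *\<^sub>R W))) (at t)"
      by (rule has_derivative_compose[OF W[unfolded has_vector_derivative_def]]) (subst comp_apply, rule d)
    then have "((f \<circ> \<gamma>) has_derivative (\<lambda>s. ?L (s *\<^sub>R W))) (at t)"
      by (rule has_derivative_transform_within_open[OF _ J(1,2)]) (use J(3) cinv_cmap[OF c] in auto)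
    moreover have "(\<lambda>s. ?L (s *\<^sub>R W)) = (*) (?L W)"
      by (rule ext) (simp add: linear_cmul[OF has_derivative_linear[OF d]] mult.commute)
    ultimately have "((f \<circ> \<gamma>) has_real_derivative ?L W) (at t)"
      by (simp add: has_field_derivative_def)
    then show ?thesis using True by (simp add: velocity_def coord_vec_def DERIV_imp_deriv)
  qed (simp add: velocity_def coord_vec_def)
qed

lemma metric_zero_vector:
  assumes g: "riemannian_metric A g" and p: "p \<in> carrier A"
  shows "g p (\<lambda>f. 0) (\<lambda>f. 0) = 0"
proof -
  obtain c where c: "c \<in> A" "p \<in> cdom c" using p by (auto simp: carrier_def)
  interpret metric_form "cmap c ` cdom c" "metric_coord A g c" by (rule metric_form_metric_coord[OF g c(1)])
  have "cmap c p \<in> cmap c ` cdom c" using c by blast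
  then have "metric_coord A g c (cmap c p) 0 0 = 0" using linear_0[OF linear_G(1)] by blast
  moreover have "coord_vec A c p 0 = (\<lambda>f. 0)"
    using coord_vec_lincomb[OF c, of 0 0 0 0] by simp
  ultimately show ?thesis by (simp add: metric_coord_def cinv_cmap[OF c])
qed

lemma riemannian_dist_le:
  assumes "piecewise_C1_curve A \<gamma>" "pathstart \<gamma> = p" "pathfinish \<gamma> = q" "curve_length A g \<gamma> \<le> L"
  shows "riemannian_dist A g p q \<le> L"
  unfolding riemannian_dist_def using assms by (intro INF_lower2[of \<gamma>]) auto

lemma riemannian_dist_self:
  assumes g: "riemannian_metric A g" and p: "p \<in> carrier A"
  shows "riemannian_dist A g p p = 0"
proof -
  have "piecewise_C1_curve A (\<lambda>s. p)"
    unfolding piecewise_C1_curve_def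
  proof (intro conjI ballI allI impI)
    show "cmap c \<circ> (\<lambda>s. p) piecewise_C1_differentiable_on {a..b}" for c :: "('a, 'e) chart" and a b
      by (simp add: comp_def C1_differentiable_imp_piecewise)
  qed (use p in \<open>auto simp: path_def path_image_def\<close>)
  moreover have "velocity A (\<lambda>s. p) s = (\<lambda>f. 0)" for s
    by (rule ext) (simp add: velocity_def comp_def)
  then have "curve_length A g (\<lambda>s. p) = 0"
    by (simp add: curve_length_def metric_zero_vector[OF g p])
  ultimately have "riemannian_dist A g p p \<le> 0"
    by (intro riemannian_dist_le[of "\<lambda>s. p"]) (auto simp: pathstart_def pathfinish_def)
  then show ?thesis by simp
qed

text \<open>A curve from outside a coordinate ball to its centre is at least as long, up to a constant, as
  the Euclidean radius: consider its part after the last visit outside.\<close>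

lemma riemannian_dist_small_imp_near:
  assumes g: "riemannian_metric A g" and U: "open U" "p \<in> U" and p: "p \<in> carrier A"
  shows "\<exists>\<epsilon>>0. \<forall>q. riemannian_dist A g q p < ennreal \<epsilon> \<longrightarrow> q \<in> U"
proof -
  obtain c where c: "c \<in> A" "p \<in> cdom c" using p by (auto simp: carrier_def)
  interpret m: metric_form "cmap c ` cdom c" "metric_coord A g c" by (rule metric_form_metric_coord[OF g c(1)])
  define x0 where "x0 = cmap c p"
  have "x0 \<in> cmap c ` (cdom c \<inter> U)" using c U by (auto simp: x0_def)
  then obtain r where r: "r > 0" "cball x0 r \<subseteq> cmap c ` (cdom c \<inter> U)"
    using open_cmap_image_Int[OF c(1) U(1)] open_contains_cball by blast
  then have r': "cball x0 r \<subseteq> cmap c ` cdom c" by blast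
  obtain l where l: "l > 0" "\<And>x v. x \<in> cball x0 r \<Longrightarrow> l * (norm v)\<^sup>2 \<le> metric_coord A g c x v v"
    using m.G_bounds[OF compact_cball r'] by blast
  define K where "K = cinv c ` cball x0 r"
  have "compact K"
    unfolding K_def
    by (rule compact_continuous_image[OF continuous_on_subset[OF continuous_on_cinv[OF c(1)] r'] compact_cball])
  then have "closed K" by (rule compact_imp_closed)
  have K: "q \<in> cdom c \<and> cmap c q \<in> cball x0 r" if "q \<in> K" for q
  proof -
    obtain x where x: "x \<in> cball x0 r" "q = cinv c x"
      using \<open>q \<in> K\<close> unfolding K_def by blast
    then have "x \<in> cmap c ` cdom c" using r' by blast
    then show ?thesis using x cinv_in_cdom cmap_cinv[OF c(1)] by metis
  qed
  have KU: "q \<in> U" if "q \<in> K" for q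
  proof -
    obtain x where x: "x \<in> cball x0 r" "q = cinv c x"
      using \<open>q \<in> K\<close> unfolding K_def by blast
    then have "q \<in> cdom c \<inter> U" using cinv_in[OF c(1), of "cdom c \<inter> U" x] r by blast
    then show ?thesis by blast
  qed
  define O' where "O' = cdom c \<inter> cmap c -` ball x0 r"
  have openO: "open O'"
    unfolding O'_def by (rule continuous_open_preimage[OF continuous_on_cmap[OF c(1)] open_cdom[OF c(1)] open_ball])
  have OK: "O' \<subseteq> K"
  proof
    fix q assume "q \<in> O'"
    then have "q = cinv c (cmap c q)" "cmap c q \<in> cball x0 r" using cinv_cmap[OF c(1)] by (auto simp: O'_def)
    then show "q \<in> K" unfolding K_def by blast
  qed
  have pO: "p \<in> O'" using c r by (simp add: O'_def x0_def)
  have "q \<in> U" if q: "riemannian_dist A g q p < ennreal (sqrt l * r)" for q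
  proof (rule ccontr)
    assume "q \<notin> U"
    obtain \<gamma> where \<gamma>: "piecewise_C1_curve A \<gamma>" "pathstart \<gamma> = q" "pathfinish \<gamma> = p"
      "curve_length A g \<gamma> < ennreal (sqrt l * r)"
      using q unfolding riemannian_dist_def INF_less_iff by blast
    have cont: "continuous_on {0..1} \<gamma>" using \<gamma>(1) by (simp add: piecewise_C1_curve_def path_def)
    define Z where "Z = {0..1} \<inter> \<gamma> -` (- O')"
    have "closed Z" unfolding Z_def
      by (rule continuous_closed_preimage[OF cont]) (use openO in auto)
    moreover have "Z \<inter> {0..1} = Z" by (auto simp: Z_def)
    ultimately have "compact Z" by (metis closed_Int_compact compact_Icc)
    have "\<gamma> 0 \<notin> O'" using \<gamma>(2) \<open>q \<notin> U\<close> OK KU by (auto simp: pathstart_def)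
    then have "0 \<in> Z" by (simp add: Z_def)
    then obtain t1 where t1: "t1 \<in> Z" "\<And>t. t \<in> Z \<Longrightarrow> t \<le> t1"
      using compact_attains_sup[of Z] \<open>compact Z\<close> by blast
    have g1: "\<gamma> 1 = p" using \<gamma>(3) by (simp add: pathfinish_def)
    then have t1b: "0 \<le> t1" "t1 < 1" using t1(1) pO by (auto simp: Z_def less_le)
    have after: "\<gamma> t \<in> O'" if "t1 < t" "t \<le> 1" for t
      using t1(2)[of t] that t1b by (force simp: Z_def)
    \<comment> \<open>After \<open>t1\<close> the curve lies in \<open>O'\<close>, hence in the
      closed set \<open>K\<close>; passing to the limit keeps \<open>\<gamma> t1\<close> in the
      chart domain although it is outside \<open>O'\<close>.\<close>
    have "\<gamma> t1 \<in> K"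
    proof -
      have "closure {t1<..1} \<subseteq> \<gamma> -` K \<inter> {0..1}"
      proof (rule closure_minimal)
        show "{t1<..1} \<subseteq> \<gamma> -` K \<inter> {0..1}"
          using subsetD[OF OK after] t1b by auto
        show "closed (\<gamma> -` K \<inter> {0..1})"
          using continuous_closed_preimage[OF cont _ \<open>closed K\<close>] by (simp add: Int_commute)
      qed
      moreover have "t1 \<in> closure {t1<..1}" using t1b by (simp add: closure_greaterThanAtMost)
      ultimately show ?thesis by blast
    qed
    have inc: "\<gamma> t \<in> cdom c" "cmap c (\<gamma> t) \<in> cball x0 r" if "t \<in> {t1..1}" for t
    proof -
      have "\<gamma> t \<in> K" using that \<open>\<gamma> t1 \<in> K\<close> after[of t] OK by (cases "t = t1") auto
      from K[OF this] show "\<gamma> t \<in> cdom c" "cmap c (\<gamma> t) \<in> cball x0 r" by auto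
    qed
    have far: "r \<le> norm (cmap c (\<gamma> 1) - cmap c (\<gamma> t1))"
    proof -
      have "\<gamma> t1 \<notin> O'" using t1(1) by (simp add: Z_def)
      then have "r \<le> dist x0 (cmap c (\<gamma> t1))" using inc(1)[of t1] t1b by (simp add: O'_def)
      then show ?thesis by (simp add: g1 x0_def dist_norm)
    qed
    have "(cmap c \<circ> \<gamma>) piecewise_C1_differentiable_on {t1..1}"
      using \<gamma>(1) c(1) inc(1) t1b unfolding piecewise_C1_curve_def
      by (metis atLeastatMost_subset_iff image_subsetI order_refl)
    then obtain S D where S: "finite S" and cc: "continuous_on {t1..1} (cmap c \<circ> \<gamma>)"
      and D: "\<And>t. t \<in> {t1..1} - S \<Longrightarrow> ((cmap c \<circ> \<gamma>) has_vector_derivative D t) (at t)"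
        "continuous_on ({t1..1} - S) D"
      unfolding piecewise_C1_differentiable_on_def C1_differentiable_on_def by blast
    \<comment> \<open>The end points are added to the exceptional set so that around each remaining
      parameter the curve stays in the chart, as \<open>velocity_coord_vec\<close> demands.\<close>
    define S' where "S' = S \<union> {t1, 1}"
    have "ennreal (norm ((cmap c \<circ> \<gamma>) 1 - (cmap c \<circ> \<gamma>) t1))
        \<le> (\<integral>\<^sup>+t. ennreal (norm (D t)) * indicator ({t1..1} - S') t \<partial>lborel)"
    proof (rule norm_diff_le_nn_integral[OF _ _ cc])
      show "continuous_on ({t1..1} - S') D" by (rule continuous_on_subset[OF D(2)]) (auto simp: S'_def)
    qed (use t1b S D(1) in \<open>auto simp: S'_def\<close>)
    then have "ennreal r \<le> (\<integral>\<^sup>+t. ennreal (norm (D t)) * indicator ({t1..1} - S') t \<partial>lborel)"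
      using far by (metis (no_types, lifting) comp_apply ennreal_leI order_trans)
    then have "ennreal (sqrt l) * ennreal r \<le>
        ennreal (sqrt l) * (\<integral>\<^sup>+t. ennreal (norm (D t)) * indicator ({t1..1} - S') t \<partial>lborel)"
      by (rule mult_left_mono) simp
    also have "\<dots> = (\<integral>\<^sup>+t. ennreal (sqrt l) * (ennreal (norm (D t)) * indicator ({t1..1} - S') t) \<partial>lborel)"
    proof (rule nn_integral_cmult[symmetric])
      define E where "E t = indicator ({t1..1} - S') t *\<^sub>R D t" for t
      have m: "E \<in> borel_measurable borel"
        unfolding E_def
        by (rule borel_measurable_continuous_on_indicator[OF _ continuous_on_subset[OF D(2)]])
          (auto simp: S'_def S sets.Diff finite_imp_closed borel_closed)
      have "(\<lambda>t. ennreal (norm (E t))) \<in> borel_measurable borel" using m by measurable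
      moreover have "ennreal (norm (E t)) = ennreal (norm (D t)) * indicator ({t1..1} - S') t" for t
        by (simp add: E_def indicator_def)
      ultimately show "(\<lambda>t. ennreal (norm (D t)) * indicator ({t1..1} - S') t) \<in> borel_measurable lborel"
        by simp
    qed
    also have "\<dots> \<le> curve_length A g \<gamma>"
      unfolding curve_length_def
    proof (rule nn_integral_mono)
      fix t
      show "ennreal (sqrt l) * (ennreal (norm (D t)) * indicator ({t1..1} - S') t)
        \<le> ennreal (sqrt (g (\<gamma> t) (velocity A \<gamma> t) (velocity A \<gamma> t))) * indicator {0..1} t"
      proof (cases "t \<in> {t1..1} - S'")
        case True
        have J: "\<gamma> ` {t1<..<1} \<subseteq> cdom c" using inc(1) by auto
        have tJ: "t \<in> {t1<..<1}" using True by (auto simp: S'_def)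
        have "((cmap c \<circ> \<gamma>) has_vector_derivative D t) (at t)" using True by (intro D(1)) (auto simp: S'_def)
        note vel = velocity_coord_vec[OF c(1) open_greaterThanLessThan tJ J this]
        have tt: "t \<in> {t1..1}" using True by simp
        have "sqrt (l * (norm (D t))\<^sup>2) \<le> sqrt (metric_coord A g c (cmap c (\<gamma> t)) (D t) (D t))"
          by (rule real_sqrt_le_mono) (rule l(2)[OF inc(2)[OF tt]])
        then have "sqrt l * norm (D t) \<le> sqrt (g (\<gamma> t) (velocity A \<gamma> t) (velocity A \<gamma> t))"
          by (simp add: vel metric_coord_def cinv_cmap[OF c(1) inc(1)[OF tt]] real_sqrt_mult)
        then show ?thesis
          using True t1b l(1) by (simp add: ennreal_mult[symmetric] ennreal_leI)
      qed simp
    qed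
    also have "\<dots> < ennreal (sqrt l * r)" by (rule \<gamma>(4))
    finally show False using l r by (simp add: ennreal_mult)
  qed
  then show ?thesis using l(1) r(1) by (intro exI[of _ "sqrt l * r"]) auto
qed

end

section \<open>Hypersurfaces of constant height\<close>

locale slice_hypersurface = hypersurface P I h \<rho> \<sigma> M \<psi>
  for P :: "('p::{t2_space, second_countable_topology}, 'e::euclidean_space) atlas"
    and I :: "real set" and h :: "'p \<Rightarrow> real" and \<rho> :: "real \<Rightarrow> real" and \<sigma> :: "'p metric_field"
    and M :: "('a::{t2_space, second_countable_topology}, 'e) atlas"
    and \<psi> :: "'a \<Rightarrow> real \<times> 'p" +
  fixes t0 :: real
  assumes height0: "\<And>p. p \<in> carrier M \<Longrightarrow> fst (\<psi> p) = t0"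
    and t0: "t0 \<in> I"
begin

abbreviation phi :: "'a \<Rightarrow> 'p" where "phi \<equiv> snd \<circ> \<psi>"

lemma vimage_phi: "c \<in> M \<Longrightarrow> cdom c \<inter> phi -` cdom d = cdom c \<inter> \<psi> -` cdom (product_chart I d)"
  using psi_in(1) psi.S.cdom_subset_carrier[of c] by (auto simp: cdom_product_chart mem_Times_iff subset_iff)

lemma phi_rep: "cmap d \<circ> phi \<circ> cinv c = (\<lambda>y. snd (rep c d y))"
  by (simp add: fun_eq_iff cmap_product_chart)

sublocale ph: smooth_mfd_map M P phi
proof (unfold_locales, unfold smooth_map_def, intro conjI ballI)
  show "phi ` carrier M \<subseteq> carrier P" using psi_in(2) by auto
  show "continuous_on (carrier M) phi"
    unfolding comp_def by (intro continuous_intros psi.continuous_on_map)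
  show "smooth_on (cmap c ` (cdom c \<inter> phi -` cdom d)) (cmap d \<circ> phi \<circ> cinv c)" if "c \<in> M" "d \<in> P" for c d
    unfolding vimage_phi[OF that(1)] phi_rep
    by (rule smooth_on_bounded_linear_compose[OF bounded_linear_snd smooth_rep[OF that]])
qed

abbreviation Phi :: "('a, 'e) chart \<Rightarrow> ('p, 'e) chart \<Rightarrow> 'e \<Rightarrow> 'e" where
  "Phi c d \<equiv> cmap d \<circ> phi \<circ> cinv c"

abbreviation Phi_dom :: "('a, 'e) chart \<Rightarrow> ('p, 'e) chart \<Rightarrow> 'e set" where
  "Phi_dom c d \<equiv> cmap c ` (cdom c \<inter> phi -` cdom d)"

text \<open>The lapse term disappears with the derivative of the constant height, so
  \<open>phi\<close> is a local homothety with constant factor \<open>\<rho> t0\<close>.\<close>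

lemma metric_coord_Phi:
  assumes c: "c \<in> M" and d: "d \<in> P" and y: "y \<in> Phi_dom c d"
  shows "metric_coord M g c y v w =
    (\<rho> t0)\<^sup>2 * metric_coord P \<sigma> d (Phi c d y) (fder (Phi c d) y v) (fder (Phi c d) y w)"
proof -
  have y': "y \<in> rep_dom c d" using y by (simp add: vimage_phi[OF c])
  note dr = smooth_on_has_derivative[OF smooth_rep[OF c d] y']
  have ht: "fst (rep c d x) = t0" if "x \<in> rep_dom c d" for x
    using height0 cinv_rep_dom(1)[OF c that] psi.S.cdom_subset_carrier[OF c]
    by (auto simp: cmap_product_chart)
  have "fder (\<lambda>x. fst (rep c d x)) y = fder (\<lambda>x. t0) y"
    by (rule fder_cong[OF open_rep_dom[OF c d] y' ht])
  then have "fst (fder (rep c d) y v) = 0" for v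
    using fder_eqI[OF has_derivative_fst[OF dr]] by (metis frechet_derivative_const)
  moreover have "snd (fder (rep c d) y v) = fder (Phi c d) y v" for v
    unfolding phi_rep fder_eqI[OF has_derivative_snd[OF dr]] ..
  ultimately show ?thesis
    using ht[OF y'] unfolding metric_coord_rep[OF c d y'] warped_form_def by (simp add: cmap_product_chart)
qed

lemma Phi_in: "c \<in> M \<Longrightarrow> y \<in> Phi_dom c d \<Longrightarrow> Phi c d y \<in> cmap d ` cdom d"
  using psi.S.cinv_cmap by auto

text \<open>By the homothety, a kernel vector has zero length in the induced Riemannian
  metric.\<close>

lemma fder_Phi_inj:
  assumes c: "c \<in> M" and d: "d \<in> P" and y: "y \<in> Phi_dom c d" and v: "fder (Phi c d) y v = 0"
  shows "v = 0"
proof (rule ccontr)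
  assume "v \<noteq> 0"
  interpret m: metric_form "cmap c ` cdom c" "metric_coord M g c" by (rule metric_form_g[OF c])
  interpret s: metric_form "cmap d ` cdom d" "metric_coord P \<sigma> d" by (rule metric_form_base[OF d])
  have "metric_coord M g c y v v > 0" using y by (intro m.pos_G \<open>v \<noteq> 0\<close>) auto
  then show False
    unfolding metric_coord_Phi[OF c d y] v
    using linear_0[OF s.linear_G(1)[OF Phi_in[OF c y]]] by simp
qed

text \<open>Packages the inverse function theorem without charts of \<open>M\<close>:
  \<open>k\<close> is a continuous section of \<open>phi\<close> over \<open>V\<close>. It serves
  both to extend lifts and to show that the image of \<open>phi\<close> is open.\<close>

lemma local_inverse:
  assumes p: "p \<in> carrier M" and d: "d \<in> P" "phi p \<in> cdom d"
  obtains U V k where "open U" "p \<in> U" "U \<subseteq> carrier M" "open V" "phi p \<in> V" "V \<subseteq> cdom d"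
    "continuous_on V k" "\<And>v. v \<in> V \<Longrightarrow> k v \<in> U \<and> phi (k v) = v"
    "\<And>u. u \<in> U \<Longrightarrow> phi u \<in> V \<and> k (phi u) = u"
proof -
  obtain c where c: "c \<in> M" "p \<in> cdom c" using p by (auto simp: carrier_def)
  have cp: "cmap c p \<in> Phi_dom c d" using c d by auto
  obtain U0 V0 g0 where U0: "open U0" "U0 \<subseteq> Phi_dom c d" "cmap c p \<in> U0" and V0: "open V0"
    and hom: "homeomorphism U0 V0 (Phi c d) g0"
    by (rule inverse_function_smooth[OF ph.smooth_on_rep[OF c(1) d(1)] ph.open_rep_dom[OF c(1) d(1)] cp
        fder_Phi_inj[OF c(1) d(1) cp]], assumption) (rule that)
  define U where "U = cdom c \<inter> cmap c -` U0"
  define V where "V = cdom d \<inter> cmap d -` V0"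
  define k where "k v = cinv c (g0 (cmap d v))" for v
  have g0: "g0 y \<in> U0" "Phi c d (g0 y) = y" if "y \<in> V0" for y
    using hom that unfolding homeomorphism_def by auto
  have P0: "Phi c d x \<in> V0" "g0 (Phi c d x) = x" if "x \<in> U0" for x
    using hom that unfolding homeomorphism_def by auto
  have Ud: "phi u \<in> cdom d" if "u \<in> U" for u
  proof -
    obtain u' where "u' \<in> cdom c" "phi u' \<in> cdom d" "cmap c u = cmap c u'"
      using \<open>u \<in> U\<close> U0(2) unfolding U_def by blast
    moreover from this have "u = u'" using that psi.S.cinv_cmap[OF c(1)] unfolding U_def by (metis IntD1)
    ultimately show ?thesis by simp
  qed
  have U: "phi u \<in> V \<and> k (phi u) = u" if "u \<in> U" for u
  proof -
    have u: "u \<in> cdom c" "cmap c u \<in> U0" using that by (auto simp: U_def)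
    have "Phi c d (cmap c u) = cmap d (phi u)" using psi.S.cinv_cmap[OF c(1) u(1)] by simp
    then show ?thesis
      using P0[OF u(2)] Ud[OF that] psi.S.cinv_cmap[OF c(1) u(1)] by (simp add: V_def k_def)
  qed
  have V: "k v \<in> U \<and> phi (k v) = v" if "v \<in> V" for v
  proof -
    have v: "v \<in> cdom d" "cmap d v \<in> V0" using that by (auto simp: V_def)
    have gU: "g0 (cmap d v) \<in> U0" by (rule g0(1)[OF v(2)])
    then have "g0 (cmap d v) \<in> cmap c ` cdom c" using U0(2) by blast
    then have cc: "k v \<in> cdom c" "cmap c (k v) = g0 (cmap d v)"
      unfolding k_def by (rule psi.S.cinv_in_cdom, rule psi.S.cmap_cinv[OF c(1)])
    then have kU: "k v \<in> U" using gU by (simp add: U_def)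
    have "cmap d (phi (k v)) = cmap d v"
      using g0(2)[OF v(2)] by (simp add: k_def)
    then have "phi (k v) = v"
      using P.cinv_cmap[OF d(1) Ud[OF kU]] P.cinv_cmap[OF d(1) v(1)] by metis
    with kU show ?thesis by simp
  qed
  have "open U" unfolding U_def
    by (rule continuous_open_preimage[OF psi.S.continuous_on_cmap[OF c(1)] psi.S.open_cdom[OF c(1)] U0(1)])
  moreover have "open V" unfolding V_def
    by (rule continuous_open_preimage[OF P.continuous_on_cmap[OF d(1)] P.open_cdom[OF d(1)] V0])
  moreover have pU: "p \<in> U" using c U0 by (simp add: U_def)
  moreover have "U \<subseteq> carrier M" using psi.S.cdom_subset_carrier[OF c(1)] by (auto simp: U_def)
  moreover have "continuous_on V k"
    unfolding k_def
  proof (rule continuous_on_compose2[OF psi.S.continuous_on_cinv[OF c(1)]])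
    show "continuous_on V (\<lambda>v. g0 (cmap d v))"
      by (rule continuous_on_compose2[of V0 g0])
        (use hom in \<open>auto simp: homeomorphism_def V_def intro: continuous_on_subset[OF P.continuous_on_cmap[OF d(1)]]\<close>)
    show "(\<lambda>v. g0 (cmap d v)) ` V \<subseteq> cmap c ` cdom c"
      using g0(1) U0(2) by (fastforce simp: V_def)
  qed
  moreover have "V \<subseteq> cdom d" by (auto simp: V_def)
  ultimately show ?thesis using U[OF pU] that[of U V k] U V by blast
qed

end

subsection \<open>Lifting coordinate segments\<close>

text \<open>A straight segment in one chart of the Riemannian factor. The factor
  \<open>(\<rho> t0)\<^sup>2\<close> is that of the homothety, so \<open>C\<close> bounds the speed
  of every lift to \<open>M\<close>.\<close>

locale segment = slice_hypersurface P I h \<rho> \<sigma> M \<psi> t0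
  for P :: "('p::{t2_space, second_countable_topology}, 'e::euclidean_space) atlas"
    and I :: "real set" and h :: "'p \<Rightarrow> real" and \<rho> :: "real \<Rightarrow> real" and \<sigma> :: "'p metric_field"
    and M :: "('a::{t2_space, second_countable_topology}, 'e) atlas"
    and \<psi> :: "'a \<Rightarrow> real \<times> 'p" and t0 :: real +
  fixes d :: "('p, 'e) chart" and a b :: 'e and C :: real
  assumes d: "d \<in> P"
    and seg: "\<And>s. s \<in> {0..1} \<Longrightarrow> a + s *\<^sub>R (b - a) \<in> cmap d ` cdom d"
    and C: "C \<ge> 0"
    and speed: "\<And>s. s \<in> {0..1} \<Longrightarrow> (\<rho> t0)\<^sup>2 * metric_coord P \<sigma> d (a + s *\<^sub>R (b - a)) (b - a) (b - a) \<le> C\<^sup>2"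
begin

definition line :: "real \<Rightarrow> 'e" where "line s = a + s *\<^sub>R (b - a)"

text \<open>Only continuity is demanded, so lifts can be concatenated at once; differentiability at
  interior parameters is automatic by \<open>lift_has_derivative\<close>.\<close>

definition is_lift :: "real \<Rightarrow> real \<Rightarrow> (real \<Rightarrow> 'a) \<Rightarrow> bool" where
  "is_lift s1 s2 \<Gamma> \<longleftrightarrow> 0 \<le> s1 \<and> s1 \<le> s2 \<and> s2 \<le> 1 \<and> continuous_on {s1..s2} \<Gamma> \<and>
     \<Gamma> ` {s1..s2} \<subseteq> carrier M \<and> (\<forall>s\<in>{s1..s2}. phi (\<Gamma> s) = cinv d (line s))"

lemma line_in: "s \<in> {0..1} \<Longrightarrow> line s \<in> cmap d ` cdom d"
  using seg by (simp add: line_def)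

lemma lift_Phi:
  assumes \<Gamma>: "is_lift s1 s2 \<Gamma>" and s: "s \<in> {s1..s2}" and c: "c \<in> M" "\<Gamma> s \<in> cdom c"
  shows "cmap c (\<Gamma> s) \<in> Phi_dom c d" "Phi c d (cmap c (\<Gamma> s)) = line s"
proof -
  have s01: "s \<in> {0..1}" and ph: "phi (\<Gamma> s) = cinv d (line s)" using \<Gamma> s by (auto simp: is_lift_def)
  have "phi (\<Gamma> s) \<in> cdom d" unfolding ph by (rule P.cinv_in_cdom[OF line_in[OF s01]])
  then show "cmap c (\<Gamma> s) \<in> Phi_dom c d" using c by blast
  show "Phi c d (cmap c (\<Gamma> s)) = line s"
    using ph psi.S.cinv_cmap[OF c] P.cmap_cinv[OF d line_in[OF s01]] by simp
qed

text \<open>Near \<open>s\<close> a continuous lift stays in the domain of a local inverse of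
  \<open>Phi c d\<close>, hence coincides there with that inverse applied to the line.\<close>

lemma lift_has_derivative:
  assumes \<Gamma>: "is_lift s1 s2 \<Gamma>" and s: "s \<in> {s1<..<s2}" and c: "c \<in> M" "\<Gamma> s \<in> cdom c"
  shows "\<exists>W. ((cmap c \<circ> \<Gamma>) has_vector_derivative W) (at s) \<and> fder (Phi c d) (cmap c (\<Gamma> s)) W = b - a"
proof -
  define y where "y = cmap c (\<Gamma> s)"
  have s': "s \<in> {s1..s2}" using s by auto
  have y: "y \<in> Phi_dom c d" "Phi c d y = line s" unfolding y_def by (rule lift_Phi[OF \<Gamma> s' c])+
  obtain U V g0 where U: "open U" "U \<subseteq> Phi_dom c d" "y \<in> U" and V: "open V"
    and hom: "homeomorphism U V (Phi c d) g0"
    and dg: "\<And>y. y \<in> V \<Longrightarrow> (g0 has_derivative inv (fder (Phi c d) (g0 y))) (at y)"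
    and bij: "\<And>y. y \<in> V \<Longrightarrow> bij (fder (Phi c d) (g0 y))"
    by (rule inverse_function_smooth[OF ph.smooth_on_rep[OF c(1) d] ph.open_rep_dom[OF c(1) d] y(1)
        fder_Phi_inj[OF c(1) d y(1)]], assumption) (rule that)
  have inV: "line s \<in> V" and gy: "g0 (line s) = y"
    using hom U(3) y(2) unfolding homeomorphism_def by (auto simp flip: y(2))
  define W where "W = inv (fder (Phi c d) y) (b - a)"
  define J where "J = {s1<..<s2} \<inter> \<Gamma> -` (cdom c \<inter> cmap c -` U)"
  have cont: "continuous_on {s1<..<s2} \<Gamma>"
    using \<Gamma> unfolding is_lift_def by (auto intro: continuous_on_subset)
  have op: "open (cdom c \<inter> cmap c -` U)"
    by (rule continuous_open_preimage[OF psi.S.continuous_on_cmap[OF c(1)] psi.S.open_cdom[OF c(1)] U(1)])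
  have J: "open J" "s \<in> J"
  proof -
    show "open J"
      unfolding J_def by (rule continuous_open_preimage[OF cont open_greaterThanLessThan op])
    show "s \<in> J" using s c U(3) by (simp add: J_def y_def)
  qed
  have eq: "g0 (line t) = (cmap c \<circ> \<Gamma>) t" if "t \<in> J" for t
  proof -
    have t: "t \<in> {s1..s2}" "\<Gamma> t \<in> cdom c" "cmap c (\<Gamma> t) \<in> U" using that by (auto simp: J_def)
    then show ?thesis
      using lift_Phi(2)[OF \<Gamma> t(1) c(1) t(2)] hom unfolding homeomorphism_def by (metis comp_apply)
  qed
  have dl: "(line has_derivative (\<lambda>h. h *\<^sub>R (b - a))) (at s)"
    unfolding line_def[abs_def] by (auto intro!: derivative_eq_intros)
  note dgs = dg[OF inV, unfolded gy]
  have "((\<lambda>t. g0 (line t)) has_derivative (\<lambda>h. inv (fder (Phi c d) y) (h *\<^sub>R (b - a)))) (at s)"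
    by (rule has_derivative_compose[OF dl dgs])
  then have "((cmap c \<circ> \<Gamma>) has_derivative (\<lambda>h. inv (fder (Phi c d) y) (h *\<^sub>R (b - a)))) (at s)"
    by (rule has_derivative_transform_within_open[OF _ J eq])
  then have "((cmap c \<circ> \<Gamma>) has_vector_derivative W) (at s)"
    unfolding has_vector_derivative_def W_def linear_cmul[OF has_derivative_linear[OF dgs]] .
  moreover have "fder (Phi c d) y W = b - a"
    unfolding W_def using bij[OF inV] by (simp add: gy bij_is_surj surj_f_inv_f)
  ultimately show ?thesis unfolding y_def by blast
qed

text \<open>The lift, reparametrised to the unit interval, is an admissible curve whose speed is
  computed from the segment by the homothety. Its length therefore bounds the distance.\<close>

lemma lift_dist:
  assumes \<Gamma>: "is_lift s1 s2 \<Gamma>" and \<alpha>: "\<alpha> \<in> {s1..s2}" and \<beta>: "\<beta> \<in> {s1..s2}"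
  shows "riemannian_dist M g (\<Gamma> \<alpha>) (\<Gamma> \<beta>) \<le> ennreal (C * \<bar>\<beta> - \<alpha>\<bar>)"
proof (cases "\<alpha> = \<beta>")
  case True
  have "\<Gamma> \<beta> \<in> carrier M" using \<Gamma> \<beta> by (auto simp: is_lift_def)
  then show ?thesis using psi.S.riemannian_dist_self[OF riemannian_g] True by simp
next
  case False
  \<comment> \<open>The affine change of parameter runs backwards when \<beta> < \<alpha>, so both
    orders of the end points are treated together.\<close>
  define u where "u t = \<alpha> + t * (\<beta> - \<alpha>)" for t
  define \<delta> where "\<delta> t = \<Gamma> (u t)" for t
  have u_in: "u t \<in> {s1..s2}" if "t \<in> {0..1}" for t
  proof -
    have "u t = (1 - t) *\<^sub>R \<alpha> + t *\<^sub>R \<beta>" by (simp add: u_def algebra_simps)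
    then show ?thesis using convexD_alt[OF convex_real_interval(5) \<alpha> \<beta>, of t] that by simp
  qed
  have u_open: "u t \<in> {s1<..<s2}" if t: "t \<in> {0<..<1}" for t
  proof -
    have "min \<alpha> \<beta> < u t \<and> u t < max \<alpha> \<beta>"
    proof (cases "\<alpha> < \<beta>")
      case True
      then have *: "0 < t * (\<beta> - \<alpha>)" "0 < (1 - t) * (\<beta> - \<alpha>)" using t by auto
      have eq: "u t = \<beta> - (1 - t) * (\<beta> - \<alpha>)" by (simp add: u_def algebra_simps)
      have "\<alpha> < u t" using *(1) unfolding u_def by linarith
      moreover have "u t < \<beta>" using *(2) unfolding eq by linarith
      ultimately show ?thesis using True by simp
    next
      case False
      then have "\<beta> < \<alpha>" using \<open>\<alpha> \<noteq> \<beta>\<close> by simp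
      then have *: "0 < t * (\<alpha> - \<beta>)" "0 < (1 - t) * (\<alpha> - \<beta>)" using t by auto
      have eq: "u t = \<alpha> - t * (\<alpha> - \<beta>)" "u t = \<beta> + (1 - t) * (\<alpha> - \<beta>)"
        by (simp_all add: u_def algebra_simps)
      have "u t < \<alpha>" using *(1) unfolding eq(1) by linarith
      moreover have "\<beta> < u t" using *(2) unfolding eq(2) by linarith
      ultimately show ?thesis using \<open>\<beta> < \<alpha>\<close> by simp
    qed
    then show ?thesis using \<alpha> \<beta> by auto
  qed
  have cu: "continuous_on {0..1} u" unfolding u_def by (intro continuous_intros)
  have "continuous_on {s1..s2} \<Gamma>" using \<Gamma> by (simp add: is_lift_def)
  from continuous_on_compose2[OF this cu] have cont: "continuous_on {0..1} \<delta>"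
    unfolding \<delta>_def[abs_def] using u_in by blast
  have du: "(u has_vector_derivative (\<beta> - \<alpha>)) (at t)" for t
    unfolding u_def[abs_def] by (auto intro!: derivative_eq_intros simp: has_vector_derivative_def)
  have deriv: "\<exists>W. ((cmap c \<circ> \<delta>) has_vector_derivative W) (at t) \<and>
      fder (Phi c d) (cmap c (\<delta> t)) W = (\<beta> - \<alpha>) *\<^sub>R (b - a)"
    if t: "t \<in> {0<..<1}" and c: "c \<in> M" "\<delta> t \<in> cdom c" for t c
  proof -
    obtain W where W: "((cmap c \<circ> \<Gamma>) has_vector_derivative W) (at (u t))" "fder (Phi c d) (cmap c (\<delta> t)) W = b - a"
      using lift_has_derivative[OF \<Gamma> u_open[OF t] c(1)] c(2) unfolding \<delta>_def by blast
    have "((cmap c \<circ> \<Gamma>) \<circ> u has_vector_derivative (\<beta> - \<alpha>) *\<^sub>R W) (at t)"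
      by (rule vector_diff_chain_at[OF du W(1)])
    moreover have "(cmap c \<circ> \<Gamma>) \<circ> u = cmap c \<circ> \<delta>" by (simp add: fun_eq_iff \<delta>_def)
    moreover have "cmap c (\<delta> t) \<in> Phi_dom c d"
      unfolding \<delta>_def by (rule lift_Phi(1)[OF \<Gamma> _ c(1)]) (use u_in[of t] t c in \<open>auto simp: \<delta>_def\<close>)
    then have "linear (fder (Phi c d) (cmap c (\<delta> t)))"
      by (rule smooth_on_fder_linear[OF ph.smooth_on_rep[OF c(1) d]])
    ultimately show ?thesis using W(2) by (intro exI[of _ "(\<beta> - \<alpha>) *\<^sub>R W"]) (simp add: linear_cmul)
  qed
  have pc: "piecewise_C1_curve M \<delta>"
    unfolding piecewise_C1_curve_def
  proof (intro conjI ballI allI impI)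
    show "path \<delta>" using cont by (simp add: path_def)
    show "path_image \<delta> \<subseteq> carrier M" using \<Gamma> u_in by (auto simp: path_image_def \<delta>_def is_lift_def)
    fix c a' b' assume c: "c \<in> M" and ab: "{a'..b'} \<subseteq> {0..1} \<and> \<delta> ` {a'..b'} \<subseteq> cdom c"
    \<comment> \<open>End points are removed because two-sided derivatives of the lift exist only at
      interior parameters; they form the exceptional set of the piecewise condition.\<close>
    define X where "X = {a'..b'} - {a', b'}"
    have X: "t \<in> {0<..<1}" "\<delta> t \<in> cdom c" "t \<in> {0..1}" if "t \<in> X" for t
    proof -
      have t: "a' < t" "t < b'" "a' \<in> {0..1}" "b' \<in> {0..1}" "t \<in> {a'..b'}"
        using that ab by (auto simp: X_def less_le)
      then show "t \<in> {0<..<1}" "t \<in> {0..1}" by auto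
      show "\<delta> t \<in> cdom c" using t(5) ab by blast
    qed
    obtain W where W: "\<And>t. t \<in> X \<Longrightarrow> ((cmap c \<circ> \<delta>) has_vector_derivative W t) (at t)"
      "\<And>t. t \<in> X \<Longrightarrow> fder (Phi c d) (cmap c (\<delta> t)) (W t) = (\<beta> - \<alpha>) *\<^sub>R (b - a)"
      using deriv[OF X(1) c X(2)] by metis
    have cc: "continuous_on {a'..b'} (cmap c \<circ> \<delta>)"
      by (rule continuous_on_compose[OF continuous_on_subset[OF cont] continuous_on_subset[OF psi.S.continuous_on_cmap[OF c]]])
        (use ab in auto)
    have inP: "cmap c (\<delta> t) \<in> Phi_dom c d" if "t \<in> X" for t
      unfolding \<delta>_def by (rule lift_Phi(1)[OF \<Gamma> u_in[OF X(3)[OF that]] c]) (use X(2)[OF that] in \<open>simp add: \<delta>_def\<close>)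
    have "continuous_on X W"
    proof (rule continuous_on_linear_solution)
      show "linear (fder (Phi c d) (cmap c (\<delta> t)))" if "t \<in> X" for t
        by (rule smooth_on_fder_linear[OF ph.smooth_on_rep[OF c d] inP[OF that]])
      show "v = 0" if "t \<in> X" "fder (Phi c d) (cmap c (\<delta> t)) v = 0" for t v
        by (rule fder_Phi_inj[OF c d inP[OF that(1)] that(2)])
      have "continuous_on X (cmap c \<circ> \<delta>)" by (rule continuous_on_subset[OF cc]) (auto simp: X_def)
      then show "continuous_on X (\<lambda>t. fder (Phi c d) (cmap c (\<delta> t)) v)" for v
        using inP
        by (intro continuous_on_compose2[OF smooth_on_imp_continuous_on[OF
              smooth_on_fder[OF ph.smooth_on_rep[OF c d] ph.open_rep_dom[OF c d]]]]) (auto simp: comp_def)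
    qed (rule W(2))
    then have "(cmap c \<circ> \<delta>) C1_differentiable_on ({a'..b'} - {a', b'})"
      using W(1) unfolding C1_differentiable_on_def X_def by blast
    then show "(cmap c \<circ> \<delta>) piecewise_C1_differentiable_on {a'..b'}"
      using cc unfolding piecewise_C1_differentiable_on_def
      by (intro conjI exI[of _ "{a', b'}"]) auto
  qed
  have vel: "sqrt (g (\<delta> t) (velocity M \<delta> t) (velocity M \<delta> t)) \<le> C * \<bar>\<beta> - \<alpha>\<bar>" if t: "t \<in> {0<..<1}" for t
  proof -
    have t01: "t \<in> {0..1}" using t by auto
    have "\<delta> t \<in> carrier M" using \<Gamma> u_in[OF t01] by (auto simp: \<delta>_def is_lift_def)
    then obtain c where c: "c \<in> M" "\<delta> t \<in> cdom c" by (auto simp: carrier_def)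
    obtain W where W: "((cmap c \<circ> \<delta>) has_vector_derivative W) (at t)"
      "fder (Phi c d) (cmap c (\<delta> t)) W = (\<beta> - \<alpha>) *\<^sub>R (b - a)"
      using deriv[OF t c] by blast
    define J where "J = {0<..<1} \<inter> \<delta> -` cdom c"
    have cont': "continuous_on {0<..<1} \<delta>" by (rule continuous_on_subset[OF cont]) auto
    have J: "open J" "t \<in> J" "\<delta> ` J \<subseteq> cdom c"
      unfolding J_def using continuous_open_preimage[OF cont' _ psi.S.open_cdom[OF c(1)]] t c(2) by auto
    have Pd: "cmap c (\<delta> t) \<in> Phi_dom c d" "Phi c d (cmap c (\<delta> t)) = line (u t)"
      using lift_Phi[OF \<Gamma> u_in[OF t01] c(1)] c(2) unfolding \<delta>_def by auto
    have u01: "u t \<in> {0..1}" using u_in[OF t01] \<Gamma> by (auto simp: is_lift_def)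
    interpret s: metric_form "cmap d ` cdom d" "metric_coord P \<sigma> d" by (rule metric_form_base[OF d])
    note bil = s.bilinear_G[OF line_in[OF u01]]
    have "g (\<delta> t) (velocity M \<delta> t) (velocity M \<delta> t) = metric_coord M g c (cmap c (\<delta> t)) W W"
      unfolding psi.S.velocity_coord_vec[OF c(1) J W(1)] metric_coord_def psi.S.cinv_cmap[OF c] ..
    also have "\<dots> = (\<rho> t0)\<^sup>2 * metric_coord P \<sigma> d (line (u t)) ((\<beta> - \<alpha>) *\<^sub>R (b - a)) ((\<beta> - \<alpha>) *\<^sub>R (b - a))"
      unfolding metric_coord_Phi[OF c(1) d Pd(1)] Pd(2) W(2) ..
    also have "\<dots> = (\<beta> - \<alpha>)\<^sup>2 * ((\<rho> t0)\<^sup>2 * metric_coord P \<sigma> d (line (u t)) (b - a) (b - a))"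
      by (simp add: bilinear_lmul[OF bil] bilinear_rmul[OF bil] power2_eq_square)
    also have "\<dots> \<le> (\<beta> - \<alpha>)\<^sup>2 * C\<^sup>2"
      using speed[OF u01] unfolding line_def by (intro mult_left_mono) auto
    also have "\<dots> = (C * \<bar>\<beta> - \<alpha>\<bar>)\<^sup>2" by (simp add: power_mult_distrib)
    finally show ?thesis using C by (intro real_le_lsqrt) auto
  qed
  have "curve_length M g \<delta> \<le> (\<integral>\<^sup>+s. ennreal (C * \<bar>\<beta> - \<alpha>\<bar>) * indicator {0..1} s \<partial>(lborel :: real measure))"
    unfolding curve_length_def
  proof (rule nn_integral_mono_AE)
    \<comment> \<open>The speed bound holds on the open interval; the two end points form a null
      set.\<close>
    have "AE s in lborel. s \<noteq> (0::real)" "AE s in lborel. s \<noteq> (1::real)"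
      by (rule AE_lborel_singleton)+
    then show "AE s in lborel. ennreal (sqrt (g (\<delta> s) (velocity M \<delta> s) (velocity M \<delta> s))) * indicator {0..1} s
        \<le> ennreal (C * \<bar>\<beta> - \<alpha>\<bar>) * indicator {0..1} s"
    proof eventually_elim
      case (elim s)
      show ?case
      proof (cases "s \<in> {0..1}")
        case True
        then have "s \<in> {0<..<1}" using elim by auto
        from vel[OF this] True show ?thesis by (simp add: ennreal_leI)
      qed simp
    qed
  qed
  also have "\<dots> = ennreal (C * \<bar>\<beta> - \<alpha>\<bar>)" by (simp add: nn_integral_cmult_indicator)
  finally have len: "curve_length M g \<delta> \<le> ennreal (C * \<bar>\<beta> - \<alpha>\<bar>)" .
  show ?thesis
    by (rule psi.S.riemannian_dist_le[OF pc _ _ len]) (simp_all add: pathstart_def pathfinish_def \<delta>_def u_def)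
qed

text \<open>The arguments pair a parameter with a point above it. They are the states of the
  iteration in \<open>lift_to_end\<close>, and transitivity is concatenation of lifts.\<close>

definition reach :: "real \<times> 'a \<Rightarrow> real \<times> 'a \<Rightarrow> bool" where
  "reach x y \<longleftrightarrow> (\<exists>\<Gamma>. is_lift (fst x) (fst y) \<Gamma> \<and> \<Gamma> (fst x) = snd x \<and> \<Gamma> (fst y) = snd y)"

lemma reach_refl:
  assumes "0 \<le> fst x" "fst x \<le> 1" "snd x \<in> carrier M" "phi (snd x) = cinv d (line (fst x))"
  shows "reach x x"
  unfolding reach_def by (intro exI[of _ "\<lambda>s. snd x"]) (use assms in \<open>simp add: is_lift_def\<close>)

lemma reach_trans:
  assumes "reach x y" "reach y z"
  shows "reach x z"
proof -
  obtain \<Gamma>1 where 1: "is_lift (fst x) (fst y) \<Gamma>1" "\<Gamma>1 (fst x) = snd x" "\<Gamma>1 (fst y) = snd y"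
    using assms(1) by (auto simp: reach_def)
  obtain \<Gamma>2 where 2: "is_lift (fst y) (fst z) \<Gamma>2" "\<Gamma>2 (fst y) = snd y" "\<Gamma>2 (fst z) = snd z"
    using assms(2) by (auto simp: reach_def)
  define \<Gamma> where "\<Gamma> s = (if s \<le> fst y then \<Gamma>1 s else \<Gamma>2 s)" for s
  have le: "0 \<le> fst x" "fst x \<le> fst y" "fst y \<le> fst z" "fst z \<le> 1" using 1(1) 2(1) by (auto simp: is_lift_def)
  have un: "{fst x..fst y} \<union> {fst y..fst z} = {fst x..fst z}" using le by auto
  have "continuous_on ({fst x..fst y} \<union> {fst y..fst z}) \<Gamma>"
    unfolding \<Gamma>_def
    by (rule continuous_on_cases) (use 1 2 in \<open>auto simp: is_lift_def\<close>)
  then have cont: "continuous_on {fst x..fst z} \<Gamma>" by (simp only: un)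
  have "is_lift (fst x) (fst z) \<Gamma>"
    unfolding is_lift_def
  proof (intro conjI ballI cont)
    have \<Gamma>_in: "\<Gamma> s \<in> carrier M \<and> phi (\<Gamma> s) = cinv d (line s)" if "s \<in> {fst x..fst z}" for s
      using 1(1) 2(1) that unfolding \<Gamma>_def is_lift_def by (cases "s \<le> fst y") (auto simp: image_subset_iff)
    then show "\<Gamma> ` {fst x..fst z} \<subseteq> carrier M" by blast
    show "phi (\<Gamma> s) = cinv d (line s)" if "s \<in> {fst x..fst z}" for s using \<Gamma>_in[OF that] by simp
  qed (use le in auto)
  moreover have "\<Gamma> (fst x) = snd x" using le 1(2) by (simp add: \<Gamma>_def)
  moreover have "\<Gamma> (fst z) = snd z" using le 1(3) 2(2,3) by (cases "fst z = fst y") (auto simp: \<Gamma>_def)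
  ultimately show ?thesis unfolding reach_def by blast
qed

text \<open>Starting anywhere, extend the lift at each step by at least half of what is possible. The end
  points form a Cauchy sequence, and at its limit the local inverse would allow a definite extension.\<close>

lemma lift_to_end:
  assumes compl: "complete_metric M g" and p0: "p0 \<in> carrier M" "phi p0 = cinv d (line 0)"
  shows "\<exists>p\<in>carrier M. phi p = cinv d b"
proof -
  define X where "X x \<longleftrightarrow> 0 \<le> fst x \<and> fst x \<le> 1 \<and> snd x \<in> carrier M \<and> phi (snd x) = cinv d (line (fst x))"
    for x :: "real \<times> 'a"
  have Xreach: "X y" if "reach x y" for x y
  proof -
    obtain \<Gamma> where \<Gamma>: "is_lift (fst x) (fst y) \<Gamma>" "\<Gamma> (fst y) = snd y"
      using \<open>reach x y\<close> unfolding reach_def by blast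
    have "fst y \<in> {fst x..fst y}" using \<Gamma>(1) by (simp add: is_lift_def)
    then have "\<Gamma> (fst y) \<in> carrier M" "phi (\<Gamma> (fst y)) = cinv d (line (fst y))"
      using \<Gamma>(1) unfolding is_lift_def by blast+
    then show ?thesis using \<Gamma> unfolding X_def is_lift_def by simp
  qed
  define R where "R x = {s. \<exists>p. reach x (s, p)}" for x
  have Rle: "s \<le> 1" if "s \<in> R x" for s x
    using that unfolding R_def reach_def is_lift_def by auto
  \<comment> \<open>The supremum of \<open>R x\<close> need not be attained, hence a state beyond
    the midpoint is chosen instead of a maximal extension. If no extension is proper,
    \<open>x\<close> itself qualifies.\<close>
  have step: "\<exists>y. X y \<and> (reach x y \<and> (\<forall>s\<in>R x. (fst x + s) / 2 \<le> fst y))" if x: "X x" for x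
  proof (cases "\<exists>s\<in>R x. fst x < s")
    case False
    have "reach x x" using x by (intro reach_refl) (auto simp: X_def)
    then show ?thesis using x False by (intro exI[of _ x]) auto
  next
    case True
    then obtain s1 where s1: "s1 \<in> R x" "fst x < s1" by blast
    have bdd: "bdd_above (R x)" by (rule bdd_aboveI) (rule Rle)
    have "s1 \<le> Sup (R x)" by (rule cSup_upper[OF s1(1) bdd])
    then have "(fst x + Sup (R x)) / 2 < Sup (R x)" using s1(2) by simp
    then obtain s2 where s2: "s2 \<in> R x" "(fst x + Sup (R x)) / 2 < s2"
      using less_cSup_iff[OF _ bdd] s1(1) by blast
    then obtain p2 where p2: "reach x (s2, p2)" by (auto simp: R_def)
    have "(fst x + s) / 2 \<le> s2" if "s \<in> R x" for s
      using cSup_upper[OF that bdd] s2(2) by simp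
    then show ?thesis using p2 Xreach[OF p2] by (intro exI[of _ "(s2, p2)"]) auto
  qed
  have "X (0, p0)" using p0 by (simp add: X_def)
  then obtain x where X: "\<And>n. X (x n)" and rs: "\<And>n. reach (x n) (x (Suc n))"
    and half: "\<And>n s. s \<in> R (x n) \<Longrightarrow> (fst (x n) + s) / 2 \<le> fst (x (Suc n))"
    using dependent_nat_choice[of "\<lambda>n. X" "\<lambda>n x y. reach x y \<and> (\<forall>s\<in>R x. (fst x + s) / 2 \<le> fst y)"] step
    by metis
  define s where "s n = fst (x n)" for n
  define q where "q n = snd (x n)" for n
  have reach_le: "reach (x i) (x j)" if "i \<le> j" for i j
    using that
  proof (induction rule: dec_induct)
    case base
    show ?case using X[of i] by (intro reach_refl) (auto simp: X_def)
  next
    case (step n)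
    show ?case by (rule reach_trans[OF step.IH rs])
  qed
  have dist_le: "riemannian_dist M g (q i) (q j) \<le> ennreal (C * \<bar>s i - s j\<bar>)" for i j
  proof -
    \<comment> \<open>The Cauchy condition concerns all pairs of indices, so the distance is bounded
      in both directions; \<open>lift_dist\<close> accepts its parameters in either order.\<close>
    have *: "riemannian_dist M g (q i) (q j) \<le> ennreal (C * \<bar>s i - s j\<bar>)
        \<and> riemannian_dist M g (q j) (q i) \<le> ennreal (C * \<bar>s j - s i\<bar>)" if ij: "i \<le> j" for i j
    proof -
      obtain \<Gamma> where \<Gamma>: "is_lift (s i) (s j) \<Gamma>" "\<Gamma> (s i) = q i" "\<Gamma> (s j) = q j"
        using reach_le[OF ij] by (auto simp: reach_def s_def q_def)
      have "s i \<in> {s i..s j}" "s j \<in> {s i..s j}" using \<Gamma>(1) by (auto simp: is_lift_def)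
      from lift_dist[OF \<Gamma>(1) this] lift_dist[OF \<Gamma>(1) this(2,1)] show ?thesis
        by (simp add: \<Gamma> abs_minus_commute)
    qed
    show ?thesis using *[of i j] *[of j i] linear[of i j] by blast
  qed
  have "incseq s"
    by (rule incseq_SucI) (use rs in \<open>auto simp: s_def reach_def is_lift_def\<close>)
  moreover have s1: "s n \<le> 1" and s0: "0 \<le> s n" and qM: "q n \<in> carrier M"
    and phq: "phi (q n) = cinv d (line (s n))" for n
    using X[of n] by (auto simp: X_def s_def q_def)
  ultimately obtain L where L: "s \<longlonglongrightarrow> L" "\<And>n. s n \<le> L"
    using incseq_convergent[of s 1] by blast
  have L01: "L \<in> {0..1}" using LIMSEQ_le_const2[OF L(1), of 1] s1 s0[of 0] L(2)[of 0] by auto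
  have "\<exists>n0. \<forall>i\<ge>n0. \<forall>j\<ge>n0. riemannian_dist M g (q i) (q j) < \<epsilon>" if \<epsilon>: "\<epsilon> > 0" for \<epsilon>
  proof -
    \<comment> \<open>The tolerance is an extended real and may be infinite, so it is replaced by a
      smaller real one. Dividing by \<open>C + 1\<close> below covers the case
      \<open>C = 0\<close>.\<close>
    obtain e' where e': "0 < e'" "e' < \<epsilon>" using dense[OF \<epsilon>] by blast
    then obtain r where r: "e' = ennreal r" "0 < r"
      by (cases e') (auto simp: top.extremum_strict)
    have C1: "C + 1 > 0" using C by simp
    then have "r / (C + 1) > 0" using r by simp
    then obtain n0 where n0: "\<And>i j. i \<ge> n0 \<Longrightarrow> j \<ge> n0 \<Longrightarrow> dist (s i) (s j) < r / (C + 1)"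
      using LIMSEQ_imp_Cauchy[OF L(1)] unfolding Cauchy_def by blast
    have "riemannian_dist M g (q i) (q j) < \<epsilon>" if "i \<ge> n0" "j \<ge> n0" for i j
    proof -
      have "\<bar>s i - s j\<bar> \<le> r / (C + 1)" using n0[OF that] by (simp add: dist_real_def)
      then have "(C + 1) * \<bar>s i - s j\<bar> \<le> r" using C1 by (simp add: field_simps)
      moreover have "C * \<bar>s i - s j\<bar> \<le> (C + 1) * \<bar>s i - s j\<bar>" by (intro mult_right_mono) auto
      ultimately have "ennreal (C * \<bar>s i - s j\<bar>) \<le> e'" unfolding r(1) by (intro ennreal_leI) linarith
      then show ?thesis using dist_le[of i j] e'(2) by (meson le_less_trans order_trans)
    qed
    then show ?thesis by blast
  qed
  then obtain p where p: "p \<in> carrier M" "(\<lambda>i. riemannian_dist M g (q i) p) \<longlonglongrightarrow> 0"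
    using compl qM unfolding complete_metric_def by (metis image_subsetI)
  have near: "eventually (\<lambda>i. q i \<in> U) sequentially" if U: "open U" "p \<in> U" for U
  proof -
    obtain \<epsilon> where \<epsilon>: "\<epsilon> > 0" "\<And>q'. riemannian_dist M g q' p < ennreal \<epsilon> \<Longrightarrow> q' \<in> U"
      using psi.S.riemannian_dist_small_imp_near[OF riemannian_g U p(1)] by blast
    have "eventually (\<lambda>i. riemannian_dist M g (q i) p < ennreal \<epsilon>) sequentially"
      by (rule order_tendstoD(2)[OF p(2)]) (simp add: \<epsilon>(1))
    then show ?thesis by (rule eventually_mono) (rule \<epsilon>(2))
  qed
  then have "q \<longlonglongrightarrow> p" by (intro topological_tendstoI)
  moreover have "isCont phi p"
    using ph.continuous_on_map continuous_on_eq_continuous_at[OF psi.S.open_carrier] p(1) by blast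
  ultimately have 1: "(\<lambda>n. phi (q n)) \<longlonglongrightarrow> phi p" by (rule isCont_tendsto_compose[rotated])
  have cl: "isCont line s" for s unfolding line_def by (intro continuous_intros)
  have "isCont (cinv d) (line L)"
    using P.continuous_on_cinv[OF d] continuous_on_eq_continuous_at[OF P.open_cmap_image[OF d]] line_in[OF L01] by blast
  then have "(\<lambda>n. cinv d (line (s n))) \<longlonglongrightarrow> cinv d (line L)"
    by (rule isCont_tendsto_compose[OF _ isCont_tendsto_compose[OF cl L(1)]])
  then have phL: "phi p = cinv d (line L)"
    using 1 LIMSEQ_unique unfolding phq by blast
  show ?thesis
  proof (cases "L = 1")
    case True
    then show ?thesis using p(1) phL by (intro bexI[of _ p]) (simp_all add: line_def)
  next
    case False
    then have "L < 1" using L01 by simp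
    have "phi p \<in> cdom d" unfolding phL by (rule P.cinv_in_cdom[OF line_in[OF L01]])
    from local_inverse[OF p(1) d this]
    obtain U V k where U: "open U" "p \<in> U" "U \<subseteq> carrier M" and V: "open V" "phi p \<in> V" "V \<subseteq> cdom d"
      and k: "continuous_on V k" "\<And>v. v \<in> V \<Longrightarrow> k v \<in> U \<and> phi (k v) = v"
        "\<And>u. u \<in> U \<Longrightarrow> phi u \<in> V \<and> k (phi u) = u" by metis
    have "open (cmap d ` V)" by (rule P.open_cmap_image_subset[OF d V(1,3)])
    moreover have lL: "line L \<in> cmap d ` V"
      using V(2) phL P.cmap_cinv[OF d line_in[OF L01]] by (metis imageI)
    ultimately have "eventually (\<lambda>s. line s \<in> cmap d ` V) (at L)"
      using cl[of L] by (metis continuous_within topological_tendstoD)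
    then obtain \<eta> where \<eta>: "\<eta> > 0" "\<And>s. s \<noteq> L \<Longrightarrow> dist s L < \<eta> \<Longrightarrow> line s \<in> cmap d ` V"
      unfolding eventually_at by blast
    have inV: "line u \<in> cmap d ` V" "cinv d (line u) \<in> V" if "\<bar>u - L\<bar> < \<eta>" for u
    proof -
      show l: "line u \<in> cmap d ` V" using \<eta>(2)[of u] that lL by (cases "u = L") (auto simp: dist_real_def)
      show "cinv d (line u) \<in> V" by (rule P.cinv_in[OF d V(3) l])
    qed
    define s' where "s' = min 1 (L + \<eta> / 2)"
    have s': "L < s'" "s' \<le> 1" "s' < L + \<eta>" using \<open>L < 1\<close> \<eta>(1) by (auto simp: s'_def min_def)
    have "eventually (\<lambda>n. q n \<in> U) sequentially" by (rule near[OF U(1,2)])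
    moreover have "eventually (\<lambda>n. L - \<eta> < s n) sequentially" by (rule order_tendstoD(1)[OF L(1)]) (use \<eta> in simp)
    \<comment> \<open>This puts the midpoint of \<open>s n\<close> and \<open>s'\<close> beyond
      \<open>L\<close>. A lift from \<open>s n\<close> to \<open>s'\<close> would then force
      \<open>s (Suc n)\<close> past its limit.\<close>
    moreover have "eventually (\<lambda>n. 2 * L - s' < s n) sequentially" by (rule order_tendstoD(1)[OF L(1)]) (use s' in simp)
    ultimately have "eventually (\<lambda>n. q n \<in> U \<and> L - \<eta> < s n \<and> 2 * L - s' < s n) sequentially"
      by eventually_elim simp
    then obtain n where n: "q n \<in> U" "L - \<eta> < s n" "2 * L - s' < s n"
      using eventually_happens'[OF sequentially_bot] by blast
    define \<Gamma> where "\<Gamma> u = k (cinv d (line u))" for u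
    have rng: "\<bar>u - L\<bar> < \<eta>" if "u \<in> {s n..s'}" for u using that n(2) s'(3) by auto
    have "is_lift (s n) s' \<Gamma>"
      unfolding is_lift_def
    proof (intro conjI ballI)
      show "0 \<le> s n" "s' \<le> 1" by (rule s0, rule s'(2))
      show "s n \<le> s'" using L(2)[of n] s'(1) by simp
      have "continuous_on {s n..s'} line" unfolding line_def by (intro continuous_intros)
      then have "continuous_on {s n..s'} (\<lambda>u. cinv d (line u))"
        by (rule continuous_on_compose2[OF P.continuous_on_cinv[OF d]]) (use inV(1) rng V(3) in blast)
      then show "continuous_on {s n..s'} \<Gamma>"
        unfolding \<Gamma>_def by (rule continuous_on_compose2[OF k(1)]) (use inV(2) rng in blast)
      show "\<Gamma> ` {s n..s'} \<subseteq> carrier M" using k(2)[OF inV(2)[OF rng]] U(3) unfolding \<Gamma>_def by blast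
      show "phi (\<Gamma> u) = cinv d (line u)" if "u \<in> {s n..s'}" for u
        using k(2)[OF inV(2)[OF rng[OF that]]] unfolding \<Gamma>_def by blast
    qed
    moreover have "\<Gamma> (s n) = q n" using k(3)[OF n(1)] phq[of n] unfolding \<Gamma>_def by simp
    ultimately have "reach (x n) (s', \<Gamma> s')" unfolding reach_def s_def q_def by auto
    then have "(s n + s') / 2 \<le> s (Suc n)"
      using half[of s' n] by (auto simp: R_def s_def)
    then have False using n(3) L(2)[of "Suc n"] by simp
    then show ?thesis ..
  qed
qed

end

section \<open>Surjectivity of the projection to the Riemannian factor\<close>

context slice_hypersurface
begin

text \<open>The image is open by the local sections. It is closed because a coordinate ball is
  convex: if it contained any image point, the segment from that point to the centre would lift and
  put the centre into the image.\<close>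

lemma surj_phi:
  assumes compl: "complete_metric M g" and ne: "carrier M \<noteq> {}"
  shows "phi ` carrier M = carrier P"
proof -
  define Q where "Q = phi ` carrier M"
  have sub: "Q \<subseteq> carrier P" unfolding Q_def using ph.map_in_carrier by auto
  have "\<exists>W. open W \<and> x \<in> W \<and> W \<subseteq> Q" if "x \<in> Q" for x
  proof -
    obtain p where p: "p \<in> carrier M" "x = phi p"
      using \<open>x \<in> Q\<close> unfolding Q_def by blast
    obtain d where d: "d \<in> P" "phi p \<in> cdom d" using ph.map_in_carrier[OF p(1)] by (auto simp: carrier_def)
    from local_inverse[OF p(1) d] obtain U V k where "U \<subseteq> carrier M" "open V" "phi p \<in> V"
      "\<And>v. v \<in> V \<Longrightarrow> k v \<in> U \<and> phi (k v) = v" by metis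
    then show ?thesis unfolding Q_def p(2) by (intro exI[of _ V]) (auto simp: image_iff, metis subsetD)
  qed
  then have "open Q" by (subst open_subopen) blast
  have "\<exists>W. open W \<and> x \<in> W \<and> W \<subseteq> - Q" if x: "x \<in> carrier P - Q" for x
  proof -
    obtain d where d: "d \<in> P" "x \<in> cdom d" using x by (auto simp: carrier_def)
    define b where "b = cmap d x"
    have "b \<in> cmap d ` cdom d" using d by (simp add: b_def)
    then obtain r where r: "r > 0" "ball b r \<subseteq> cmap d ` cdom d"
      using P.open_cmap_image[OF d(1)] open_contains_ball by blast
    define W where "W = cdom d \<inter> cmap d -` ball b r"
    have "open W" unfolding W_def
      by (rule continuous_open_preimage[OF P.continuous_on_cmap[OF d(1)] P.open_cdom[OF d(1)] open_ball])
    moreover have "x \<in> W" using d r by (simp add: W_def b_def)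
    moreover have "W \<subseteq> - Q"
    proof
      fix y assume y: "y \<in> W"
      show "y \<in> - Q"
      proof
        assume "y \<in> Q"
        then obtain p0 where p0: "p0 \<in> carrier M" "phi p0 = y" by (auto simp: Q_def)
        define a where "a = cmap d y"
        have ab: "a \<in> ball b r" "b \<in> ball b r" using y r by (auto simp: W_def a_def)
        have seg: "a + s *\<^sub>R (b - a) \<in> cmap d ` cdom d" if "s \<in> {0..1}" for s
        proof -
          have "(1 - s) *\<^sub>R a + s *\<^sub>R b \<in> ball b r"
            using convexD_alt[OF convex_ball ab, of s] that by simp
          then show ?thesis using r(2) by (auto simp: algebra_simps)
        qed
        interpret s: metric_form "cmap d ` cdom d" "metric_coord P \<sigma> d" by (rule metric_form_base[OF d(1)])
        \<comment> \<open>Compactness of the segment bounds the squared speed by some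
          \<open>C0\<close>, whose square root is the speed constant of the locale
          \<open>segment\<close>.\<close>
        have "continuous_on {0..1} (\<lambda>s. (\<rho> t0)\<^sup>2 * metric_coord P \<sigma> d (a + s *\<^sub>R (b - a)) (b - a) (b - a))"
          by (intro continuous_intros continuous_on_compose2[OF smooth_on_imp_continuous_on[OF s.smooth_G]])
            (use seg in blast)
        from compact_bound_real[OF compact_Icc this] obtain C0 where
          C0: "\<And>s. s \<in> {0..1} \<Longrightarrow> \<bar>(\<rho> t0)\<^sup>2 * metric_coord P \<sigma> d (a + s *\<^sub>R (b - a)) (b - a) (b - a)\<bar> \<le> C0" by blast
        have "C0 \<ge> 0" using C0[of 0] by simp
        interpret segment P I h \<rho> \<sigma> M \<psi> t0 d a b "sqrt C0"
          by unfold_locales (use d(1) seg C0 \<open>C0 \<ge> 0\<close> in \<open>auto simp: abs_le_iff\<close>)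
        have yd: "y \<in> cdom d" using y by (simp add: W_def)
        have "line 0 = a" by (simp add: line_def)
        then have "phi p0 = cinv d (line 0)" using p0(2) P.cinv_cmap[OF d(1) yd] by (simp add: a_def)
        from lift_to_end[OF compl p0(1) this] have "cinv d b \<in> Q" unfolding Q_def by (metis imageI)
        then show False using x P.cinv_cmap[OF d \<open>x \<in> cdom d\<close>] by (simp add: b_def)
      qed
    qed
    ultimately show ?thesis by blast
  qed
  note outside = this
  have "open (carrier P - Q)"
    unfolding open_subopen[of "carrier P - Q"]
  proof
    fix x assume x: "x \<in> carrier P - Q"
    obtain W where "open W" "x \<in> W" "W \<subseteq> - Q" using outside[OF x] by blast
    then show "\<exists>W. open W \<and> x \<in> W \<and> W \<subseteq> carrier P - Q"
      using x P.open_carrier by (intro exI[of _ "W \<inter> carrier P"]) auto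
  qed
  then have "openin (top_of_set (carrier P)) (carrier P - Q)"
    by (rule open_openin_trans[OF P.open_carrier]) auto
  then have "closedin (top_of_set (carrier P)) Q"
    using sub by (simp add: closedin_def)
  moreover have "openin (top_of_set (carrier P)) Q"
    by (rule open_openin_trans[OF P.open_carrier \<open>open Q\<close> sub])
  ultimately have "Q = {} \<or> Q = carrier P" using connected_P by (simp add: connected_clopen)
  then show ?thesis using ne by (auto simp: Q_def)
qed

end

section \<open>Attainment of the maximal height, and the image of the immersion\<close>

theorem theorem13:
  fixes P :: "('p::{t2_space, second_countable_topology}, 'e::euclidean_space) atlas"
    and \<sigma> :: "'p metric_field"
    and I :: "real set" and h :: "'p \<Rightarrow> real" and \<rho> :: "real \<Rightarrow> real"
    and M :: "('a::{t2_space, second_countable_topology}, 'e) atlas"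
    and \<psi> :: "'a \<Rightarrow> real \<times> 'p" and N :: "'a \<Rightarrow> (real \<times> 'p) tvec"
    and t0 :: real
  defines "Mbar \<equiv> product_atlas I P"
    and "gbar \<equiv> doubly_warped_metric P h \<rho> \<sigma>"
  assumes "doubly_warped_data I h \<rho> P \<sigma>"
    and "\<And>t. t \<in> I \<Longrightarrow> deriv \<rho> t \<ge> 0"
    and "spacelike_hypersurface M Mbar gbar \<psi>"
    and "complete_metric M (pullback_metric Mbar \<psi> gbar)"
    and "\<not> compact (carrier M)"
    and "connected (carrier M)"
    and "t0 \<in> I"
    and above: "\<And>x. x \<in> carrier M \<Longrightarrow> fst (\<psi> x) \<ge> t0"
    and asymptotic: "\<And>\<epsilon>. \<epsilon> > 0 \<Longrightarrow>
      \<exists>K. compact K \<and> K \<subseteq> carrier M \<and> (\<forall>x \<in> carrier M - K. \<bar>fst (\<psi> x) - t0\<bar> < \<epsilon>)"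
    and "future_unit_normal M I P gbar \<psi> N"
    and "\<And>x. x \<in> carrier M \<Longrightarrow>
      mean_curvature M Mbar gbar \<psi> N x \<ge>
        deriv \<rho> (fst (\<psi> x)) / (h (snd (\<psi> x)) * \<rho> (fst (\<psi> x)))"
  shows "\<psi> ` carrier M = {t0} \<times> carrier P"
proof -
  note data = assms(3) and \<rho>' = assms(4) and spacelike = assms(5) and compl = assms(6)
    and noncompact = assms(7) and conn = assms(8) and t0 = assms(9) and N = assms(12) and H = assms(13)
  note defs = Mbar_def gbar_def
  interpret hypersurface P I h \<rho> \<sigma> M \<psi>
  proof
    show "smooth_manifold P" using data by (simp add: doubly_warped_data_def)
  qed (use data spacelike in \<open>simp_all add: defs\<close>)
  note N' = N[unfolded defs] and H' = H[unfolded defs]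
  have const: "fst (\<psi> x) = t0" if x: "x \<in> carrier M" for x
  proof (rule ccontr)
    assume "fst (\<psi> x) \<noteq> t0"
    then have "fst (\<psi> x) - t0 > 0" using above[OF x] by simp
    \<comment> \<open>The tolerance is the excess of the height at \<open>x\<close> over
      \<open>t0\<close>, so outside \<open>K\<close> the height is below its value at
      \<open>x\<close>. The point \<open>x\<close> thus lies in \<open>K\<close>, and the maximum
      over \<open>K\<close> is global.\<close>
    from asymptotic[OF this] obtain K where K: "compact K" "K \<subseteq> carrier M"
      "\<forall>y\<in>carrier M - K. \<bar>fst (\<psi> y) - t0\<bar> < fst (\<psi> x) - t0"
      by (elim exE conjE)
    have out: "fst (\<psi> y) < fst (\<psi> x)" if "y \<in> carrier M" "y \<notin> K" for y
      using bspec[OF K(3), of y] that by simp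
    have xK: "x \<in> K" using out[OF x] by blast
    have "continuous_on K (\<lambda>p. fst (\<psi> p))"
      by (intro continuous_intros continuous_on_subset[OF psi.continuous_on_map K(2)])
    then obtain p where p: "p \<in> K" "\<And>y. y \<in> K \<Longrightarrow> fst (\<psi> y) \<le> fst (\<psi> p)"
      using continuous_attains_sup[OF K(1)] xK by blast
    have max: "fst (\<psi> y) \<le> fst (\<psi> p)" if "y \<in> carrier M" for y
      using p(2)[of y] p(2)[OF xK] out[OF that] by (cases "y \<in> K") simp_all
    have eq: "fst (\<psi> y) = fst (\<psi> p)" if "y \<in> carrier M" for y
      by (rule height_constant[OF N' conn \<rho>' H' _ max that]) (use p(1) K(2) in auto)
    \<comment> \<open>The constant height is at least the height at \<open>x\<close>, whereas points
      outside \<open>K\<close> lie strictly lower; hence nothing is left outside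
      \<open>K\<close>.\<close>
    have "y \<in> K" if "y \<in> carrier M" for y
      using out[OF that] eq[OF that] p(2)[OF xK] by (cases "y \<in> K") simp_all
    then have "carrier M = K" using K(2) by blast
    then show False using K(1) noncompact by simp
  qed
  interpret slice_hypersurface P I h \<rho> \<sigma> M \<psi> t0
    by unfold_locales (use const t0 in auto)
  have "carrier M \<noteq> {}" using noncompact by auto
  from surj_phi[OF compl[unfolded defs] this] have "(\<lambda>x. snd (\<psi> x)) ` carrier M = carrier P"
    by (simp add: comp_def)
  moreover have "\<psi> ` carrier M = {t0} \<times> (\<lambda>x. snd (\<psi> x)) ` carrier M"
    using const by (auto simp: image_iff prod_eq_iff)
  ultimately show ?thesis by simp
qed

end
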